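(* Let $k$ be a field. For any $k$-algebra $A$ and any ideal $I$ of $A$, we have: (i) $\sqrt[s]{I}=\{a\in A : I\cap \Sigma_a\neq\emptyset\}$; (ii) $\sqrt[s]{I}=\{b\in A : \exists m,n\in \mathbb N,\ \exists D(\bar x)\in \mathcal D,\ \exists \bar a\in A,\ b^mD(\bar a/b^n)\in I_b\}$; (iii) $\sqrt[s]{I}=\{b\in A : \exists m,n\in\mathbb N,\ \exists D(\bar x)\in \mathcal D,\ \exists \bar a\in A,\ b^mD^\#(\bar a,b^n)\in I\}$; (iv) $\sqrt[s]{I}=\{b\in A: \exists n\in \mathbb N,\ \exists D(\bar x)\in \mathcal D,\ \exists \bar a\in A,\ b^nD^\#(\bar a,b^n)\in I\}$; (v) $\sqrt[s]{I}=\{b\in A : \exists P(\bar x,y)\in \mathcal H,\ \exists \bar a\in A,\ \exists n\in\mathbb N,\ P(\bar a,b^n)\in I\}$.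
   Context: All rings are commutative and unital; $\mathbb N$ contains $0$; $\bar a\in A$ means a finite tuple of elements of $A$ of appropriate length. The algebraic signature $\mathcal D$ of $k$ is the set of all polynomials in finitely many variables over $k$ which have no zero rational in $k$ (nonzero constants included). For $D=\sum_{\bar i}a_{\bar i}\bar X^{\bar i}$ of total degree $d$, $D^\#(\bar X,Y)=\sum_{\bar i}a_{\bar i}\bar X^{\bar i}Y^{d-|\bar i|}$ is its homogenisation. The homogeneous signature $\mathcal H$ of $k$ is the set of all non-zero homogeneous polynomials $P(\bar X,Y)$ over $k$ in finitely many variables $\bar X=(X_1,\ldots,X_n)$ and a distinguished variable $Y$ such that for all $\bar a\in k^n$ and $b\in k$, $P(\bar a,b)=0$ implies $b=0$. An ideal $I$ of a $k$-algebra $A$ is special if for all $P(\bar X,Y)\in\mathcal H$ and $\bar a,b$ from $A$ such that $P(\bar a,b)\in I$, we have $b\in I$. The special radical $\sqrt[s]{I}$ of an ideal $I$ of $A$ is the intersection of all special prime ideals of $A$ containing $I$ (equal to $A$ if there are none). For $a\in A$, $\Sigma_a$ is the multiplicative subset of $A$ generated by all elements $a^mD^\#(\bar b,a^n)$ with $D\in\mathcal D$, $m,n\in\mathbb N$ and $\bar b$ an appropriate tuple from $A$. For $b\in A$, $A_b$ is the localisation of $A$ at the powers of $b$, and $I_b=IA_b$ is the ideal of $A_b$ generated by the image of $I$. *)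

theory Defs
  imports "HOL-Algebra.Algebra"
begin

text \<open>
  Polynomials are the indexed polynomials of HOL-Algebra: functions from monomials (multisets of
  variables) to coefficients. The variables \<open>X\<^sub>1, \<dots>, X\<^sub>r\<close> are the indices \<open>i < r\<close>; once the
  distinguished variable \<open>Y\<close> is present, \<open>X\<^sub>i\<close> becomes \<open>Some i\<close> and \<open>Y\<close> is \<open>None\<close>. A tuple of
  length \<open>r\<close> from \<open>A\<close> is a function in \<open>{..<r} \<rightarrow> carrier A\<close> (values outside \<open>{..<r}\<close> are
  irrelevant), and \<open>case_option b a\<close> assigns \<open>a i\<close> to \<open>X\<^sub>i\<close> and \<open>b\<close> to \<open>Y\<close>.
\<close>

definition poly_support :: "('k, 'x) ring_scheme \<Rightarrow> ('v multiset \<Rightarrow> 'k) \<Rightarrow> 'v multiset set"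
  where "poly_support K P = {m. P m \<noteq> \<zero>\<^bsub>K\<^esub>}"

definition poly_eval ::
  "('k, 'x) ring_scheme \<Rightarrow> ('k, 'a, 'y) module_scheme \<Rightarrow> ('v \<Rightarrow> 'a) \<Rightarrow> ('v multiset \<Rightarrow> 'k) \<Rightarrow> 'a"
  where "poly_eval K A x P =
    (\<Oplus>\<^bsub>A\<^esub> m \<in> poly_support K P.
      P m \<odot>\<^bsub>A\<^esub> (\<Otimes>\<^bsub>A\<^esub> i \<in> set_mset m. x i [^]\<^bsub>A\<^esub> count m i))"

text \<open>\<open>K\<close> as an algebra over itself, so that \<open>poly_eval\<close> also evaluates at points of \<open>K\<close>.\<close>

definition self_algebra :: "('k, 'x) ring_scheme \<Rightarrow> ('k, 'k) module"
  where "self_algebra K =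
    \<lparr>carrier = carrier K, monoid.mult = monoid.mult K, one = one K, ring.zero = ring.zero K, ring.add = ring.add K,
     smult = monoid.mult K\<rparr>"

definition total_degree :: "('k, 'x) ring_scheme \<Rightarrow> ('v multiset \<Rightarrow> 'k) \<Rightarrow> nat"
  where "total_degree K P = Max (size ` poly_support K P)"

definition homogeneous :: "('k, 'x) ring_scheme \<Rightarrow> ('v multiset \<Rightarrow> 'k) \<Rightarrow> bool"
  where "homogeneous K P \<longleftrightarrow> (\<exists>d. \<forall>m \<in> poly_support K P. size m = d)"

text \<open>The sum over \<open>m\<close> of \<open>D m \<cdot> X\<^sup>m \<cdot> Y ^ (d - size m)\<close>, where \<open>d\<close> is the total degree.\<close>

definition homogenisation ::
  "('k, 'x) ring_scheme \<Rightarrow> (nat multiset \<Rightarrow> 'k) \<Rightarrow> (nat option multiset \<Rightarrow> 'k)"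
  where "homogenisation K D = (\<lambda>M. \<Oplus>\<^bsub>K\<^esub> m \<in> poly_support K D.
    if M = image_mset Some m + replicate_mset (total_degree K D - size m) None
    then D m else \<zero>\<^bsub>K\<^esub>)"

definition alg_signature :: "('k, 'x) ring_scheme \<Rightarrow> nat \<Rightarrow> (nat multiset \<Rightarrow> 'k) set"
  where "alg_signature K r =
    {D \<in> ring.indexed_pset K {..<r} (carrier K).
      \<forall>a \<in> {..<r} \<rightarrow> carrier K. poly_eval K (self_algebra K) a D \<noteq> \<zero>\<^bsub>K\<^esub>}"

definition hom_signature :: "('k, 'x) ring_scheme \<Rightarrow> nat \<Rightarrow> (nat option multiset \<Rightarrow> 'k) set"
  where "hom_signature K r =
    {P \<in> ring.indexed_pset K (insert None (Some ` {..<r})) (carrier K).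
      P \<noteq> ring.indexed_const K \<zero>\<^bsub>K\<^esub> \<and> homogeneous K P \<and>
      (\<forall>a \<in> {..<r} \<rightarrow> carrier K. \<forall>b \<in> carrier K.
        poly_eval K (self_algebra K) (case_option b a) P = \<zero>\<^bsub>K\<^esub> \<longrightarrow> b = \<zero>\<^bsub>K\<^esub>)}"

definition special_ideal ::
  "('k, 'x) ring_scheme \<Rightarrow> ('k, 'a, 'y) module_scheme \<Rightarrow> 'a set \<Rightarrow> bool"
  where "special_ideal K A I \<longleftrightarrow> ideal I A \<and>
    (\<forall>r. \<forall>P \<in> hom_signature K r. \<forall>a \<in> {..<r} \<rightarrow> carrier A. \<forall>b \<in> carrier A.
      poly_eval K A (case_option b a) P \<in> I \<longrightarrow> b \<in> I)"

definition special_radical ::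
  "('k, 'x) ring_scheme \<Rightarrow> ('k, 'a, 'y) module_scheme \<Rightarrow> 'a set \<Rightarrow> 'a set"
  where "special_radical K A I =
    carrier A \<inter> \<Inter> {p. primeideal p A \<and> special_ideal K A p \<and> I \<subseteq> p}"

definition Sigma_gens ::
  "('k, 'x) ring_scheme \<Rightarrow> ('k, 'a, 'y) module_scheme \<Rightarrow> 'a \<Rightarrow> 'a set"
  where "Sigma_gens K A a =
    {a [^]\<^bsub>A\<^esub> m \<otimes>\<^bsub>A\<^esub> poly_eval K A (case_option (a [^]\<^bsub>A\<^esub> n) b) (homogenisation K D) |
      (m::nat) (n::nat) r D b. D \<in> alg_signature K r \<and> b \<in> {..<r} \<rightarrow> carrier A}"

definition Sigma_set ::
  "('k, 'x) ring_scheme \<Rightarrow> ('k, 'a, 'y) module_scheme \<Rightarrow> 'a \<Rightarrow> 'a set"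
  where "Sigma_set K A a = \<Inter> {S. submonoid S A \<and> Sigma_gens K A a \<subseteq> S}"

text \<open>
  Localisation of an algebra at a multiplicative subset \<open>S\<close>. Elements are equivalence classes of
  pairs \<open>(r, s)\<close>; an operation is the union of the classes obtained from all representatives, and
  these classes coincide.
\<close>

definition frac_rel :: "('a, 'x) ring_scheme \<Rightarrow> 'a set \<Rightarrow> (('a \<times> 'a) \<times> ('a \<times> 'a)) set"
  where "frac_rel A S =
    {((r, s), (r', s')) | r s r' s'. r \<in> carrier A \<and> r' \<in> carrier A \<and> s \<in> S \<and> s' \<in> S \<and>
      (\<exists>t \<in> S. t \<otimes>\<^bsub>A\<^esub> (r \<otimes>\<^bsub>A\<^esub> s' \<ominus>\<^bsub>A\<^esub> r' \<otimes>\<^bsub>A\<^esub> s) = \<zero>\<^bsub>A\<^esub>)}"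

definition frac :: "('a, 'x) ring_scheme \<Rightarrow> 'a set \<Rightarrow> 'a \<Rightarrow> 'a \<Rightarrow> ('a \<times> 'a) set"
  where "frac A S r s = frac_rel A S `` {(r, s)}"

definition localisation ::
  "('k, 'a, 'y) module_scheme \<Rightarrow> 'a set \<Rightarrow> ('k, ('a \<times> 'a) set) module"
  where "localisation A S =
    \<lparr>carrier = (carrier A \<times> S) // frac_rel A S,
     monoid.mult = (\<lambda>U V. \<Union>(r, s) \<in> U. \<Union>(r', s') \<in> V. frac A S (r \<otimes>\<^bsub>A\<^esub> r') (s \<otimes>\<^bsub>A\<^esub> s')),
     one = frac A S \<one>\<^bsub>A\<^esub> \<one>\<^bsub>A\<^esub>,
     ring.zero = frac A S \<zero>\<^bsub>A\<^esub> \<one>\<^bsub>A\<^esub>,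
     ring.add = (\<lambda>U V. \<Union>(r, s) \<in> U. \<Union>(r', s') \<in> V.
       frac A S (r \<otimes>\<^bsub>A\<^esub> s' \<oplus>\<^bsub>A\<^esub> r' \<otimes>\<^bsub>A\<^esub> s) (s \<otimes>\<^bsub>A\<^esub> s')),
     smult = (\<lambda>c U. \<Union>(r, s) \<in> U. frac A S (c \<odot>\<^bsub>A\<^esub> r) s)\<rparr>"

definition powers :: "('a, 'x) ring_scheme \<Rightarrow> 'a \<Rightarrow> 'a set"
  where "powers A b = range (\<lambda>n::nat. b [^]\<^bsub>A\<^esub> n)"

abbreviation localisation_at ::
  "('k, 'a, 'y) module_scheme \<Rightarrow> 'a \<Rightarrow> ('k, ('a \<times> 'a) set) module"
  where "localisation_at A b \<equiv> localisation A (powers A b)"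

abbreviation frac_at :: "('a, 'x) ring_scheme \<Rightarrow> 'a \<Rightarrow> 'a \<Rightarrow> 'a \<Rightarrow> ('a \<times> 'a) set"
  where "frac_at A b \<equiv> frac A (powers A b)"

definition localised_ideal ::
  "('k, 'a, 'y) module_scheme \<Rightarrow> 'a \<Rightarrow> 'a set \<Rightarrow> ('a \<times> 'a) set set"
  where "localised_ideal A b I =
    genideal (localisation_at A b) ((\<lambda>c. frac_at A b c \<one>\<^bsub>A\<^esub>) ` I)"

end

theory Submission
  imports Defs
begin

text \<open>
  Fix \<open>b\<close> and let \<open>V\<close> be the set of values \<open>P(a, b\<^sup>n)\<close> with \<open>P\<close> in the homogeneous signature.
  Everything reduces to: \<open>b\<close> lies in the special radical of \<open>I\<close> iff \<open>I\<close> meets \<open>V\<close>. Let \<open>S\<close> be the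
  saturation \<open>{s. \<exists>t. b\<^sup>t s \<in> V}\<close>. It is a submonoid, since after raising the exponents of \<open>b\<close> to a
  common value the product of two special forms in disjoint variables is special; and it is closed
  under \<open>s \<mapsto> P(a, s)\<close>, since for \<open>Q\<close> of degree \<open>e + 1\<close> the composite \<open>P(X Y\<^sup>e, Q(Z, Y))\<close> is again
  special. If \<open>I\<close> misses \<open>V\<close> then it misses \<open>S\<close>, and an ideal containing \<open>I\<close> and maximal among those
  disjoint from \<open>S\<close> is a special prime not containing \<open>b\<close>. The other descriptions follow because a
  special form is a power of \<open>Y\<close> times the homogenisation of its dehomogenisation.
\<close>

section \<open>Evaluation of monomials and polynomials\<close>

text \<open>Why \<open>S\<close> has to be closed under \<open>s \<mapsto> P(a, s)\<close>: let
  \<open>p\<close> contain \<open>I\<close> and be maximal among the ideals missing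
  \<open>S\<close>, and suppose that \<open>P(a, c)\<close> lies in \<open>p\<close> but
  \<open>c\<close> does not. Maximality gives \<open>s = x + e c\<close> in \<open>S\<close> with
  \<open>x\<close> in \<open>p\<close>. By homogeneity \<open>P(e a, e c) = e^d P(a, c)\<close> lies
  in \<open>p\<close>, and it is congruent modulo \<open>p\<close> to \<open>P(e a, s)\<close>,
  which lies in \<open>S\<close>: a contradiction.

  Why saturate: a form sees \<open>b\<close> only through a single value \<open>b^n\<close> of
  \<open>Y\<close>. Passing to another exponent means scaling all arguments, and homogeneity then
  multiplies the value by a power of \<open>b\<close>. So products and composites of values are
  values only up to such powers. An ideal absorbs them, so it meets \<open>S\<close> exactly when it
  meets \<open>V\<close>.

  Products and composites of polynomials are never written out in coefficients. A form is handled as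
  the pair of functions that one polynomial induces on \<open>K\<close> and on \<open>A\<close>: the
  first carries the no-zero condition, the second the values. Both are kept because over a finite
  field the function on \<open>K\<close> does not determine the polynomial.

  The field enters through division by \<open>b\<close> when homogenising and through the absence of
  zero divisors in products.\<close>

definition monomial_eval :: "('a, 'x) monoid_scheme \<Rightarrow> ('v \<Rightarrow> 'a) \<Rightarrow> 'v multiset \<Rightarrow> 'a"
  where "monomial_eval G x m = (\<Otimes>\<^bsub>G\<^esub> i \<in> set_mset m. x i [^]\<^bsub>G\<^esub> count m i)"

context comm_monoid
begin

text \<open>Absent variables have exponent 0 and contribute the factor 1, so monomials in different
  variables can be multiplied over one index set.\<close>

lemma monomial_eval_superset:
  assumes "finite S" "set_mset m \<subseteq> S" "x \<in> S \<rightarrow> carrier G"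
  shows "monomial_eval G x m = (\<Otimes>i \<in> S. x i [^] count m i)"
  unfolding monomial_eval_def
  by (rule finprod_mono_neutral_cong_left) (use assms in \<open>auto simp: not_in_iff\<close>)

lemma monomial_eval_closed [simp, intro]:
  "x \<in> set_mset m \<rightarrow> carrier G \<Longrightarrow> monomial_eval G x m \<in> carrier G"
  unfolding monomial_eval_def by (intro finprod_closed) auto

lemma monomial_eval_empty [simp]: "monomial_eval G x {#} = \<one>"
  by (simp add: monomial_eval_def)

lemma monomial_eval_union:
  assumes "x \<in> set_mset m \<rightarrow> carrier G" "x \<in> set_mset n \<rightarrow> carrier G"
  shows "monomial_eval G x (m + n) = monomial_eval G x m \<otimes> monomial_eval G x n"
proof -
  let ?S = "set_mset m \<union> set_mset n"
  have x: "x \<in> ?S \<rightarrow> carrier G" using assms by auto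
  have "monomial_eval G x (m + n) = (\<Otimes>i \<in> ?S. x i [^] count m i \<otimes> x i [^] count n i)"
    unfolding monomial_eval_superset[of ?S "m + n" x, OF _ _ x, simplified]
    by (rule finprod_cong') (use x in \<open>auto simp: nat_pow_mult Pi_iff\<close>)
  also have "\<dots> = monomial_eval G x m \<otimes> monomial_eval G x n"
    using x by (subst finprod_multf) (auto simp: monomial_eval_superset[of ?S] Pi_iff)
  finally show ?thesis .
qed

lemma monomial_eval_single [simp]: "x i \<in> carrier G \<Longrightarrow> monomial_eval G x {#i#} = x i"
  unfolding monomial_eval_def by simp

lemma monomial_eval_add_mset:
  assumes "x i \<in> carrier G" "x \<in> set_mset m \<rightarrow> carrier G"
  shows "monomial_eval G x (add_mset i m) = x i \<otimes> monomial_eval G x m"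
  using monomial_eval_union[of x "{#i#}" m] assms by simp

lemma monomial_eval_cong:
  "(\<And>i. i \<in># m \<Longrightarrow> x i = y i) \<Longrightarrow> y \<in> set_mset m \<rightarrow> carrier G \<Longrightarrow>
    monomial_eval G x m = monomial_eval G y m"
  unfolding monomial_eval_def by (intro finprod_cong') auto

lemma monomial_eval_image_mset:
  "x \<in> f ` set_mset m \<rightarrow> carrier G \<Longrightarrow>
    monomial_eval G x (image_mset f m) = monomial_eval G (\<lambda>i. x (f i)) m"
  by (induction m) (auto simp: monomial_eval_add_mset Pi_iff)

lemma monomial_eval_replicate_mset:
  "x i \<in> carrier G \<Longrightarrow> monomial_eval G x (replicate_mset n i) = x i [^] n"
  by (induction n) (auto simp: monomial_eval_add_mset m_comm)

text \<open>The source of every homogeneity statement below: each variable, counted with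
  multiplicity, contributes one factor \<open>y\<close>.\<close>

lemma monomial_eval_scale:
  assumes "y \<in> carrier G" "x \<in> set_mset m \<rightarrow> carrier G"
  shows "monomial_eval G (\<lambda>i. y \<otimes> x i) m = y [^] size m \<otimes> monomial_eval G x m"
  using assms(2)
proof (induction m)
  case (add i m)
  then show ?case
    using assms(1) by (auto simp: monomial_eval_add_mset Pi_iff nat_pow_Suc2 m_ac simp del: nat_pow_Suc)
qed (simp add: assms(1))

end

lemma (in ring_hom_cring) hom_monomial_eval:
  "x \<in> set_mset m \<rightarrow> carrier R \<Longrightarrow> h (monomial_eval R x m) = monomial_eval S (\<lambda>i. h (x i)) m"
  by (induction m) (auto simp: R.monomial_eval_add_mset S.monomial_eval_add_mset Pi_iff)

lemma poly_eval_monomial_eval: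
  "poly_eval K A x P = (\<Oplus>\<^bsub>A\<^esub> m \<in> poly_support K P. P m \<odot>\<^bsub>A\<^esub> monomial_eval A x m)"
  by (simp add: poly_eval_def monomial_eval_def)

section \<open>Indexed polynomials as finitely supported coefficient functions\<close>

context cring
begin

lemma poly_support_const: "poly_support R (indexed_const k) \<subseteq> {{#}}"
  by (auto simp: poly_support_def indexed_const_def split: if_splits)

text \<open>Indexed polynomials are generated inductively by constants, sums and multiplication by a
  variable. Together with the converse \<open>indexed_psetI\<close>, this allows working with
  supports and coefficients instead of generation.\<close>

lemma indexed_pset_supp:
  assumes "P \<in> indexed_pset V (carrier R)"
  shows "finite (poly_support R P)" "P m \<in> carrier R"
    "m \<in> poly_support R P \<Longrightarrow> set_mset m \<subseteq> V"
proof -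
  have "finite (poly_support R P) \<and> (\<forall>m \<in> poly_support R P. set_mset m \<subseteq> V)"
    using assms
  proof (induction)
    case (indexed_const k)
    then show ?case using poly_support_const[of k] by (auto intro: finite_subset)
  next
    case (indexed_padd P Q)
    have "poly_support R (P \<Oplus> Q) \<subseteq> poly_support R P \<union> poly_support R Q"
      by (auto simp: poly_support_def indexed_padd_def)
    with indexed_padd show ?case
      using finite_subset[of "poly_support R (P \<Oplus> Q)" "poly_support R P \<union> poly_support R Q"] by blast
  next
    case (indexed_pmult P i)
    \<comment> \<open>Multiplication by a variable only translates the support.\<close>
    have sub: "poly_support R (P \<Otimes> i) \<subseteq> add_mset i ` poly_support R P"
    proof
      fix n assume "n \<in> poly_support R (P \<Otimes> i)"
      then have "n = add_mset i (n - {#i#})" "n - {#i#} \<in> poly_support R P"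
        by (auto simp: poly_support_def indexed_pmult_def split: if_splits)
      then show "n \<in> add_mset i ` poly_support R P" by (rule image_eqI)
    qed
    with indexed_pmult have "finite (poly_support R (P \<Otimes> i))" by (meson finite_imageI finite_subset)
    moreover have "set_mset n \<subseteq> V" if n: "n \<in> poly_support R (P \<Otimes> i)" for n
    proof -
      obtain m where "n = add_mset i m" "m \<in> poly_support R P" using subsetD[OF sub n] by blast
      with indexed_pmult show ?thesis by simp
    qed
    ultimately show ?case by blast
  qed
  then show "finite (poly_support R P)" "m \<in> poly_support R P \<Longrightarrow> set_mset m \<subseteq> V" by auto
  show "P m \<in> carrier R"
    using indexed_pset_in_carrier[OF _ assms] by (simp add: carrier_coeff_def)
qed

lemma indexed_monomial:
  assumes "k \<in> carrier R" "set_mset m \<subseteq> V"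
  shows "(\<lambda>n. if n = m then k else \<zero>) \<in> indexed_pset V (carrier R)"
  using assms(2)
proof (induction m)
  case empty
  show ?case using indexed_pset.indexed_const[of k "carrier R" V] assms(1)
    by (simp add: indexed_const_def)
next
  case (add i m)
  then have "(\<lambda>n. if n = m then k else \<zero>) \<Otimes> i \<in> indexed_pset V (carrier R)"
    by (intro indexed_pset.indexed_pmult) auto
  also have "(\<lambda>n. if n = m then k else \<zero>) \<Otimes> i = (\<lambda>n. if n = add_mset i m then k else \<zero>)"
  proof (rule ext)
    fix n
    have "i \<in># n \<and> n - {#i#} = m \<longleftrightarrow> n = add_mset i m" by auto
    then show "((\<lambda>n. if n = m then k else \<zero>) \<Otimes> i) n = (if n = add_mset i m then k else \<zero>)"
      unfolding indexed_pmult_def by presburger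
  qed
  finally show ?case .
qed

text \<open>Induction on a finite set containing the support, splitting off one monomial at a time.
  The set is allowed to be larger than the support so that the polynomial with one coefficient
  erased fits the induction hypothesis.\<close>

lemma indexed_psetI:
  assumes "finite (poly_support R P)" "\<And>m. P m \<in> carrier R"
    "\<And>m. m \<in> poly_support R P \<Longrightarrow> set_mset m \<subseteq> V"
  shows "P \<in> indexed_pset V (carrier R)"
proof -
  have "P \<in> indexed_pset V (carrier R)"
    if "finite S" "poly_support R P \<subseteq> S" "\<And>m. P m \<in> carrier R" "\<And>m. m \<in> S \<Longrightarrow> set_mset m \<subseteq> V" for S P
    using that
  proof (induction S arbitrary: P)
    case empty
    then have "P = indexed_const \<zero>" by (auto simp: poly_support_def indexed_const_def)
    then show ?case by (simp add: indexed_pset.indexed_const)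
  next
    case (insert m S)
    let ?Q = "\<lambda>n. if n = m then \<zero> else P n" and ?M = "\<lambda>n. if n = m then P m else \<zero>"
    have "?Q \<in> indexed_pset V (carrier R)"
      using insert.prems by (intro insert.IH) (auto simp: poly_support_def)
    moreover have "?M \<in> indexed_pset V (carrier R)"
      using insert.prems by (intro indexed_monomial) auto
    ultimately have "?Q \<Oplus> ?M \<in> indexed_pset V (carrier R)" by (rule indexed_pset.indexed_padd)
    also have "?Q \<Oplus> ?M = P" using insert.prems(2) by (auto simp: indexed_padd_def fun_eq_iff)
    finally show ?case .
  qed
  from this[OF assms(1) subset_refl assms(2,3)] show ?thesis .
qed

end

section \<open>Evaluation in an algebra\<close>

lemma self_algebra_simps [simp]:
  "carrier (self_algebra K) = carrier K" "\<zero>\<^bsub>self_algebra K\<^esub> = \<zero>\<^bsub>K\<^esub>"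
  "\<one>\<^bsub>self_algebra K\<^esub> = \<one>\<^bsub>K\<^esub>" "monoid.mult (self_algebra K) = monoid.mult K"
  "ring.add (self_algebra K) = ring.add K" "smult (self_algebra K) = monoid.mult K"
  by (auto simp: self_algebra_def)

lemma self_algebra_pow [simp]: "x [^]\<^bsub>self_algebra K\<^esub> (n::nat) = x [^]\<^bsub>K\<^esub> n"
  by (simp add: nat_pow_def)

lemma (in cring) algebra_self: "algebra R (self_algebra R)"
proof -
  have "abelian_group (self_algebra R)"
  proof (rule abelian_groupI)
    fix x assume "x \<in> carrier (self_algebra R)"
    then show "\<exists>y\<in>carrier (self_algebra R). y \<oplus>\<^bsub>self_algebra R\<^esub> x = \<zero>\<^bsub>self_algebra R\<^esub>"
      using l_neg a_inv_closed by fastforce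
  qed (simp_all add: a_ac)
  moreover have "comm_monoid (self_algebra R)"
    by (rule comm_monoidI) (simp_all add: m_ac)
  ultimately have "cring (self_algebra R)"
    by (rule cringI) (simp add: l_distr)
  then show ?thesis
    by (rule algebraI[OF is_cring]) (simp_all add: l_distr r_distr m_assoc)
qed

lemma (in cring) indexed_pset_smult:
  assumes "c \<in> carrier R" "P \<in> indexed_pset V (carrier R)"
  shows "(\<lambda>m. c \<otimes> P m) \<in> indexed_pset V (carrier R)"
proof (rule indexed_psetI)
  have sub: "poly_support R (\<lambda>m. c \<otimes> P m) \<subseteq> poly_support R P"
    using assms by (auto simp: poly_support_def)
  then show "finite (poly_support R (\<lambda>m. c \<otimes> P m))"
    using indexed_pset_supp(1)[OF assms(2)] by (rule finite_subset)
  show "set_mset m \<subseteq> V" if "m \<in> poly_support R (\<lambda>m. c \<otimes> P m)" for m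
    using indexed_pset_supp(3)[OF assms(2)] sub that by blast
qed (use assms indexed_pset_supp(2)[OF assms(2)] in auto)

locale k_algebra = K: cring K + A: cring A + algebra K A
  for K :: "('k, 'x) ring_scheme" (structure) and A :: "('k, 'a, 'y) module_scheme" (structure)

lemma k_algebraI: "algebra K A \<Longrightarrow> k_algebra K A"
  by (simp add: k_algebra_def algebra.R_cring algebra.M_cring)

context k_algebra
begin

text \<open>Terms with coefficient zero add nothing. This is needed because cancellation can make
  the support of a sum or of a scalar multiple smaller than expected, while the computations want
  one fixed index set.\<close>

lemma poly_eval_superset:
  assumes P: "P \<in> K.indexed_pset V (carrier K)" and S: "finite S" "poly_support K P \<subseteq> S"
    "\<And>m. m \<in> S \<Longrightarrow> set_mset m \<subseteq> V" and x: "x \<in> V \<rightarrow> carrier A"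
  shows "poly_eval K A x P = (\<Oplus>\<^bsub>A\<^esub> m \<in> S. P m \<odot>\<^bsub>A\<^esub> monomial_eval A x m)"
  unfolding poly_eval_monomial_eval
proof (rule A.add.finprod_mono_neutral_cong_left)
  have mon: "monomial_eval A x m \<in> carrier A" if "m \<in> S" for m
    using S(3)[OF that] x by (intro A.monomial_eval_closed) auto
  with K.indexed_pset_supp(2)[OF P]
  show "(\<lambda>m. P m \<odot>\<^bsub>A\<^esub> monomial_eval A x m) \<in> S \<rightarrow> carrier A" by auto
  show "P m \<odot>\<^bsub>A\<^esub> monomial_eval A x m = \<zero>\<^bsub>A\<^esub>" if "m \<in> S - poly_support K P" for m
    using that mon by (auto simp: poly_support_def)
qed (use S in auto)

lemma poly_eval_term_closed:
  assumes "P \<in> K.indexed_pset V (carrier K)" "x \<in> V \<rightarrow> carrier A" "m \<in> poly_support K P"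
  shows "monomial_eval A x m \<in> carrier A" "P m \<odot>\<^bsub>A\<^esub> monomial_eval A x m \<in> carrier A"
proof -
  show "monomial_eval A x m \<in> carrier A"
    using K.indexed_pset_supp(3)[OF assms(1,3)] assms(2) by (intro A.monomial_eval_closed) auto
  then show "P m \<odot>\<^bsub>A\<^esub> monomial_eval A x m \<in> carrier A"
    using K.indexed_pset_supp(2)[OF assms(1)] by auto
qed

lemma poly_eval_closed:
  assumes "P \<in> K.indexed_pset V (carrier K)" "x \<in> V \<rightarrow> carrier A"
  shows "poly_eval K A x P \<in> carrier A"
  unfolding poly_eval_monomial_eval
  by (intro A.finsum_closed) (use poly_eval_term_closed[OF assms] in auto)

lemma poly_eval_cong:
  assumes "P \<in> K.indexed_pset V (carrier K)" "y \<in> V \<rightarrow> carrier A" "\<And>i. i \<in> V \<Longrightarrow> x i = y i"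
  shows "poly_eval K A x P = poly_eval K A y P"
  unfolding poly_eval_monomial_eval
proof (rule A.finsum_cong')
  show "P m \<odot>\<^bsub>A\<^esub> monomial_eval A x m = P m \<odot>\<^bsub>A\<^esub> monomial_eval A y m"
    if "m \<in> poly_support K P" for m
    using K.indexed_pset_supp(3)[OF assms(1) that] assms(2,3)
    by (subst A.monomial_eval_cong[of m x y]) auto
qed (use poly_eval_term_closed[OF assms(1,2)] in auto)

lemma poly_eval_padd:
  assumes P: "P \<in> K.indexed_pset V (carrier K)" and Q: "Q \<in> K.indexed_pset V (carrier K)"
    and x: "x \<in> V \<rightarrow> carrier A"
  shows "poly_eval K A x (K.indexed_padd P Q) = poly_eval K A x P \<oplus>\<^bsub>A\<^esub> poly_eval K A x Q"
proof -
  let ?S = "poly_support K P \<union> poly_support K Q"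
  have S: "finite ?S" "\<And>m. m \<in> ?S \<Longrightarrow> set_mset m \<subseteq> V"
    using K.indexed_pset_supp(1,3)[OF P] K.indexed_pset_supp(1,3)[OF Q] by blast+
  have sub: "poly_support K (K.indexed_padd P Q) \<subseteq> ?S"
    by (auto simp: poly_support_def K.indexed_padd_def)
  have mon: "monomial_eval A x m \<in> carrier A" if "m \<in> ?S" for m
    using S(2)[OF that] x by (intro A.monomial_eval_closed) auto
  note coeff = K.indexed_pset_supp(2)[OF P] K.indexed_pset_supp(2)[OF Q]
  have "poly_eval K A x (K.indexed_padd P Q)
      = (\<Oplus>\<^bsub>A\<^esub> m \<in> ?S. K.indexed_padd P Q m \<odot>\<^bsub>A\<^esub> monomial_eval A x m)"
    by (rule poly_eval_superset[OF K.indexed_pset.indexed_padd[OF P Q] S(1) sub S(2) x])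
  also have "\<dots> = (\<Oplus>\<^bsub>A\<^esub> m \<in> ?S. P m \<odot>\<^bsub>A\<^esub> monomial_eval A x m \<oplus>\<^bsub>A\<^esub> Q m \<odot>\<^bsub>A\<^esub> monomial_eval A x m)"
    by (rule A.finsum_cong') (use coeff mon in \<open>auto simp: K.indexed_padd_def smult_l_distr\<close>)
  also have "\<dots> = (\<Oplus>\<^bsub>A\<^esub> m \<in> ?S. P m \<odot>\<^bsub>A\<^esub> monomial_eval A x m) \<oplus>\<^bsub>A\<^esub>
      (\<Oplus>\<^bsub>A\<^esub> m \<in> ?S. Q m \<odot>\<^bsub>A\<^esub> monomial_eval A x m)"
    by (rule A.finsum_addf) (use coeff mon in auto)
  also have "(\<Oplus>\<^bsub>A\<^esub> m \<in> ?S. P m \<odot>\<^bsub>A\<^esub> monomial_eval A x m) = poly_eval K A x P"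
    by (rule poly_eval_superset[symmetric, OF P S(1) _ S(2) x]) auto
  also have "(\<Oplus>\<^bsub>A\<^esub> m \<in> ?S. Q m \<odot>\<^bsub>A\<^esub> monomial_eval A x m) = poly_eval K A x Q"
    by (rule poly_eval_superset[symmetric, OF Q S(1) _ S(2) x]) auto
  finally show ?thesis .
qed

lemma smult_mult_left:
  assumes "c \<in> carrier K" "x \<in> carrier A" "y \<in> carrier A"
  shows "x \<otimes>\<^bsub>A\<^esub> (c \<odot>\<^bsub>A\<^esub> y) = c \<odot>\<^bsub>A\<^esub> (x \<otimes>\<^bsub>A\<^esub> y)"
  using assms smult_assoc2[of c y x] by (simp add: A.m_comm)

text \<open>Adding one copy of \<open>i\<close> is injective on monomials, so no terms merge: the
  sum is reindexed and \<open>x i\<close> is pulled out.\<close>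

lemma poly_eval_pmult:
  assumes P: "P \<in> K.indexed_pset V (carrier K)" and i: "i \<in> V" and x: "x \<in> V \<rightarrow> carrier A"
  shows "poly_eval K A x (K.indexed_pmult P i) = x i \<otimes>\<^bsub>A\<^esub> poly_eval K A x P"
proof -
  have "inj_on (add_mset i) (poly_support K P)" by (auto intro: inj_onI)
  moreover have supp: "poly_support K (K.indexed_pmult P i) = add_mset i ` poly_support K P"
  proof
    show "poly_support K (K.indexed_pmult P i) \<subseteq> add_mset i ` poly_support K P"
    proof
      fix n assume "n \<in> poly_support K (K.indexed_pmult P i)"
      then have "n = add_mset i (n - {#i#})" "n - {#i#} \<in> poly_support K P"
        by (auto simp: poly_support_def K.indexed_pmult_def split: if_splits)
      then show "n \<in> add_mset i ` poly_support K P" by (rule image_eqI)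
    qed
  qed (auto simp: poly_support_def K.indexed_pmult_def)
  moreover have "K.indexed_pmult P i (add_mset i m) = P m" for m
    by (simp add: K.indexed_pmult_def)
  ultimately have "poly_eval K A x (K.indexed_pmult P i) =
      (\<Oplus>\<^bsub>A\<^esub> m \<in> poly_support K P. P m \<odot>\<^bsub>A\<^esub> monomial_eval A x (add_mset i m))"
    using poly_eval_term_closed(2)[OF K.indexed_pset.indexed_pmult[OF P i] x]
    unfolding poly_eval_monomial_eval by (simp add: A.finsum_reindex Pi_iff)
  also have "\<dots> = (\<Oplus>\<^bsub>A\<^esub> m \<in> poly_support K P. x i \<otimes>\<^bsub>A\<^esub> (P m \<odot>\<^bsub>A\<^esub> monomial_eval A x m))"
  proof (rule A.finsum_cong')
    fix m assume m: "m \<in> poly_support K P"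
    have "x \<in> set_mset m \<rightarrow> carrier A" "x i \<in> carrier A"
      using K.indexed_pset_supp(3)[OF P m] x i by auto
    then show "P m \<odot>\<^bsub>A\<^esub> monomial_eval A x (add_mset i m) = x i \<otimes>\<^bsub>A\<^esub> (P m \<odot>\<^bsub>A\<^esub> monomial_eval A x m)"
      using K.indexed_pset_supp(2)[OF P]
      by (simp add: A.monomial_eval_add_mset smult_mult_left)
  qed (use poly_eval_term_closed[OF P x] x i in auto)
  also have "\<dots> = x i \<otimes>\<^bsub>A\<^esub> poly_eval K A x P"
    unfolding poly_eval_monomial_eval
    by (rule A.finsum_rdistr[symmetric])
      (use K.indexed_pset_supp(1)[OF P] poly_eval_term_closed[OF P x] x i in auto)
  finally show ?thesis .
qed

lemma poly_eval_smult:
  assumes P: "P \<in> K.indexed_pset V (carrier K)" and c: "c \<in> carrier K" and x: "x \<in> V \<rightarrow> carrier A"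
  shows "poly_eval K A x (\<lambda>m. c \<otimes> P m) = c \<odot>\<^bsub>A\<^esub> poly_eval K A x P"
proof -
  have "poly_eval K A x (\<lambda>m. c \<otimes> P m) =
      (\<Oplus>\<^bsub>A\<^esub> m \<in> poly_support K P. (c \<otimes> P m) \<odot>\<^bsub>A\<^esub> monomial_eval A x m)"
    using K.indexed_pset_supp[OF P] x c
    by (intro poly_eval_superset[OF K.indexed_pset_smult[OF c P]]) (auto simp: poly_support_def)
  also have "\<dots> = (\<Oplus>\<^bsub>A\<^esub> m \<in> poly_support K P. c \<odot>\<^bsub>A\<^esub> (P m \<odot>\<^bsub>A\<^esub> monomial_eval A x m))"
    using K.indexed_pset_supp(2)[OF P] poly_eval_term_closed[OF P x] c
    by (intro A.finsum_cong') (auto simp: smult_assoc1)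
  also have "\<dots> = c \<odot>\<^bsub>A\<^esub> poly_eval K A x P"
    unfolding poly_eval_monomial_eval
    using K.indexed_pset_supp(1)[OF P] poly_eval_term_closed[OF P x] c
    by (intro finsum_smult_ldistr[symmetric]) auto
  finally show ?thesis .
qed

lemma poly_eval_const:
  assumes "k \<in> carrier K"
  shows "poly_eval K A x (K.indexed_const k) = k \<odot>\<^bsub>A\<^esub> \<one>\<^bsub>A\<^esub>"
proof -
  have "poly_eval K A x (K.indexed_const k) =
      (\<Oplus>\<^bsub>A\<^esub> m \<in> {{#}}. K.indexed_const k m \<odot>\<^bsub>A\<^esub> monomial_eval A x m)"
    by (rule poly_eval_superset[of _ "{}"])
      (use assms K.poly_support_const K.indexed_pset.indexed_const in auto)
  with assms show ?thesis by (simp add: K.indexed_const_def)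
qed

text \<open>All monomials have the same size \<open>d\<close>, so each term yields the same factor
  \<open>y^d\<close>.\<close>

lemma poly_eval_scale:
  assumes P: "P \<in> K.indexed_pset V (carrier K)" and d: "\<And>m. m \<in> poly_support K P \<Longrightarrow> size m = d"
    and x: "x \<in> V \<rightarrow> carrier A" and y: "y \<in> carrier A"
  shows "poly_eval K A (\<lambda>i. y \<otimes>\<^bsub>A\<^esub> x i) P = y [^]\<^bsub>A\<^esub> d \<otimes>\<^bsub>A\<^esub> poly_eval K A x P"
proof -
  have "poly_eval K A (\<lambda>i. y \<otimes>\<^bsub>A\<^esub> x i) P =
      (\<Oplus>\<^bsub>A\<^esub> m \<in> poly_support K P. y [^]\<^bsub>A\<^esub> d \<otimes>\<^bsub>A\<^esub> (P m \<odot>\<^bsub>A\<^esub> monomial_eval A x m))"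
    unfolding poly_eval_monomial_eval
  proof (rule A.finsum_cong')
    fix m assume m: "m \<in> poly_support K P"
    have "x \<in> set_mset m \<rightarrow> carrier A" using K.indexed_pset_supp(3)[OF P m] x by auto
    then show "P m \<odot>\<^bsub>A\<^esub> monomial_eval A (\<lambda>i. y \<otimes>\<^bsub>A\<^esub> x i) m
        = y [^]\<^bsub>A\<^esub> d \<otimes>\<^bsub>A\<^esub> (P m \<odot>\<^bsub>A\<^esub> monomial_eval A x m)"
      using K.indexed_pset_supp(2)[OF P] y d[OF m]
      by (simp add: A.monomial_eval_scale smult_mult_left)
  qed (use poly_eval_term_closed[OF P x] y in auto)
  also have "\<dots> = y [^]\<^bsub>A\<^esub> d \<otimes>\<^bsub>A\<^esub> poly_eval K A x P"
    unfolding poly_eval_monomial_eval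
    by (rule A.finsum_rdistr[symmetric])
      (use K.indexed_pset_supp(1)[OF P] poly_eval_term_closed[OF P x] y in auto)
  finally show ?thesis .
qed

text \<open>Used for the map from \<open>A\<close> to its localisation, to carry values of
  homogenised polynomials there.\<close>

lemma poly_eval_hom:
  assumes N: "algebra K N" and h: "h \<in> ring_hom A N"
    and smult: "\<And>c x. c \<in> carrier K \<Longrightarrow> x \<in> carrier A \<Longrightarrow> h (c \<odot>\<^bsub>A\<^esub> x) = c \<odot>\<^bsub>N\<^esub> h x"
    and P: "P \<in> K.indexed_pset V (carrier K)" and x: "x \<in> V \<rightarrow> carrier A"
  shows "h (poly_eval K A x P) = poly_eval K N (\<lambda>i. h (x i)) P"
proof -
  interpret N: k_algebra K N by (rule k_algebraI[OF N])
  interpret h: ring_hom_cring A N h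
    by (rule ring_hom_cring.intro[OF M_cring N.M_cring]) (simp add: ring_hom_cring_axioms_def h)
  have hx: "(\<lambda>i. h (x i)) \<in> V \<rightarrow> carrier N" using x by auto
  have "h (poly_eval K A x P) = (\<Oplus>\<^bsub>N\<^esub> m \<in> poly_support K P. h (P m \<odot>\<^bsub>A\<^esub> monomial_eval A x m))"
    unfolding poly_eval_monomial_eval using poly_eval_term_closed[OF P x]
    by (subst h.hom_finsum) (auto simp: o_def)
  also have "\<dots> = poly_eval K N (\<lambda>i. h (x i)) P"
    unfolding poly_eval_monomial_eval
  proof (rule N.A.finsum_cong')
    fix m assume m: "m \<in> poly_support K P"
    have "x \<in> set_mset m \<rightarrow> carrier A" using K.indexed_pset_supp(3)[OF P m] x by auto
    then show "h (P m \<odot>\<^bsub>A\<^esub> monomial_eval A x m) = P m \<odot>\<^bsub>N\<^esub> monomial_eval N (\<lambda>i. h (x i)) m"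
      using K.indexed_pset_supp(2)[OF P] by (simp add: smult h.hom_monomial_eval)
  qed (use N.poly_eval_term_closed[OF P hx] in auto)
  finally show ?thesis .
qed

end

section \<open>Homogeneous polynomial functions\<close>

lemma finsum_self [simp]: "finsum (self_algebra K) = finsum K"
  by (simp add: finsum_def finprod_def fun_eq_iff)

lemma monomial_eval_self [simp]: "monomial_eval (self_algebra K) = monomial_eval K"
  by (simp add: monomial_eval_def finprod_def fun_eq_iff)

lemma (in cring) k_algebra_self: "k_algebra R (self_algebra R)"
  by (rule k_algebraI[OF algebra_self])

context k_algebra
begin

interpretation self: k_algebra K "self_algebra K"
  by (rule K.k_algebra_self)

text \<open>One polynomial must witness both functions, and they are prescribed only on tuples with
  values in the carriers at the indices in \<open>V\<close>. The zero polynomial counts as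
  homogeneous of every degree, so sums of forms of degree \<open>d\<close>, even empty ones or ones
  that cancel, stay of degree \<open>d\<close>.\<close>

definition form :: "'v set \<Rightarrow> nat \<Rightarrow> (('v \<Rightarrow> 'k) \<Rightarrow> 'k) \<Rightarrow> (('v \<Rightarrow> 'a) \<Rightarrow> 'a) \<Rightarrow> bool"
  where "form V d f g \<longleftrightarrow> (\<exists>P \<in> K.indexed_pset V (carrier K).
    (\<forall>m \<in> poly_support K P. size m = d) \<and>
    (\<forall>x \<in> V \<rightarrow> carrier K. f x = poly_eval K (self_algebra K) x P) \<and>
    (\<forall>x \<in> V \<rightarrow> carrier A. g x = poly_eval K A x P))"

lemma formI:
  assumes "P \<in> K.indexed_pset V (carrier K)" "\<And>m. m \<in> poly_support K P \<Longrightarrow> size m = d"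
    "\<And>x. x \<in> V \<rightarrow> carrier K \<Longrightarrow> f x = poly_eval K (self_algebra K) x P"
    "\<And>x. x \<in> V \<rightarrow> carrier A \<Longrightarrow> g x = poly_eval K A x P"
  shows "form V d f g"
  using assms unfolding form_def by blast

lemma formE:
  assumes "form V d f g"
  obtains P where "P \<in> K.indexed_pset V (carrier K)" "\<And>m. m \<in> poly_support K P \<Longrightarrow> size m = d"
    "\<And>x. x \<in> V \<rightarrow> carrier K \<Longrightarrow> f x = poly_eval K (self_algebra K) x P"
    "\<And>x. x \<in> V \<rightarrow> carrier A \<Longrightarrow> g x = poly_eval K A x P"
  using assms unfolding form_def by blast

lemma form_closed:
  assumes "form V d f g"
  shows "x \<in> V \<rightarrow> carrier K \<Longrightarrow> f x \<in> carrier K" "y \<in> V \<rightarrow> carrier A \<Longrightarrow> g y \<in> carrier A"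
  using assms self.poly_eval_closed poly_eval_closed by (auto elim!: formE)

lemma form_cong:
  assumes "form V d f g" "d = d'" "\<And>x. x \<in> V \<rightarrow> carrier K \<Longrightarrow> f' x = f x"
    "\<And>x. x \<in> V \<rightarrow> carrier A \<Longrightarrow> g' x = g x"
  shows "form V d' f' g'"
  using assms unfolding form_def by simp

lemma form_const:
  assumes "c \<in> carrier K"
  shows "form V 0 (\<lambda>_. c) (\<lambda>_. c \<odot>\<^bsub>A\<^esub> \<one>\<^bsub>A\<^esub>)"
  by (rule formI[of "K.indexed_const c"])
    (use assms K.poly_support_const[of c] in
      \<open>auto intro: K.indexed_pset.indexed_const simp: poly_eval_const self.poly_eval_const\<close>)

lemma form_zero: "form V d (\<lambda>_. \<zero>) (\<lambda>_. \<zero>\<^bsub>A\<^esub>)"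
  by (rule formI[of "\<lambda>_. \<zero>"])
    (auto intro: K.indexed_psetI simp: poly_eval_def poly_support_def)

lemma form_add:
  assumes "form V d f g" "form V d f' g'"
  shows "form V d (\<lambda>x. f x \<oplus> f' x) (\<lambda>x. g x \<oplus>\<^bsub>A\<^esub> g' x)"
proof -
  obtain P where P: "P \<in> K.indexed_pset V (carrier K)" "\<And>m. m \<in> poly_support K P \<Longrightarrow> size m = d"
    "\<And>x. x \<in> V \<rightarrow> carrier K \<Longrightarrow> f x = poly_eval K (self_algebra K) x P"
    "\<And>x. x \<in> V \<rightarrow> carrier A \<Longrightarrow> g x = poly_eval K A x P"
    using assms(1) unfolding form_def by blast
  obtain Q where Q: "Q \<in> K.indexed_pset V (carrier K)" "\<And>m. m \<in> poly_support K Q \<Longrightarrow> size m = d"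
    "\<And>x. x \<in> V \<rightarrow> carrier K \<Longrightarrow> f' x = poly_eval K (self_algebra K) x Q"
    "\<And>x. x \<in> V \<rightarrow> carrier A \<Longrightarrow> g' x = poly_eval K A x Q"
    using assms(2) unfolding form_def by blast
  have "m \<in> poly_support K P \<or> m \<in> poly_support K Q" if "m \<in> poly_support K (K.indexed_padd P Q)" for m
    using that by (auto simp: poly_support_def K.indexed_padd_def)
  with P(2) Q(2) have "size m = d" if "m \<in> poly_support K (K.indexed_padd P Q)" for m
    using that by blast
  then show ?thesis
    by (rule formI[OF K.indexed_pset.indexed_padd[OF P(1) Q(1)]])
      (simp_all add: P(3,4) Q(3,4) poly_eval_padd[OF P(1) Q(1)] self.poly_eval_padd[OF P(1) Q(1)])
qed

lemma form_var_mult: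
  assumes "form V d f g" "i \<in> V"
  shows "form V (Suc d) (\<lambda>x. x i \<otimes> f x) (\<lambda>x. x i \<otimes>\<^bsub>A\<^esub> g x)"
proof -
  obtain P where P: "P \<in> K.indexed_pset V (carrier K)" "\<And>m. m \<in> poly_support K P \<Longrightarrow> size m = d"
    "\<And>x. x \<in> V \<rightarrow> carrier K \<Longrightarrow> f x = poly_eval K (self_algebra K) x P"
    "\<And>x. x \<in> V \<rightarrow> carrier A \<Longrightarrow> g x = poly_eval K A x P"
    using assms(1) unfolding form_def by blast
  have "size m = Suc d" if m: "m \<in> poly_support K (K.indexed_pmult P i)" for m
  proof -
    from m have "i \<in># m" "m - {#i#} \<in> poly_support K P"
      by (auto simp: poly_support_def K.indexed_pmult_def split: if_splits)
    then show ?thesis using P(2) by (metis size_Suc_Diff1)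
  qed
  then show ?thesis
    by (rule formI[OF K.indexed_pset.indexed_pmult[OF P(1) assms(2)]])
      (simp_all add: P(3,4) poly_eval_pmult[OF P(1) assms(2)] self.poly_eval_pmult[OF P(1) assms(2)])
qed

lemma form_smult:
  assumes "form V d f g" "c \<in> carrier K"
  shows "form V d (\<lambda>x. c \<otimes> f x) (\<lambda>x. c \<odot>\<^bsub>A\<^esub> g x)"
proof -
  obtain P where P: "P \<in> K.indexed_pset V (carrier K)" "\<And>m. m \<in> poly_support K P \<Longrightarrow> size m = d"
    "\<And>x. x \<in> V \<rightarrow> carrier K \<Longrightarrow> f x = poly_eval K (self_algebra K) x P"
    "\<And>x. x \<in> V \<rightarrow> carrier A \<Longrightarrow> g x = poly_eval K A x P"
    using assms(1) unfolding form_def by blast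
  have "size m = d" if "m \<in> poly_support K (\<lambda>m. c \<otimes> P m)" for m
    using that assms(2) by (intro P(2)) (auto simp: poly_support_def)
  then show ?thesis
    by (rule formI[OF K.indexed_pset_smult[OF assms(2) P(1)]])
      (simp_all add: P(3,4) poly_eval_smult[OF P(1) assms(2)] self.poly_eval_smult[OF P(1) assms(2)])
qed

text \<open>A bridge to \<open>form_mult\<close>: the polynomial type offers multiplication by
  single variables, from which multiplication by monomials and then, by linearity, by arbitrary
  forms is built.\<close>

lemma form_monomial_mult:
  assumes "form V d f g" "set_mset m \<subseteq> V"
  shows "form V (size m + d) (\<lambda>x. monomial_eval K x m \<otimes> f x) (\<lambda>x. monomial_eval A x m \<otimes>\<^bsub>A\<^esub> g x)"
  using assms(2)
proof (induction m)
  case empty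
  show ?case by (rule form_cong[OF assms(1)]) (auto simp: form_closed[OF assms(1)])
next
  case (add i m)
  then have i: "i \<in> V" and m: "set_mset m \<subseteq> V" by auto
  show ?case
  proof (rule form_cong[OF form_var_mult[OF add.IH[OF m] i]])
    fix x assume x: "x \<in> V \<rightarrow> carrier K"
    then have "x i \<in> carrier K" "x \<in> set_mset m \<rightarrow> carrier K" using i m by auto
    then show "monomial_eval K x (add_mset i m) \<otimes> f x = x i \<otimes> (monomial_eval K x m \<otimes> f x)"
      by (simp add: K.monomial_eval_add_mset K.m_assoc form_closed(1)[OF assms(1) x])
  next
    fix x assume x: "x \<in> V \<rightarrow> carrier A"
    then have "x i \<in> carrier A" "x \<in> set_mset m \<rightarrow> carrier A" using i m by auto
    then show "monomial_eval A x (add_mset i m) \<otimes>\<^bsub>A\<^esub> g x = x i \<otimes>\<^bsub>A\<^esub> (monomial_eval A x m \<otimes>\<^bsub>A\<^esub> g x)"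
      by (simp add: A.monomial_eval_add_mset A.m_assoc form_closed(2)[OF assms(1) x])
  qed simp
qed

lemma form_sum:
  assumes "finite S" "\<And>s. s \<in> S \<Longrightarrow> form V d (F s) (G s)"
  shows "form V d (\<lambda>x. \<Oplus>s \<in> S. F s x) (\<lambda>x. \<Oplus>\<^bsub>A\<^esub>s \<in> S. G s x)"
  using assms
proof (induction S)
  case empty
  then show ?case by (simp add: form_zero)
next
  case (insert s S)
  have "form V d (\<lambda>x. F s x \<oplus> (\<Oplus>s \<in> S. F s x)) (\<lambda>x. G s x \<oplus>\<^bsub>A\<^esub> (\<Oplus>\<^bsub>A\<^esub>s \<in> S. G s x))"
    using insert by (intro form_add) auto
  then show ?case
    by (rule form_cong)
      (use insert form_closed[OF insert.prems] in
        \<open>auto intro!: K.finsum_insert A.finsum_insert\<close>)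
qed

text \<open>Expanding only the first factor into its terms makes the product a sum of scalar
  multiples of monomials times the second factor, all of degree \<open>d + e\<close>. No convolution
  of coefficients is needed.\<close>

lemma form_mult:
  assumes fg: "form V d f g" and fg': "form V e f' g'"
  shows "form V (d + e) (\<lambda>x. f x \<otimes> f' x) (\<lambda>x. g x \<otimes>\<^bsub>A\<^esub> g' x)"
proof -
  obtain P where P: "P \<in> K.indexed_pset V (carrier K)" "\<And>m. m \<in> poly_support K P \<Longrightarrow> size m = d"
    "\<And>x. x \<in> V \<rightarrow> carrier K \<Longrightarrow> f x = poly_eval K (self_algebra K) x P"
    "\<And>x. x \<in> V \<rightarrow> carrier A \<Longrightarrow> g x = poly_eval K A x P"
    using fg unfolding form_def by blast
  note supp = K.indexed_pset_supp[OF P(1)]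
  note closed = form_closed[OF fg']
  have "form V (d + e)
      (\<lambda>x. \<Oplus>m \<in> poly_support K P. P m \<otimes> (monomial_eval K x m \<otimes> f' x))
      (\<lambda>x. \<Oplus>\<^bsub>A\<^esub>m \<in> poly_support K P. P m \<odot>\<^bsub>A\<^esub> (monomial_eval A x m \<otimes>\<^bsub>A\<^esub> g' x))"
    using supp P(2) form_smult[OF form_monomial_mult[OF fg']] by (intro form_sum) force+
  then show ?thesis
  proof (rule form_cong[OF _ refl])
    fix x assume x: "x \<in> V \<rightarrow> carrier K"
    note tc = self.poly_eval_term_closed[OF P(1), simplified, OF x]
    show "f x \<otimes> f' x = (\<Oplus>m \<in> poly_support K P. P m \<otimes> (monomial_eval K x m \<otimes> f' x))"
      unfolding P(3)[OF x] poly_eval_monomial_eval using tc closed(1)[OF x] supp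
      by (simp add: K.finsum_ldistr Pi_iff) (rule K.finsum_cong', auto simp: K.m_assoc)
  next
    fix x assume x: "x \<in> V \<rightarrow> carrier A"
    note tc = poly_eval_term_closed[OF P(1) x]
    show "g x \<otimes>\<^bsub>A\<^esub> g' x = (\<Oplus>\<^bsub>A\<^esub>m \<in> poly_support K P. P m \<odot>\<^bsub>A\<^esub> (monomial_eval A x m \<otimes>\<^bsub>A\<^esub> g' x))"
      unfolding P(4)[OF x] poly_eval_monomial_eval using tc closed(2)[OF x] supp
      by (simp add: A.finsum_ldistr Pi_iff) (rule A.finsum_cong', auto simp: smult_assoc2)
  qed
qed

lemma form_one: "form V 0 (\<lambda>_. \<one>) (\<lambda>_. \<one>\<^bsub>A\<^esub>)"
  by (rule form_cong[OF form_const[of \<one>]]) auto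

lemma form_var:
  assumes "i \<in> V" shows "form V 1 (\<lambda>x. x i) (\<lambda>x. x i)"
  by (rule form_cong[OF form_var_mult[OF form_one assms]]) (use assms in \<open>auto simp: Pi_iff\<close>)

lemma form_pow:
  assumes "form V d f g"
  shows "form V (n * d) (\<lambda>x. f x [^] n) (\<lambda>x. g x [^]\<^bsub>A\<^esub> n)"
proof (induction n)
  case 0
  show ?case by (rule form_cong[OF form_one]) auto
next
  case (Suc n)
  show ?case by (rule form_cong[OF form_mult[OF Suc assms]]) auto
qed

lemma form_monomial:
  assumes "\<And>v. v \<in># m \<Longrightarrow> form W e (F v) (G v)"
  shows "form W (size m * e) (\<lambda>x. monomial_eval K (\<lambda>v. F v x) m) (\<lambda>x. monomial_eval A (\<lambda>v. G v x) m)"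
  using assms
proof (induction m)
  case empty
  show ?case by (rule form_cong[OF form_one]) auto
next
  case (add v m)
  then have v: "form W e (F v) (G v)" and m: "\<And>u. u \<in># m \<Longrightarrow> form W e (F u) (G u)" by auto
  show ?case
    by (rule form_cong[OF form_mult[OF v add.IH[OF m]]])
      (auto simp: K.monomial_eval_add_mset A.monomial_eval_add_mset Pi_iff form_closed[OF v] form_closed[OF m])
qed

text \<open>All variables are replaced by forms of one common degree \<open>e\<close>; only then do
  the terms, each of size \<open>d\<close>, end up in the same degree \<open>d * e\<close>. This
  constraint dictates the shape of the composite in \<open>special_form_compose\<close>.\<close>

lemma form_poly_eval:
  assumes P: "P \<in> K.indexed_pset V (carrier K)" "\<And>m. m \<in> poly_support K P \<Longrightarrow> size m = d"
    and FG: "\<And>v. v \<in> V \<Longrightarrow> form W e (F v) (G v)"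
  shows "form W (d * e) (\<lambda>x. poly_eval K (self_algebra K) (\<lambda>v. F v x) P)
    (\<lambda>x. poly_eval K A (\<lambda>v. G v x) P)"
  unfolding poly_eval_monomial_eval
proof (simp, rule form_sum)
  fix m assume m: "m \<in> poly_support K P"
  have "form W (size m * e) (\<lambda>x. monomial_eval K (\<lambda>v. F v x) m) (\<lambda>x. monomial_eval A (\<lambda>v. G v x) m)"
    using FG K.indexed_pset_supp(3)[OF P(1) m] by (intro form_monomial) blast
  then show "form W (d * e) (\<lambda>x. P m \<otimes> monomial_eval K (\<lambda>v. F v x) m)
      (\<lambda>x. P m \<odot>\<^bsub>A\<^esub> monomial_eval A (\<lambda>v. G v x) m)"
    using form_smult K.indexed_pset_supp(2)[OF P(1)] P(2)[OF m] by blast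
qed (rule K.indexed_pset_supp(1)[OF P(1)])

end

section \<open>Homogenisation\<close>

text \<open>The target degree \<open>e\<close> is a parameter because two values occur: the total
  degree of \<open>D\<close> when homogenising, and the degree of a given form when dehomogenising,
  which is larger if \<open>Y\<close> divides the form.\<close>

definition hom_monomial :: "nat \<Rightarrow> nat multiset \<Rightarrow> nat option multiset"
  where "hom_monomial e m = image_mset Some m + replicate_mset (e - size m) None"

text \<open>Discarding the copies of \<open>None\<close> recovers the original monomial.\<close>

lemma inj_hom_monomial: "inj_on (hom_monomial e) S"
proof (rule inj_onI)
  fix m n assume "hom_monomial e m = hom_monomial e n"
  then have "filter_mset (\<lambda>v. v \<noteq> None) (hom_monomial e m) = filter_mset (\<lambda>v. v \<noteq> None) (hom_monomial e n)"
    by simp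
  moreover have "filter_mset (\<lambda>v. v \<noteq> None) (hom_monomial e k) = image_mset Some k" for k
    by (auto simp: hom_monomial_def filter_mset_image_mset)
  ultimately have "image_mset the (image_mset Some m) = image_mset the (image_mset Some n)"
    by simp
  then show "m = n" by (simp add: multiset.map_comp o_def)
qed

lemma size_hom_monomial: "size m \<le> e \<Longrightarrow> size (hom_monomial e m) = e"
  by (simp add: hom_monomial_def)

lemma option_multiset_decompose:
  "\<exists>m k. M = image_mset Some m + replicate_mset k None"
proof (induction M)
  case (add v M)
  then obtain m k where M: "M = image_mset Some m + replicate_mset k None" by blast
  show ?case
  proof (cases v)
    case None
    with M show ?thesis by (intro exI[of _ m] exI[of _ "Suc k"]) simp
  next
    case (Some i)
    with M show ?thesis by (intro exI[of _ "add_mset i m"] exI[of _ k]) simp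
  qed
qed simp

lemma hom_monomial_surj:
  assumes "size M = e"
  obtains m where "size m \<le> e" "M = hom_monomial e m"
proof -
  obtain m k where "M = image_mset Some m + replicate_mset k None"
    using option_multiset_decompose by blast
  with assms that[of m] show ?thesis by (auto simp: hom_monomial_def)
qed

lemma set_mset_hom_monomial:
  "Some ` set_mset m \<subseteq> set_mset (hom_monomial e m)"
  "set_mset (hom_monomial e m) \<subseteq> insert None (Some ` set_mset m)"
  by (auto simp: hom_monomial_def)

lemma (in cring) homogenisation_nonsupp:
  assumes "M \<notin> hom_monomial (total_degree R D) ` poly_support R D"
  shows "homogenisation R D M = \<zero>"
proof -
  have "homogenisation R D M = (\<Oplus>m \<in> poly_support R D. \<zero>)"
    unfolding homogenisation_def using assms
    by (intro finsum_cong') (auto simp: hom_monomial_def)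
  then show ?thesis by simp
qed

text \<open>By injectivity of \<open>hom_monomial\<close> at a fixed degree the defining sum has a
  single summand that can be nonzero. Homogenising therefore relabels monomials and never adds
  coefficients together.\<close>

lemma (in cring) homogenisation_supp:
  assumes D: "D \<in> indexed_pset V (carrier R)" and m: "m \<in> poly_support R D"
  shows "homogenisation R D (hom_monomial (total_degree R D) m) = D m"
proof -
  have "hom_monomial (total_degree R D) m = hom_monomial (total_degree R D) n \<longleftrightarrow> m = n" for n
    using inj_hom_monomial[of _ UNIV] by (auto dest: injD)
  then have "homogenisation R D (hom_monomial (total_degree R D) m) =
      (\<Oplus>n \<in> poly_support R D. if m = n then D n else \<zero>)"
    unfolding homogenisation_def by (simp add: hom_monomial_def)
  also have "\<dots> = D m"
    using indexed_pset_supp[OF D] m by (intro add.finprod_singleton) auto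
  finally show ?thesis .
qed

lemma (in cring) poly_support_homogenisation:
  assumes "D \<in> indexed_pset V (carrier R)"
  shows "poly_support R (homogenisation R D) = hom_monomial (total_degree R D) ` poly_support R D"
proof
  show "poly_support R (homogenisation R D) \<subseteq> hom_monomial (total_degree R D) ` poly_support R D"
    using homogenisation_nonsupp[of _ D] unfolding poly_support_def[of R "homogenisation R D"] by blast
  show "hom_monomial (total_degree R D) ` poly_support R D \<subseteq> poly_support R (homogenisation R D)"
    using homogenisation_supp[OF assms] by (auto simp: poly_support_def)
qed

lemma (in cring) size_le_total_degree:
  assumes "D \<in> indexed_pset V (carrier R)" "m \<in> poly_support R D"
  shows "size m \<le> total_degree R D"
  unfolding total_degree_def using indexed_pset_supp(1)[OF assms(1)] assms(2) by (intro Max_ge) auto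

lemma (in cring) homogenisation_pset:
  assumes D: "D \<in> indexed_pset V (carrier R)"
  shows "homogenisation R D \<in> indexed_pset (insert None (Some ` V)) (carrier R)"
proof (rule indexed_psetI)
  show "finite (poly_support R (homogenisation R D))"
    using indexed_pset_supp(1)[OF D] by (simp add: poly_support_homogenisation[OF D])
  show "homogenisation R D M \<in> carrier R" for M
    using homogenisation_nonsupp[of M D] homogenisation_supp[OF D] indexed_pset_supp(2)[OF D]
    by (cases "M \<in> hom_monomial (total_degree R D) ` poly_support R D") auto
  fix M assume "M \<in> poly_support R (homogenisation R D)"
  then obtain m where m: "m \<in> poly_support R D" "M = hom_monomial (total_degree R D) m"
    by (auto simp: poly_support_homogenisation[OF D])
  with indexed_pset_supp(3)[OF D m(1)] set_mset_hom_monomial(2)[of "total_degree R D" m]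
  show "set_mset M \<subseteq> insert None (Some ` V)" by blast
qed

context k_algebra
begin

text \<open>\<open>P\<close> is any relabelling of \<open>D\<close> in degree \<open>e\<close>, so
  that the formula covers both the homogenisation of \<open>D\<close> and a form whose
  dehomogenisation is \<open>D\<close>.\<close>

lemma poly_eval_hom_monomials:
  assumes D: "D \<in> K.indexed_pset V (carrier K)"
    and supp: "poly_support K P = hom_monomial e ` poly_support K D"
    and coeff: "\<And>m. m \<in> poly_support K D \<Longrightarrow> P (hom_monomial e m) = D m"
    and x: "x \<in> V \<rightarrow> carrier A" and y: "y \<in> carrier A"
  shows "poly_eval K A (case_option y x) P =
    (\<Oplus>\<^bsub>A\<^esub> m \<in> poly_support K D. D m \<odot>\<^bsub>A\<^esub> (monomial_eval A x m \<otimes>\<^bsub>A\<^esub> y [^]\<^bsub>A\<^esub> (e - size m)))"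
proof -
  have mon: "monomial_eval A (case_option y x) (hom_monomial e m) =
      monomial_eval A x m \<otimes>\<^bsub>A\<^esub> y [^]\<^bsub>A\<^esub> (e - size m)" if "m \<in> poly_support K D" for m
  proof -
    have "x \<in> set_mset m \<rightarrow> carrier A" using K.indexed_pset_supp(3)[OF D that] x by auto
    moreover from this have "case_option y x \<in> Some ` set_mset m \<rightarrow> carrier A" by auto
    ultimately show ?thesis unfolding hom_monomial_def using y
      by (subst A.monomial_eval_union)
        (auto simp: A.monomial_eval_image_mset A.monomial_eval_replicate_mset split: if_splits)
  qed
  note tc = poly_eval_term_closed(1)[OF D x]
  have "poly_eval K A (case_option y x) P = (\<Oplus>\<^bsub>A\<^esub> m \<in> poly_support K D.
      P (hom_monomial e m) \<odot>\<^bsub>A\<^esub> monomial_eval A (case_option y x) (hom_monomial e m))"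
    unfolding poly_eval_monomial_eval supp
    by (rule A.finsum_reindex[OF _ inj_hom_monomial])
      (use mon tc y coeff K.indexed_pset_supp(2)[OF D] in auto)
  also have "\<dots> = (\<Oplus>\<^bsub>A\<^esub> m \<in> poly_support K D.
      D m \<odot>\<^bsub>A\<^esub> (monomial_eval A x m \<otimes>\<^bsub>A\<^esub> y [^]\<^bsub>A\<^esub> (e - size m)))"
    by (rule A.finsum_cong') (use mon tc y coeff K.indexed_pset_supp(2)[OF D] in auto)
  finally show ?thesis .
qed

text \<open>The division-free version of \<open>D#(a, y) = y^d D(a / y)\<close>, valid in every
  algebra. It is applied in \<open>K\<close>, where a nonzero \<open>y\<close> is invertible, and in
  the localisation, where \<open>y\<close> is the image of \<open>b^n\<close>.\<close>

lemma poly_eval_homogenisation: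
  assumes D: "D \<in> K.indexed_pset V (carrier K)" and x: "x \<in> V \<rightarrow> carrier A" and y: "y \<in> carrier A"
  shows "poly_eval K A (case_option y (\<lambda>i. y \<otimes>\<^bsub>A\<^esub> x i)) (homogenisation K D) =
    y [^]\<^bsub>A\<^esub> total_degree K D \<otimes>\<^bsub>A\<^esub> poly_eval K A x D"
proof -
  let ?d = "total_degree K D"
  have yx: "(\<lambda>i. y \<otimes>\<^bsub>A\<^esub> x i) \<in> V \<rightarrow> carrier A" using x y by auto
  note tc = poly_eval_term_closed[OF D x]
  have "poly_eval K A (case_option y (\<lambda>i. y \<otimes>\<^bsub>A\<^esub> x i)) (homogenisation K D) =
    (\<Oplus>\<^bsub>A\<^esub> m \<in> poly_support K D. D m \<odot>\<^bsub>A\<^esub> (monomial_eval A (\<lambda>i. y \<otimes>\<^bsub>A\<^esub> x i) m \<otimes>\<^bsub>A\<^esub> y [^]\<^bsub>A\<^esub> (?d - size m)))"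
    by (rule poly_eval_hom_monomials[OF D K.poly_support_homogenisation[OF D]
          K.homogenisation_supp[OF D] yx y])
  also have "\<dots> = (\<Oplus>\<^bsub>A\<^esub> m \<in> poly_support K D. y [^]\<^bsub>A\<^esub> ?d \<otimes>\<^bsub>A\<^esub> (D m \<odot>\<^bsub>A\<^esub> monomial_eval A x m))"
  proof (rule A.finsum_cong')
    fix m assume m: "m \<in> poly_support K D"
    have "x \<in> set_mset m \<rightarrow> carrier A" using K.indexed_pset_supp(3)[OF D m] x by auto
    then have "monomial_eval A (\<lambda>i. y \<otimes>\<^bsub>A\<^esub> x i) m \<otimes>\<^bsub>A\<^esub> y [^]\<^bsub>A\<^esub> (?d - size m) =
        (y [^]\<^bsub>A\<^esub> size m \<otimes>\<^bsub>A\<^esub> y [^]\<^bsub>A\<^esub> (?d - size m)) \<otimes>\<^bsub>A\<^esub> monomial_eval A x m"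
      using y by (simp add: A.monomial_eval_scale A.m_ac)
    \<comment> \<open>The degree bound matters: without \<open>size m \<le> ?d\<close> the
      subtraction of naturals would truncate and the exponents would not add up to
      \<open>?d\<close>.\<close>
    also have "y [^]\<^bsub>A\<^esub> size m \<otimes>\<^bsub>A\<^esub> y [^]\<^bsub>A\<^esub> (?d - size m) = y [^]\<^bsub>A\<^esub> ?d"
      using y K.size_le_total_degree[OF D m] by (simp add: A.nat_pow_mult)
    finally show "D m \<odot>\<^bsub>A\<^esub> (monomial_eval A (\<lambda>i. y \<otimes>\<^bsub>A\<^esub> x i) m \<otimes>\<^bsub>A\<^esub> y [^]\<^bsub>A\<^esub> (?d - size m)) =
        y [^]\<^bsub>A\<^esub> ?d \<otimes>\<^bsub>A\<^esub> (D m \<odot>\<^bsub>A\<^esub> monomial_eval A x m)"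
      using y tc[OF m] K.indexed_pset_supp(2)[OF D] by (simp add: smult_mult_left)
  qed (use tc y in auto)
  also have "\<dots> = y [^]\<^bsub>A\<^esub> ?d \<otimes>\<^bsub>A\<^esub> poly_eval K A x D"
    unfolding poly_eval_monomial_eval
    by (rule A.finsum_rdistr[symmetric]) (use K.indexed_pset_supp(1)[OF D] tc y in auto)
  finally show ?thesis .
qed

text \<open>The form has degree \<open>e\<close>, the homogenisation only the total degree of
  \<open>D\<close>; the difference is the power of \<open>Y\<close> dividing the form. Nonempty
  support makes the total degree a maximum over a nonempty set, hence at most
  \<open>e\<close>.\<close>

lemma poly_eval_dehomogenise:
  assumes D: "D \<in> K.indexed_pset V (carrier K)" and ne: "poly_support K D \<noteq> {}"
    and supp: "poly_support K P = hom_monomial e ` poly_support K D"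
    and coeff: "\<And>m. m \<in> poly_support K D \<Longrightarrow> P (hom_monomial e m) = D m"
    and size: "\<And>m. m \<in> poly_support K D \<Longrightarrow> size m \<le> e"
    and x: "x \<in> V \<rightarrow> carrier A" and y: "y \<in> carrier A"
  shows "poly_eval K A (case_option y x) P =
    y [^]\<^bsub>A\<^esub> (e - total_degree K D) \<otimes>\<^bsub>A\<^esub> poly_eval K A (case_option y x) (homogenisation K D)"
proof -
  let ?d = "total_degree K D"
  note tc = poly_eval_term_closed[OF D x]
  have de: "?d \<le> e" unfolding total_degree_def
    using K.indexed_pset_supp(1)[OF D] ne size by (subst Max_le_iff) auto
  have "poly_eval K A (case_option y x) P = (\<Oplus>\<^bsub>A\<^esub> m \<in> poly_support K D.
      D m \<odot>\<^bsub>A\<^esub> (monomial_eval A x m \<otimes>\<^bsub>A\<^esub> y [^]\<^bsub>A\<^esub> (e - size m)))"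
    by (rule poly_eval_hom_monomials[OF D supp coeff x y])
  also have "\<dots> = (\<Oplus>\<^bsub>A\<^esub> m \<in> poly_support K D. y [^]\<^bsub>A\<^esub> (e - ?d) \<otimes>\<^bsub>A\<^esub>
      (D m \<odot>\<^bsub>A\<^esub> (monomial_eval A x m \<otimes>\<^bsub>A\<^esub> y [^]\<^bsub>A\<^esub> (?d - size m))))"
  proof (rule A.finsum_cong')
    fix m assume m: "m \<in> poly_support K D"
    have "y [^]\<^bsub>A\<^esub> (e - size m) = y [^]\<^bsub>A\<^esub> (e - ?d) \<otimes>\<^bsub>A\<^esub> y [^]\<^bsub>A\<^esub> (?d - size m)"
      using y K.size_le_total_degree[OF D m] de by (simp add: A.nat_pow_mult)
    then show "D m \<odot>\<^bsub>A\<^esub> (monomial_eval A x m \<otimes>\<^bsub>A\<^esub> y [^]\<^bsub>A\<^esub> (e - size m)) =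
        y [^]\<^bsub>A\<^esub> (e - ?d) \<otimes>\<^bsub>A\<^esub> (D m \<odot>\<^bsub>A\<^esub> (monomial_eval A x m \<otimes>\<^bsub>A\<^esub> y [^]\<^bsub>A\<^esub> (?d - size m)))"
      using y tc[OF m] K.indexed_pset_supp(2)[OF D] by (simp add: smult_mult_left A.m_lcomm)
  qed (use tc y K.indexed_pset_supp(2)[OF D] in auto)
  also have "\<dots> = y [^]\<^bsub>A\<^esub> (e - ?d) \<otimes>\<^bsub>A\<^esub> (\<Oplus>\<^bsub>A\<^esub> m \<in> poly_support K D.
      D m \<odot>\<^bsub>A\<^esub> (monomial_eval A x m \<otimes>\<^bsub>A\<^esub> y [^]\<^bsub>A\<^esub> (?d - size m)))"
    by (rule A.finsum_rdistr[symmetric])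
      (use K.indexed_pset_supp(1,2)[OF D] tc y in auto)
  also have "(\<Oplus>\<^bsub>A\<^esub> m \<in> poly_support K D.
      D m \<odot>\<^bsub>A\<^esub> (monomial_eval A x m \<otimes>\<^bsub>A\<^esub> y [^]\<^bsub>A\<^esub> (?d - size m))) =
      poly_eval K A (case_option y x) (homogenisation K D)"
    by (rule poly_eval_hom_monomials[symmetric, OF D K.poly_support_homogenisation[OF D]
          K.homogenisation_supp[OF D] x y])
  finally show ?thesis .
qed

end

section \<open>Passing between the algebraic and the homogeneous signature\<close>

lemma (in domain) nat_pow_nonzero:
  "x \<in> carrier R \<Longrightarrow> x \<noteq> \<zero> \<Longrightarrow> x [^] (n::nat) \<noteq> \<zero>"
  by (induction n) (auto simp: integral_iff)

locale field_algebra = k_algebra K A + K: field K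
  for K :: "('k, 'x) ring_scheme" (structure) and A :: "('k, 'a, 'y) module_scheme" (structure)

lemma field_algebraI: "field K \<Longrightarrow> algebra K A \<Longrightarrow> field_algebra K A"
  by (simp add: field_algebra_def k_algebraI)

lemma (in field) field_algebra_self: "field_algebra R (self_algebra R)"
  by (rule field_algebraI[OF field_axioms algebra_self])

abbreviation hom_vars :: "nat \<Rightarrow> nat option set"
  where "hom_vars r \<equiv> insert None (Some ` {..<r})"

lemma case_option_hom_vars:
  "case_option b a \<in> hom_vars r \<rightarrow> C \<longleftrightarrow> b \<in> C \<and> a \<in> {..<r} \<rightarrow> C"
  by (auto simp: Pi_iff)

context field_algebra
begin

interpretation self: field_algebra K "self_algebra K"
  by (rule K.field_algebra_self)

lemma hom_signatureD:
  assumes "P \<in> hom_signature K r"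
  shows "P \<in> K.indexed_pset (hom_vars r) (carrier K)"
    "\<exists>d. \<forall>m \<in> poly_support K P. size m = d"
    "\<And>a b. a \<in> {..<r} \<rightarrow> carrier K \<Longrightarrow> b \<in> carrier K \<Longrightarrow>
      poly_eval K (self_algebra K) (case_option b a) P = \<zero> \<Longrightarrow> b = \<zero>"
  using assms unfolding hom_signature_def homogeneous_def by blast+

text \<open>The zero polynomial vanishes at \<open>Y = 1\<close>, so the no-zero condition would
  give \<open>1 = 0\<close>.\<close>

lemma hom_signatureI:
  assumes P: "P \<in> K.indexed_pset (hom_vars r) (carrier K)"
    "\<And>m. m \<in> poly_support K P \<Longrightarrow> size m = d"
    and zero: "\<And>a b. a \<in> {..<r} \<rightarrow> carrier K \<Longrightarrow> b \<in> carrier K \<Longrightarrow>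
      poly_eval K (self_algebra K) (case_option b a) P = \<zero> \<Longrightarrow> b = \<zero>"
  shows "P \<in> hom_signature K r"
proof -
  have "P \<noteq> K.indexed_const \<zero>"
  proof
    assume "P = K.indexed_const \<zero>"
    then have "poly_eval K (self_algebra K) (case_option \<one> (\<lambda>_. \<zero>)) P = \<zero>"
      by (simp add: self.poly_eval_const)
    then have "\<one> = \<zero>" by (rule zero[of "\<lambda>_. \<zero>", rotated 2]) auto
    then show False by simp
  qed
  then show ?thesis using assms unfolding hom_signature_def homogeneous_def by blast
qed

lemma alg_signatureD:
  assumes "D \<in> alg_signature K r"
  shows "D \<in> K.indexed_pset {..<r} (carrier K)"
    "\<And>a. a \<in> {..<r} \<rightarrow> carrier K \<Longrightarrow> poly_eval K (self_algebra K) a D \<noteq> \<zero>"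
    "poly_support K D \<noteq> {}"
proof -
  show "D \<in> K.indexed_pset {..<r} (carrier K)"
    using assms unfolding alg_signature_def by blast
  show *: "poly_eval K (self_algebra K) a D \<noteq> \<zero>" if "a \<in> {..<r} \<rightarrow> carrier K" for a
    using assms that unfolding alg_signature_def by blast
  show "poly_support K D \<noteq> {}"
    using *[of "\<lambda>_. \<zero>"] by (auto simp: poly_eval_def)
qed

text \<open>If \<open>b\<close> is nonzero, then \<open>D#(a, b) = b^d D(a / b)\<close> is a product
  of two nonzero elements of the field.\<close>

lemma homogenisation_hom_signature:
  assumes "D \<in> alg_signature K r"
  shows "homogenisation K D \<in> hom_signature K r"
proof (rule hom_signatureI)
  note D = alg_signatureD[OF assms]
  show "homogenisation K D \<in> K.indexed_pset (hom_vars r) (carrier K)"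
    by (rule K.homogenisation_pset[OF D(1)])
  show "size M = total_degree K D" if "M \<in> poly_support K (homogenisation K D)" for M
    using that K.size_le_total_degree[OF D(1)]
    by (auto simp: K.poly_support_homogenisation[OF D(1)] size_hom_monomial)
  fix a b assume a: "a \<in> {..<r} \<rightarrow> carrier K" and b: "b \<in> carrier K"
    and zero: "poly_eval K (self_algebra K) (case_option b a) (homogenisation K D) = \<zero>"
  show "b = \<zero>"
  proof (rule ccontr)
    assume b0: "b \<noteq> \<zero>"
    with b have inv: "inv b \<in> carrier K" "b \<otimes> inv b = \<one>"
      using K.field_Units by (auto intro: K.Units_r_inv)
    let ?x = "\<lambda>i. inv b \<otimes> a i"
    have x: "?x \<in> {..<r} \<rightarrow> carrier K" using a inv by auto
    have bx: "b \<otimes> ?x i = a i" if "i < r" for i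
      using a b inv that by (simp add: K.m_assoc[symmetric] Pi_iff)
    have "poly_eval K (self_algebra K) (case_option b a) (homogenisation K D) =
        poly_eval K (self_algebra K) (case_option b (\<lambda>i. b \<otimes> ?x i)) (homogenisation K D)"
      by (rule self.poly_eval_cong[OF K.homogenisation_pset[OF D(1)]])
        (use a b bx inv in \<open>auto simp: Pi_iff split: option.split\<close>)
    also have "\<dots> = b [^] total_degree K D \<otimes> poly_eval K (self_algebra K) ?x D"
      using self.poly_eval_homogenisation[OF D(1), simplified, OF x b] .
    finally have "b [^] total_degree K D \<otimes> poly_eval K (self_algebra K) ?x D = \<zero>"
      using zero by simp
    moreover have "b [^] total_degree K D \<noteq> \<zero>"
      by (rule K.nat_pow_nonzero[OF b b0])
    ultimately show False
      using D(2)[OF x] self.poly_eval_closed[OF D(1), simplified, OF x] b K.integral by blast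
  qed
qed

text \<open>Setting \<open>Y = 1\<close> loses only the exponent of the power of \<open>Y\<close>
  dividing \<open>P\<close>; this is \<open>j\<close>, so \<open>P = Y^j D#\<close>. Only the
  resulting identity between values in \<open>A\<close> is recorded.\<close>

lemma dehomogenisation:
  assumes "P \<in> hom_signature K r"
  obtains D j where "D \<in> alg_signature K r"
    "\<And>a b. a \<in> {..<r} \<rightarrow> carrier A \<Longrightarrow> b \<in> carrier A \<Longrightarrow>
      poly_eval K A (case_option b a) P =
        b [^]\<^bsub>A\<^esub> (j::nat) \<otimes>\<^bsub>A\<^esub> poly_eval K A (case_option b a) (homogenisation K D)"
proof -
  note P = hom_signatureD[OF assms]
  obtain e where e: "\<And>M. M \<in> poly_support K P \<Longrightarrow> size M = e" using P(2) by blast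
  \<comment> \<open>The coefficients of \<open>P(X, 1)\<close>: among the monomials of degree
    \<open>e\<close>, \<open>hom_monomial e m\<close> is the only one that becomes \<open>m\<close>
    at \<open>Y = 1\<close>.\<close>
  define D where "D m = (if size m \<le> e then P (hom_monomial e m) else \<zero>)" for m
  have supp: "poly_support K P = hom_monomial e ` poly_support K D"
  proof
    show "poly_support K P \<subseteq> hom_monomial e ` poly_support K D"
    proof
      fix M assume M: "M \<in> poly_support K P"
      obtain m where "size m \<le> e" "M = hom_monomial e m" by (rule hom_monomial_surj[OF e[OF M]])
      with M show "M \<in> hom_monomial e ` poly_support K D" by (auto simp: poly_support_def D_def)
    qed
  qed (auto simp: poly_support_def D_def split: if_splits)
  have size: "size m \<le> e" and coeff: "P (hom_monomial e m) = D m" if "m \<in> poly_support K D" for m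
    using that by (auto simp: poly_support_def D_def split: if_splits)
  have D: "D \<in> K.indexed_pset {..<r} (carrier K)"
  proof (rule K.indexed_psetI)
    have "finite (hom_monomial e ` poly_support K D)"
      using K.indexed_pset_supp(1)[OF P(1)] by (simp add: supp)
    then show "finite (poly_support K D)" by (rule finite_imageD[OF _ inj_hom_monomial])
    show "D m \<in> carrier K" for m
      using K.indexed_pset_supp(2)[OF P(1)] by (simp add: D_def)
    fix m assume "m \<in> poly_support K D"
    then have "set_mset (hom_monomial e m) \<subseteq> hom_vars r"
      by (intro K.indexed_pset_supp(3)[OF P(1)]) (simp add: supp)
    with set_mset_hom_monomial(1)[of m e] have "Some ` set_mset m \<subseteq> hom_vars r" by (rule subset_trans)
    then show "set_mset m \<subseteq> {..<r}" by auto
  qed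
  have "poly_eval K (self_algebra K) a D \<noteq> \<zero>" if a: "a \<in> {..<r} \<rightarrow> carrier K" for a
  proof
    assume zero: "poly_eval K (self_algebra K) a D = \<zero>"
    \<comment> \<open>A zero \<open>a\<close> of \<open>D\<close> would be a zero
      \<open>(a, 1)\<close> of \<open>P\<close>, and the condition on \<open>P\<close> would force
      \<open>1 = 0\<close>.\<close>
    have "poly_eval K (self_algebra K) (case_option \<one> a) P = (\<Oplus>m \<in> poly_support K D.
        D m \<otimes> (monomial_eval K a m \<otimes> \<one> [^] (e - size m)))"
      using self.poly_eval_hom_monomials[OF D supp coeff, of a \<one>] a by simp
    also have "\<dots> = poly_eval K (self_algebra K) a D"
      unfolding poly_eval_monomial_eval
      using self.poly_eval_term_closed[OF D, simplified, OF a] by (simp, intro K.finsum_cong') auto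
    finally have "\<one> = \<zero>" using P(3)[OF a K.one_closed] zero by simp
    then show False by simp
  qed
  with D have alg: "D \<in> alg_signature K r" by (auto simp: alg_signature_def)
  show ?thesis
    by (rule that[OF alg poly_eval_dehomogenise[OF D alg_signatureD(3)[OF alg] supp coeff size]])
qed

end

section \<open>Special forms\<close>

context k_algebra
begin

text \<open>Only the values at indices in \<open>V\<close> matter. This discards the irrelevant
  entries of concatenated tuples and of shifted assignments.\<close>

lemma form_local:
  assumes "form V d f g"
  shows "y \<in> V \<rightarrow> carrier K \<Longrightarrow> (\<And>v. v \<in> V \<Longrightarrow> x v = y v) \<Longrightarrow> f x = f y"
    "y' \<in> V \<rightarrow> carrier A \<Longrightarrow> (\<And>v. v \<in> V \<Longrightarrow> x' v = y' v) \<Longrightarrow> g x' = g y'"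
proof -
  interpret self: k_algebra K "self_algebra K" by (rule K.k_algebra_self)
  obtain P where P: "P \<in> K.indexed_pset V (carrier K)"
    "\<And>x. x \<in> V \<rightarrow> carrier K \<Longrightarrow> f x = poly_eval K (self_algebra K) x P"
    "\<And>x. x \<in> V \<rightarrow> carrier A \<Longrightarrow> g x = poly_eval K A x P"
    using assms unfolding form_def by blast
  show "f x = f y" if y: "y \<in> V \<rightarrow> carrier K" and eq: "\<And>v. v \<in> V \<Longrightarrow> x v = y v"
  proof -
    have "x \<in> V \<rightarrow> carrier K" using y eq by (simp add: Pi_iff)
    with y eq show ?thesis by (simp add: P(2) self.poly_eval_cong[OF P(1), of y x])
  qed
  show "g x' = g y'" if y: "y' \<in> V \<rightarrow> carrier A" and eq: "\<And>v. v \<in> V \<Longrightarrow> x' v = y' v"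
  proof -
    have "x' \<in> V \<rightarrow> carrier A" using y eq by (simp add: Pi_iff)
    with y eq show ?thesis by (simp add: P(3) poly_eval_cong[OF P(1), of y' x'])
  qed
qed

lemma form_scale:
  assumes fg: "form V d f g" and x: "x \<in> V \<rightarrow> carrier A" and y: "y \<in> carrier A"
  shows "g (\<lambda>v. y \<otimes>\<^bsub>A\<^esub> x v) = y [^]\<^bsub>A\<^esub> d \<otimes>\<^bsub>A\<^esub> g x"
proof -
  obtain P where P: "P \<in> K.indexed_pset V (carrier K)" "\<And>m. m \<in> poly_support K P \<Longrightarrow> size m = d"
    "\<And>x. x \<in> V \<rightarrow> carrier A \<Longrightarrow> g x = poly_eval K A x P"
    using fg unfolding form_def by blast
  have "(\<lambda>v. y \<otimes>\<^bsub>A\<^esub> x v) \<in> V \<rightarrow> carrier A" using x y by auto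
  then show ?thesis using poly_eval_scale[OF P(1,2) x y] by (simp add: P(3) x)
qed

lemma form_subst:
  assumes fg: "form V d f g" and FG: "\<And>v. v \<in> V \<Longrightarrow> form W e (F v) (G v)"
  shows "form W (d * e) (\<lambda>x. f (\<lambda>v. F v x)) (\<lambda>x. g (\<lambda>v. G v x))"
proof -
  obtain P where P: "P \<in> K.indexed_pset V (carrier K)" "\<And>m. m \<in> poly_support K P \<Longrightarrow> size m = d"
    "\<And>x. x \<in> V \<rightarrow> carrier K \<Longrightarrow> f x = poly_eval K (self_algebra K) x P"
    "\<And>x. x \<in> V \<rightarrow> carrier A \<Longrightarrow> g x = poly_eval K A x P"
    using fg unfolding form_def by blast
  show ?thesis
  proof (rule form_cong[OF form_poly_eval[where F = F and G = G, OF P(1,2) FG] refl])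
    show "f (\<lambda>v. F v x) = poly_eval K (self_algebra K) (\<lambda>v. F v x) P" if "x \<in> W \<rightarrow> carrier K" for x
      using form_closed(1)[OF FG that] by (intro P(3)) auto
    show "g (\<lambda>v. G v x) = poly_eval K A (\<lambda>v. G v x) P" if "x \<in> W \<rightarrow> carrier A" for x
      using form_closed(2)[OF FG that] by (intro P(4)) auto
  qed
qed

lemma form_rename:
  assumes "form V d f g" "\<phi> \<in> V \<rightarrow> W"
  shows "form W d (\<lambda>x. f (\<lambda>v. x (\<phi> v))) (\<lambda>x. g (\<lambda>v. x (\<phi> v)))"
  using form_subst[OF assms(1) form_var, of \<phi> W] assms(2) by (simp add: Pi_iff)

end

context field_algebra
begin

text \<open>Counterpart of \<open>hom_signature\<close> for pairs of functions: \<open>f\<close>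
  carries the no-zero condition over \<open>K\<close>, \<open>g\<close> takes the values in
  \<open>A\<close>.\<close>

definition special_form where
  "special_form r d f g \<longleftrightarrow> form (hom_vars r) d f g \<and>
    (\<forall>a \<in> {..<r} \<rightarrow> carrier K. \<forall>b \<in> carrier K. f (case_option b a) = \<zero> \<longrightarrow> b = \<zero>)"

lemma special_formI:
  assumes "form (hom_vars r) d f g"
    "\<And>x. x \<in> hom_vars r \<rightarrow> carrier K \<Longrightarrow> f x = \<zero> \<Longrightarrow> x None = \<zero>"
  shows "special_form r d f g"
  unfolding special_form_def
proof (intro conjI ballI impI)
  fix a b assume "a \<in> {..<r} \<rightarrow> carrier K" "b \<in> carrier K" "f (case_option b a) = \<zero>"
  then show "b = \<zero>" using assms(2)[of "case_option b a", unfolded case_option_hom_vars] by simp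
qed (rule assms(1))

text \<open>Every assignment is the \<open>case_option\<close> of its value at \<open>None\<close>
  and its restriction to the \<open>Some i\<close>, so the no-zero condition may be used for
  assignments not given in that shape.\<close>

lemma special_formD:
  assumes "special_form r d f g"
  shows "form (hom_vars r) d f g"
    "\<And>x. x \<in> hom_vars r \<rightarrow> carrier K \<Longrightarrow> f x = \<zero> \<Longrightarrow> x None = \<zero>"
proof -
  show "form (hom_vars r) d f g" using assms by (simp add: special_form_def)
  fix x assume x: "x \<in> hom_vars r \<rightarrow> carrier K" "f x = \<zero>"
  have "x = case_option (x None) (\<lambda>i. x (Some i))" by (simp add: fun_eq_iff split: option.split)
  moreover have "x None \<in> carrier K" "(\<lambda>i. x (Some i)) \<in> {..<r} \<rightarrow> carrier K" using x(1) by auto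
  ultimately show "x None = \<zero>" using assms x(2) unfolding special_form_def by metis
qed

lemma hom_signature_special_form:
  assumes "P \<in> hom_signature K r"
  shows "\<exists>d f. special_form r d f (\<lambda>x. poly_eval K A x P)"
proof -
  note P = hom_signatureD[OF assms]
  obtain d where "\<And>m. m \<in> poly_support K P \<Longrightarrow> size m = d" using P(2) by blast
  then have "form (hom_vars r) d (\<lambda>x. poly_eval K (self_algebra K) x P) (\<lambda>x. poly_eval K A x P)"
    by (intro formI[OF P(1)]) auto
  with P(3) have "special_form r d (\<lambda>x. poly_eval K (self_algebra K) x P) (\<lambda>x. poly_eval K A x P)"
    by (simp add: special_form_def)
  then show ?thesis by blast
qed

lemma special_form_hom_signature:
  assumes "special_form r d f g"
  shows "\<exists>P \<in> hom_signature K r. \<forall>x \<in> hom_vars r \<rightarrow> carrier A. g x = poly_eval K A x P"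
proof -
  obtain P where P: "P \<in> K.indexed_pset (hom_vars r) (carrier K)"
    "\<And>m. m \<in> poly_support K P \<Longrightarrow> size m = d"
    "\<And>x. x \<in> hom_vars r \<rightarrow> carrier K \<Longrightarrow> f x = poly_eval K (self_algebra K) x P"
    "\<And>x. x \<in> hom_vars r \<rightarrow> carrier A \<Longrightarrow> g x = poly_eval K A x P"
    using special_formD(1)[OF assms] unfolding form_def by blast
  have "P \<in> hom_signature K r"
  proof (rule hom_signatureI[OF P(1,2)])
    fix a b assume "a \<in> {..<r} \<rightarrow> carrier K" "b \<in> carrier K"
    then have ab: "case_option b a \<in> hom_vars r \<rightarrow> carrier K"
      by (simp only: case_option_hom_vars simp_thms)
    assume "poly_eval K (self_algebra K) (case_option b a) P = \<zero>"
    then show "b = \<zero>" using special_formD(2)[OF assms ab] by (simp add: P(3)[OF ab])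
  qed
  with P(4) show ?thesis by blast
qed

text \<open>The first \<open>r\<close> indices hold the variables of the first form; those of the
  second form are moved up by \<open>r\<close> to become disjoint from them.\<close>

definition append_tuple :: "nat \<Rightarrow> (nat \<Rightarrow> 'c) \<Rightarrow> (nat \<Rightarrow> 'c) \<Rightarrow> nat \<Rightarrow> 'c"
  where "append_tuple r a z i = (if i < r then a i else z (i - r))"

lemma append_tuple_closed:
  "a \<in> {..<r} \<rightarrow> C \<Longrightarrow> z \<in> {..<s} \<rightarrow> C \<Longrightarrow> append_tuple r a z \<in> {..<r + s} \<rightarrow> C"
  by (auto simp: append_tuple_def Pi_iff)

text \<open>The two forms share \<open>Y\<close> and nothing else. Over a domain a zero of the
  product is a zero of one factor, and either factor forces \<open>Y = 0\<close>. Disjointness lets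
  the tuples \<open>a\<close> and \<open>z\<close> be chosen independently.\<close>

lemma special_form_mult:
  assumes fg: "special_form r d f g" and fg': "special_form s e f' g'"
  shows "\<exists>F G. special_form (r + s) (d + e) F G \<and>
    (\<forall>y \<in> carrier A. \<forall>a \<in> {..<r} \<rightarrow> carrier A. \<forall>z \<in> {..<s} \<rightarrow> carrier A.
      G (case_option y (append_tuple r a z)) = g (case_option y a) \<otimes>\<^bsub>A\<^esub> g' (case_option y z))"
proof -
  \<comment> \<open>The shift fixes \<open>None\<close>, so \<open>Y\<close> remains common to both
    factors.\<close>
  let ?shift = "map_option (\<lambda>i. r + i)"
  have shift: "?shift \<in> hom_vars s \<rightarrow> hom_vars (r + s)" by auto
  have id: "(\<lambda>v. v) \<in> hom_vars r \<rightarrow> hom_vars (r + s)" by auto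
  let ?F = "\<lambda>x. f x \<otimes> f' (\<lambda>v. x (?shift v))" and ?G = "\<lambda>x. g x \<otimes>\<^bsub>A\<^esub> g' (\<lambda>v. x (?shift v))"
  have "special_form (r + s) (d + e) ?F ?G"
  proof (rule special_formI)
    show "form (hom_vars (r + s)) (d + e) ?F ?G"
      by (intro form_mult form_rename[OF special_formD(1)[OF fg] id]
          form_rename[OF special_formD(1)[OF fg'] shift])
    fix x assume x: "x \<in> hom_vars (r + s) \<rightarrow> carrier K" and zero: "?F x = \<zero>"
    have x1: "x \<in> hom_vars r \<rightarrow> carrier K" and x2: "(\<lambda>v. x (?shift v)) \<in> hom_vars s \<rightarrow> carrier K"
      using x by auto
    from zero have "f x = \<zero> \<or> f' (\<lambda>v. x (?shift v)) = \<zero>"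
      using form_closed(1)[OF special_formD(1)[OF fg] x1] form_closed(1)[OF special_formD(1)[OF fg'] x2]
      by (simp add: K.integral_iff)
    then show "x None = \<zero>"
      using special_formD(2)[OF fg x1] special_formD(2)[OF fg' x2] by auto
  qed
  moreover have "?G (case_option y (append_tuple r a z)) = g (case_option y a) \<otimes>\<^bsub>A\<^esub> g' (case_option y z)"
    if "y \<in> carrier A" "a \<in> {..<r} \<rightarrow> carrier A" "z \<in> {..<s} \<rightarrow> carrier A" for y a z
  proof -
    have "g (case_option y (append_tuple r a z)) = g (case_option y a)"
      by (rule form_local(2)[OF special_formD(1)[OF fg]])
        (use that in \<open>auto simp: append_tuple_def\<close>)
    moreover have "g' (\<lambda>v. case_option y (append_tuple r a z) (?shift v)) = g' (case_option y z)"
      by (rule form_local(2)[OF special_formD(1)[OF fg']])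
        (use that in \<open>auto simp: append_tuple_def\<close>)
    ultimately show ?thesis by simp
  qed
  ultimately show ?thesis by blast
qed

text \<open>The form \<open>f (X Y\<^sup>e, f' (Z, Y))\<close>; the factor \<open>Y\<^sup>e\<close> makes it homogeneous.\<close>

lemma special_form_compose:
  assumes fg: "special_form r d f g" and fg': "special_form s (Suc e) f' g'"
  shows "\<exists>F G. special_form (r + s) (d * Suc e) F G \<and>
    (\<forall>y \<in> carrier A. \<forall>a \<in> {..<r} \<rightarrow> carrier A. \<forall>z \<in> {..<s} \<rightarrow> carrier A.
      G (case_option y (append_tuple r a z)) =
        g (case_option (g' (case_option y z)) (\<lambda>i. a i \<otimes>\<^bsub>A\<^esub> y [^]\<^bsub>A\<^esub> e)))"
proof -
  let ?shift = "map_option (\<lambda>i. r + i)"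
  have shift: "?shift \<in> hom_vars s \<rightarrow> hom_vars (r + s)" by auto
  define F where "F = (\<lambda>v x. case v of None \<Rightarrow> f' (\<lambda>v. x (?shift v)) | Some i \<Rightarrow> x (Some i) \<otimes> x None [^] e)"
  define G where "G = (\<lambda>v x. case v of None \<Rightarrow> g' (\<lambda>v. x (?shift v)) | Some i \<Rightarrow> x (Some i) \<otimes>\<^bsub>A\<^esub> x None [^]\<^bsub>A\<^esub> e)"
  have FG: "form (hom_vars (r + s)) (Suc e) (F v) (G v)" if "v \<in> hom_vars r" for v
  proof (cases v)
    case None
    then show ?thesis
      using form_rename[OF special_formD(1)[OF fg'] shift] by (simp add: F_def G_def)
  next
    case (Some i)
    with that have "Some i \<in> hom_vars (r + s)" by auto
    from form_mult[OF form_var[OF this] form_pow[OF form_var, of None "hom_vars (r + s)" e]] Some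
    show ?thesis by (simp add: F_def G_def)
  qed
  have "special_form (r + s) (d * Suc e) (\<lambda>x. f (\<lambda>v. F v x)) (\<lambda>x. g (\<lambda>v. G v x))"
  proof (rule special_formI)
    show "form (hom_vars (r + s)) (d * Suc e) (\<lambda>x. f (\<lambda>v. F v x)) (\<lambda>x. g (\<lambda>v. G v x))"
      by (rule form_subst[OF special_formD(1)[OF fg] FG])
    fix x assume x: "x \<in> hom_vars (r + s) \<rightarrow> carrier K" and zero: "f (\<lambda>v. F v x) = \<zero>"
    \<comment> \<open>The no-zero condition is used twice: the outer form forces the value put in
      place of its \<open>Y\<close>, namely the inner form, to vanish, and the inner form then
      forces \<open>Y\<close> itself to vanish.\<close>
    have "(\<lambda>v. F v x) \<in> hom_vars r \<rightarrow> carrier K"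
      using form_closed(1)[OF FG x] by auto
    from special_formD(2)[OF fg this zero] have zero': "f' (\<lambda>v. x (?shift v)) = \<zero>"
      by (simp add: F_def)
    have "(\<lambda>v. x (?shift v)) \<in> hom_vars s \<rightarrow> carrier K" using x by auto
    from special_formD(2)[OF fg' this zero'] show "x None = \<zero>" by simp
  qed
  moreover have "g (\<lambda>v. G v (case_option y (append_tuple r a z))) =
      g (case_option (g' (case_option y z)) (\<lambda>i. a i \<otimes>\<^bsub>A\<^esub> y [^]\<^bsub>A\<^esub> e))"
    if "y \<in> carrier A" "a \<in> {..<r} \<rightarrow> carrier A" "z \<in> {..<s} \<rightarrow> carrier A" for y a z
  proof (rule form_local(2)[OF special_formD(1)[OF fg]])
    have yz: "case_option y z \<in> hom_vars s \<rightarrow> carrier A" using that by (simp only: case_option_hom_vars simp_thms)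
    then have "g' (case_option y z) \<in> carrier A" by (rule form_closed(2)[OF special_formD(1)[OF fg']])
    then show "case_option (g' (case_option y z)) (\<lambda>i. a i \<otimes>\<^bsub>A\<^esub> y [^]\<^bsub>A\<^esub> e) \<in> hom_vars r \<rightarrow> carrier A"
      using that by (auto simp: Pi_iff)
    have "g' (\<lambda>v. case_option y (append_tuple r a z) (?shift v)) = g' (case_option y z)"
      by (rule form_local(2)[OF special_formD(1)[OF fg'] yz]) (auto simp: append_tuple_def)
    then show "G v (case_option y (append_tuple r a z)) =
        case_option (g' (case_option y z)) (\<lambda>i. a i \<otimes>\<^bsub>A\<^esub> y [^]\<^bsub>A\<^esub> e) v" if "v \<in> hom_vars r" for v
      using that by (auto simp: G_def append_tuple_def)
  qed
  ultimately show ?thesis by blast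
qed

end

section \<open>The saturated set of values\<close>

context field_algebra
begin

definition hom_values :: "'a \<Rightarrow> 'a set"
  where "hom_values b = {v. \<exists>r. \<exists>P \<in> hom_signature K r. \<exists>a \<in> {..<r} \<rightarrow> carrier A. \<exists>n::nat.
    v = poly_eval K A (case_option (b [^]\<^bsub>A\<^esub> n) a) P}"

definition sat_values :: "'a \<Rightarrow> 'a set"
  where "sat_values b = {s \<in> carrier A. \<exists>t::nat. b [^]\<^bsub>A\<^esub> t \<otimes>\<^bsub>A\<^esub> s \<in> hom_values b}"

lemma case_option_closed:
  "b \<in> C \<Longrightarrow> a \<in> {..<r} \<rightarrow> C \<Longrightarrow> case_option b a \<in> hom_vars r \<rightarrow> C"
  by (simp only: case_option_hom_vars simp_thms)

lemma hom_valuesI: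
  assumes g: "special_form r d f g" and a: "a \<in> {..<r} \<rightarrow> carrier A" and b: "b \<in> carrier A"
  shows "g (case_option (b [^]\<^bsub>A\<^esub> (n::nat)) a) \<in> hom_values b"
proof -
  obtain P where "P \<in> hom_signature K r" "\<And>x. x \<in> hom_vars r \<rightarrow> carrier A \<Longrightarrow> g x = poly_eval K A x P"
    using special_form_hom_signature[OF g] by blast
  then have "P \<in> hom_signature K r"
    "g (case_option (b [^]\<^bsub>A\<^esub> n) a) = poly_eval K A (case_option (b [^]\<^bsub>A\<^esub> n) a) P"
    using case_option_closed[OF _ a] b by auto
  then show ?thesis using a unfolding hom_values_def by blast
qed

lemma hom_valuesE:
  assumes "v \<in> hom_values b"
  obtains r d f g a and n :: nat where "special_form r d f g" "a \<in> {..<r} \<rightarrow> carrier A"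
    "v = g (case_option (b [^]\<^bsub>A\<^esub> n) a)"
proof -
  from assms obtain r P a n where P: "P \<in> hom_signature K r" "a \<in> {..<r} \<rightarrow> carrier A"
    "v = poly_eval K A (case_option (b [^]\<^bsub>A\<^esub> (n::nat)) a) P"
    unfolding hom_values_def by blast
  obtain d f where "special_form r d f (\<lambda>x. poly_eval K A x P)"
    using hom_signature_special_form[OF P(1)] by blast
  from that[OF this P(2,3)] show ?thesis .
qed

lemma special_form_value_closed:
  "special_form r d f g \<Longrightarrow> a \<in> {..<r} \<rightarrow> carrier A \<Longrightarrow> y \<in> carrier A \<Longrightarrow>
    g (case_option y a) \<in> carrier A"
  by (rule form_closed(2)[OF special_formD(1) case_option_closed])

lemma hom_values_closed:
  assumes "b \<in> carrier A" "v \<in> hom_values b" shows "v \<in> carrier A"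
  using assms(2) by (rule hom_valuesE) (use assms(1) special_form_value_closed in \<open>metis A.nat_pow_closed\<close>)

lemma special_form_scale:
  assumes g: "special_form r d f g" and a: "a \<in> {..<r} \<rightarrow> carrier A" and y: "y \<in> carrier A"
    and c: "c \<in> carrier A"
  shows "g (case_option (c \<otimes>\<^bsub>A\<^esub> y) (\<lambda>i. c \<otimes>\<^bsub>A\<^esub> a i)) = c [^]\<^bsub>A\<^esub> d \<otimes>\<^bsub>A\<^esub> g (case_option y a)"
proof -
  have "case_option (c \<otimes>\<^bsub>A\<^esub> y) (\<lambda>i. c \<otimes>\<^bsub>A\<^esub> a i) = (\<lambda>v. c \<otimes>\<^bsub>A\<^esub> case_option y a v)"
    by (simp add: fun_eq_iff split: option.split)
  then show ?thesis
    using form_scale[OF special_formD(1)[OF g] case_option_closed[OF y a] c] by simp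
qed

text \<open>The exponent of \<open>b\<close> can be raised from \<open>n\<close> to
  \<open>n + s\<close> by scaling the tuple too, at the price of the factor \<open>b^(s d)\<close>.
  These factors are what the saturation absorbs.\<close>

lemma special_form_shift:
  assumes g: "special_form r d f g" and a: "a \<in> {..<r} \<rightarrow> carrier A" and b: "b \<in> carrier A"
  shows "g (case_option (b [^]\<^bsub>A\<^esub> (n + s)) (\<lambda>i. b [^]\<^bsub>A\<^esub> s \<otimes>\<^bsub>A\<^esub> a i)) =
    b [^]\<^bsub>A\<^esub> (s * d) \<otimes>\<^bsub>A\<^esub> g (case_option (b [^]\<^bsub>A\<^esub> n) a)"
  using special_form_scale[OF g a, of "b [^]\<^bsub>A\<^esub> n" "b [^]\<^bsub>A\<^esub> s"] b
  by (simp add: A.nat_pow_mult A.nat_pow_pow add.commute)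

text \<open>The form \<open>Y\<close> itself, with no further variables. It puts the powers of
  \<open>b\<close> among the values and, used as a factor, raises the degree of a form by
  one.\<close>

lemma special_form_var: "special_form 0 1 (\<lambda>x. x None) (\<lambda>x. x None)"
  by (intro special_formI form_var) auto

lemma hom_values_mult:
  assumes b: "b \<in> carrier A" and v: "v \<in> hom_values b" and w: "w \<in> hom_values b"
  shows "\<exists>t::nat. b [^]\<^bsub>A\<^esub> t \<otimes>\<^bsub>A\<^esub> (v \<otimes>\<^bsub>A\<^esub> w) \<in> hom_values b"
proof -
  obtain r d f g a and n :: nat where g: "special_form r d f g" and a: "a \<in> {..<r} \<rightarrow> carrier A"
    and v': "v = g (case_option (b [^]\<^bsub>A\<^esub> n) a)" using v by (rule hom_valuesE)
  obtain r' d' f' g' a' and n' :: nat where g': "special_form r' d' f' g'"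
    and a': "a' \<in> {..<r'} \<rightarrow> carrier A" and w': "w = g' (case_option (b [^]\<^bsub>A\<^esub> n') a')"
    using w by (rule hom_valuesE)
  obtain F G where FG: "special_form (r + r') (d + d') F G"
    "\<And>y a z. y \<in> carrier A \<Longrightarrow> a \<in> {..<r} \<rightarrow> carrier A \<Longrightarrow> z \<in> {..<r'} \<rightarrow> carrier A \<Longrightarrow>
      G (case_option y (append_tuple r a z)) = g (case_option y a) \<otimes>\<^bsub>A\<^esub> g' (case_option y z)"
    using special_form_mult[OF g g'] by blast
  \<comment> \<open>Cross scaling: each tuple is multiplied by the power of \<open>b\<close> from
    the other value, so that both forms are evaluated at \<open>Y = b^(n + n')\<close>.\<close>
  let ?a = "\<lambda>i. b [^]\<^bsub>A\<^esub> n' \<otimes>\<^bsub>A\<^esub> a i" and ?a' = "\<lambda>i. b [^]\<^bsub>A\<^esub> n \<otimes>\<^bsub>A\<^esub> a' i"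
  have aa: "?a \<in> {..<r} \<rightarrow> carrier A" "?a' \<in> {..<r'} \<rightarrow> carrier A" using a a' b by auto
  have vw: "v \<in> carrier A" "w \<in> carrier A" using hom_values_closed b v w by auto
  have "G (case_option (b [^]\<^bsub>A\<^esub> (n + n')) (append_tuple r ?a ?a')) =
      (b [^]\<^bsub>A\<^esub> (n' * d) \<otimes>\<^bsub>A\<^esub> v) \<otimes>\<^bsub>A\<^esub> (b [^]\<^bsub>A\<^esub> (n * d') \<otimes>\<^bsub>A\<^esub> w)"
    using special_form_shift[OF g a b, of n n'] special_form_shift[OF g' a' b, of n' n] aa b
    by (simp add: FG(2) v' w' add.commute)
  also have "\<dots> = (b [^]\<^bsub>A\<^esub> (n' * d) \<otimes>\<^bsub>A\<^esub> b [^]\<^bsub>A\<^esub> (n * d')) \<otimes>\<^bsub>A\<^esub> (v \<otimes>\<^bsub>A\<^esub> w)"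
    using b vw by (simp add: A.m_ac)
  also have "\<dots> = b [^]\<^bsub>A\<^esub> (n' * d + n * d') \<otimes>\<^bsub>A\<^esub> (v \<otimes>\<^bsub>A\<^esub> w)"
    using b by (simp add: A.nat_pow_mult)
  finally show ?thesis
    using hom_valuesI[OF FG(1) append_tuple_closed[OF aa] b, of "n + n'"] by auto
qed

text \<open>The case \<open>n = 0\<close> puts \<open>1\<close> into the saturation; the case
  \<open>n = 1\<close> puts \<open>b\<close> there and so keeps \<open>b\<close> out of the prime
  constructed below.\<close>

lemma pow_hom_values: "b \<in> carrier A \<Longrightarrow> b [^]\<^bsub>A\<^esub> (n::nat) \<in> hom_values b"
  using hom_valuesI[OF special_form_var, of undefined b n] by simp

lemma hom_values_subset_sat_values:
  assumes "b \<in> carrier A" shows "hom_values b \<subseteq> sat_values b"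
proof
  fix v assume v: "v \<in> hom_values b"
  with hom_values_closed[OF assms v] show "v \<in> sat_values b"
    unfolding sat_values_def by (auto intro!: exI[of _ "0::nat"])
qed

lemma sat_values_mult:
  assumes b: "b \<in> carrier A" and v: "v \<in> sat_values b" and w: "w \<in> sat_values b"
  shows "v \<otimes>\<^bsub>A\<^esub> w \<in> sat_values b"
proof -
  obtain s t :: nat where st: "b [^]\<^bsub>A\<^esub> s \<otimes>\<^bsub>A\<^esub> v \<in> hom_values b" "b [^]\<^bsub>A\<^esub> t \<otimes>\<^bsub>A\<^esub> w \<in> hom_values b"
    and vw: "v \<in> carrier A" "w \<in> carrier A"
    using v w unfolding sat_values_def by blast
  obtain u :: nat where "b [^]\<^bsub>A\<^esub> u \<otimes>\<^bsub>A\<^esub> ((b [^]\<^bsub>A\<^esub> s \<otimes>\<^bsub>A\<^esub> v) \<otimes>\<^bsub>A\<^esub> (b [^]\<^bsub>A\<^esub> t \<otimes>\<^bsub>A\<^esub> w)) \<in> hom_values b"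
    using hom_values_mult[OF b st] by blast
  also have "b [^]\<^bsub>A\<^esub> u \<otimes>\<^bsub>A\<^esub> ((b [^]\<^bsub>A\<^esub> s \<otimes>\<^bsub>A\<^esub> v) \<otimes>\<^bsub>A\<^esub> (b [^]\<^bsub>A\<^esub> t \<otimes>\<^bsub>A\<^esub> w)) =
      (b [^]\<^bsub>A\<^esub> u \<otimes>\<^bsub>A\<^esub> (b [^]\<^bsub>A\<^esub> s \<otimes>\<^bsub>A\<^esub> b [^]\<^bsub>A\<^esub> t)) \<otimes>\<^bsub>A\<^esub> (v \<otimes>\<^bsub>A\<^esub> w)"
    using b vw by (simp add: A.m_ac)
  also have "\<dots> = b [^]\<^bsub>A\<^esub> (u + (s + t)) \<otimes>\<^bsub>A\<^esub> (v \<otimes>\<^bsub>A\<^esub> w)"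
    using b by (simp add: A.nat_pow_mult)
  finally show ?thesis using vw unfolding sat_values_def by auto
qed

lemma sat_values_submonoid:
  assumes "b \<in> carrier A" shows "submonoid (sat_values b) A"
proof
  show "sat_values b \<subseteq> carrier A" by (auto simp: sat_values_def)
  show "\<one>\<^bsub>A\<^esub> \<in> sat_values b"
    using hom_values_subset_sat_values[OF assms] pow_hom_values[OF assms, of 0] by auto
qed (rule sat_values_mult[OF assms])

text \<open>A representation fit for use as the inner form of a composite. A degree
  \<open>Suc e\<close> is needed for the factors \<open>X Y^e\<close>. At \<open>Y = b^n\<close>
  such a factor brings in \<open>b^(n e)\<close>, which must not exceed the power \<open>b^t\<close>
  by which the arguments are to be scaled; hence \<open>n * e \<le> t\<close>.\<close>

lemma sat_values_rep:
  assumes b: "b \<in> carrier A" and s: "s \<in> sat_values b"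
  obtains r e f g a and n t :: nat where "special_form r (Suc e) f g" "a \<in> {..<r} \<rightarrow> carrier A"
    "n * e \<le> t" "b [^]\<^bsub>A\<^esub> t \<otimes>\<^bsub>A\<^esub> s = g (case_option (b [^]\<^bsub>A\<^esub> n) a)"
proof -
  obtain t :: nat where t: "b [^]\<^bsub>A\<^esub> t \<otimes>\<^bsub>A\<^esub> s \<in> hom_values b" and sc: "s \<in> carrier A"
    using s unfolding sat_values_def by blast
  obtain r d f g a and n :: nat where g: "special_form r d f g" and a: "a \<in> {..<r} \<rightarrow> carrier A"
    and eq: "b [^]\<^bsub>A\<^esub> t \<otimes>\<^bsub>A\<^esub> s = g (case_option (b [^]\<^bsub>A\<^esub> n) a)"
    using t by (rule hom_valuesE)
  \<comment> \<open>Multiplying by \<open>Y\<close> makes the degree positive, whatever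
    \<open>d\<close> is.\<close>
  obtain F G where FG: "special_form r (Suc d) F G"
    "\<And>y a. y \<in> carrier A \<Longrightarrow> a \<in> {..<r} \<rightarrow> carrier A \<Longrightarrow>
      \<exists>c \<in> {..<r} \<rightarrow> carrier A. G (case_option y c) = y \<otimes>\<^bsub>A\<^esub> g (case_option y a)"
  proof -
    obtain F G where FG: "special_form (0 + r) (1 + d) F G"
      "\<And>y a z. y \<in> carrier A \<Longrightarrow> a \<in> {..<0} \<rightarrow> carrier A \<Longrightarrow> z \<in> {..<r} \<rightarrow> carrier A \<Longrightarrow>
        G (case_option y (append_tuple 0 a z)) = y \<otimes>\<^bsub>A\<^esub> g (case_option y z)"
      using special_form_mult[OF special_form_var g] by auto
    show ?thesis
    proof (rule that[of F G])
      show "special_form r (Suc d) F G" using FG(1) by simp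
      \<comment> \<open>\<open>Y\<close> uses no variables besides itself, so the first tuple is
        empty and \<open>undefined\<close> can stand for it.\<close>
      show "\<exists>c \<in> {..<r} \<rightarrow> carrier A. G (case_option y c) = y \<otimes>\<^bsub>A\<^esub> g (case_option y a)"
        if "y \<in> carrier A" "a \<in> {..<r} \<rightarrow> carrier A" for y a
        using FG(2)[of y undefined a] append_tuple_closed[of undefined 0 "carrier A" a r] that
        by (intro bexI[of _ "append_tuple 0 undefined a"]) auto
    qed
  qed
  obtain c where c: "c \<in> {..<r} \<rightarrow> carrier A"
    "G (case_option (b [^]\<^bsub>A\<^esub> n) c) = b [^]\<^bsub>A\<^esub> n \<otimes>\<^bsub>A\<^esub> g (case_option (b [^]\<^bsub>A\<^esub> n) a)"
    using FG(2)[of "b [^]\<^bsub>A\<^esub> n" a] a b by auto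
  \<comment> \<open>Chosen to make \<open>t\<close> large enough: shifting by \<open>?k\<close>
    turns the exponent of \<open>b\<close> into \<open>n + n d\<close> and adds
    \<open>?k * Suc d\<close>, which equals \<open>(n + ?k) * d\<close>, to the power in
    front.\<close>
  let ?k = "n * d"
  let ?c = "\<lambda>i. b [^]\<^bsub>A\<^esub> ?k \<otimes>\<^bsub>A\<^esub> c i"
  have "G (case_option (b [^]\<^bsub>A\<^esub> (n + ?k)) ?c) =
      b [^]\<^bsub>A\<^esub> (?k * Suc d) \<otimes>\<^bsub>A\<^esub> (b [^]\<^bsub>A\<^esub> n \<otimes>\<^bsub>A\<^esub> (b [^]\<^bsub>A\<^esub> t \<otimes>\<^bsub>A\<^esub> s))"
    using special_form_shift[OF FG(1) c(1) b] c(2) eq by simp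
  also have "\<dots> = b [^]\<^bsub>A\<^esub> (?k * Suc d + n + t) \<otimes>\<^bsub>A\<^esub> s"
    using b sc by (simp add: A.m_assoc[symmetric] A.nat_pow_mult add.assoc)
  finally have eq': "b [^]\<^bsub>A\<^esub> (?k * Suc d + n + t) \<otimes>\<^bsub>A\<^esub> s = G (case_option (b [^]\<^bsub>A\<^esub> (n + ?k)) ?c)" ..
  have "(n + ?k) * d \<le> ?k * Suc d + n + t" by (simp add: algebra_simps)
  moreover have "?c \<in> {..<r} \<rightarrow> carrier A" using b c by auto
  ultimately show ?thesis using that[OF FG(1) _ _ eq'] by blast
qed

lemma sat_values_poly_eval:
  assumes b: "b \<in> carrier A" and s: "s \<in> sat_values b" and P: "P \<in> hom_signature K r"
    and a: "a \<in> {..<r} \<rightarrow> carrier A"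
  shows "poly_eval K A (case_option s a) P \<in> sat_values b"
proof -
  define g where "g x = poly_eval K A x P" for x
  obtain d f where g: "special_form r d f g"
    using hom_signature_special_form[OF P] unfolding g_def by blast
  obtain r' e f' g' z and n t :: nat where g': "special_form r' (Suc e) f' g'"
    and z: "z \<in> {..<r'} \<rightarrow> carrier A" and nt: "n * e \<le> t"
    and eq: "b [^]\<^bsub>A\<^esub> t \<otimes>\<^bsub>A\<^esub> s = g' (case_option (b [^]\<^bsub>A\<^esub> n) z)"
    using b s by (rule sat_values_rep)
  have sc: "s \<in> carrier A" using s by (simp add: sat_values_def)
  obtain F G where FG: "special_form (r + r') (d * Suc e) F G"
    "\<And>y a z. y \<in> carrier A \<Longrightarrow> a \<in> {..<r} \<rightarrow> carrier A \<Longrightarrow> z \<in> {..<r'} \<rightarrow> carrier A \<Longrightarrow>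
      G (case_option y (append_tuple r a z)) =
        g (case_option (g' (case_option y z)) (\<lambda>i. a i \<otimes>\<^bsub>A\<^esub> y [^]\<^bsub>A\<^esub> e))"
    using special_form_compose[OF g g'] by blast
  \<comment> \<open>The composite multiplies each \<open>X\<close> by \<open>Y^e\<close>, that is by
    \<open>b^(n e)\<close>; the factor \<open>b^(t - n e)\<close> tops this up to
    \<open>b^t\<close>. All arguments of the outer form then share the factor \<open>b^t\<close>,
    which homogeneity pulls out as \<open>b^(t d)\<close>.\<close>
  let ?a = "\<lambda>i. b [^]\<^bsub>A\<^esub> (t - n * e) \<otimes>\<^bsub>A\<^esub> a i"
  have a': "?a \<in> {..<r} \<rightarrow> carrier A" using a b by auto
  have ae: "?a i \<otimes>\<^bsub>A\<^esub> (b [^]\<^bsub>A\<^esub> n) [^]\<^bsub>A\<^esub> e = b [^]\<^bsub>A\<^esub> t \<otimes>\<^bsub>A\<^esub> a i" if "i < r" for i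
  proof -
    have "a i \<in> carrier A" using a that by auto
    then have "?a i \<otimes>\<^bsub>A\<^esub> (b [^]\<^bsub>A\<^esub> n) [^]\<^bsub>A\<^esub> e = (b [^]\<^bsub>A\<^esub> (t - n * e) \<otimes>\<^bsub>A\<^esub> b [^]\<^bsub>A\<^esub> (n * e)) \<otimes>\<^bsub>A\<^esub> a i"
      using b by (simp add: A.nat_pow_pow A.m_ac)
    also have "b [^]\<^bsub>A\<^esub> (t - n * e) \<otimes>\<^bsub>A\<^esub> b [^]\<^bsub>A\<^esub> (n * e) = b [^]\<^bsub>A\<^esub> t"
      using b nt by (simp add: A.nat_pow_mult)
    finally show ?thesis .
  qed
  have "G (case_option (b [^]\<^bsub>A\<^esub> n) (append_tuple r ?a z)) =
      g (case_option (b [^]\<^bsub>A\<^esub> t \<otimes>\<^bsub>A\<^esub> s) (\<lambda>i. ?a i \<otimes>\<^bsub>A\<^esub> (b [^]\<^bsub>A\<^esub> n) [^]\<^bsub>A\<^esub> e))"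
    using FG(2)[OF _ a' z] b by (simp add: eq)
  also have "\<dots> = g (case_option (b [^]\<^bsub>A\<^esub> t \<otimes>\<^bsub>A\<^esub> s) (\<lambda>i. b [^]\<^bsub>A\<^esub> t \<otimes>\<^bsub>A\<^esub> a i))"
  proof (rule form_local(2)[OF special_formD(1)[OF g]])
    show "case_option (b [^]\<^bsub>A\<^esub> t \<otimes>\<^bsub>A\<^esub> s) (\<lambda>i. b [^]\<^bsub>A\<^esub> t \<otimes>\<^bsub>A\<^esub> a i) \<in> hom_vars r \<rightarrow> carrier A"
      by (rule case_option_closed) (use a b sc in auto)
  qed (use ae in auto)
  also have "\<dots> = (b [^]\<^bsub>A\<^esub> t) [^]\<^bsub>A\<^esub> d \<otimes>\<^bsub>A\<^esub> g (case_option s a)"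
    using special_form_scale[OF g a sc] b by simp
  also have "(b [^]\<^bsub>A\<^esub> t) [^]\<^bsub>A\<^esub> d = b [^]\<^bsub>A\<^esub> (t * d)" using b by (simp add: A.nat_pow_pow)
  finally have "b [^]\<^bsub>A\<^esub> (t * d) \<otimes>\<^bsub>A\<^esub> g (case_option s a) \<in> hom_values b"
    using hom_valuesI[OF FG(1) append_tuple_closed[OF a' z] b, of n] by simp
  moreover have "g (case_option s a) \<in> carrier A" by (rule special_form_value_closed[OF g a sc])
  ultimately show ?thesis unfolding sat_values_def g_def by blast
qed

end

section \<open>Special primes and the radical\<close>

text \<open>Zorn's lemma, with maximality recorded in the form in which it is used: for
  \<open>u\<close> outside \<open>p\<close> the ideal \<open>p + (u)\<close> is strictly larger and
  hence meets \<open>S\<close>.\<close>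

lemma (in cring) exists_ideal_maximal_disjoint:
  assumes I: "ideal I R" "I \<inter> S = {}"
  obtains p where "ideal p R" "I \<subseteq> p" "p \<inter> S = {}"
    "\<And>u. u \<in> carrier R \<Longrightarrow> u \<notin> p \<Longrightarrow> \<exists>x \<in> p. \<exists>e \<in> carrier R. x \<oplus> e \<otimes> u \<in> S"
proof -
  let ?F = "{J. ideal J R \<and> I \<subseteq> J \<and> J \<inter> S = {}}"
  have ne: "?F \<noteq> {}" using I by blast
  have chain: "\<Union>C \<in> ?F" if C: "C \<noteq> {}" "subset.chain ?F C" for C
  proof -
    have CF: "C \<subseteq> ?F" using C(2) by (simp add: pred_on.chain_def)
    have "subset.chain {J. ideal J R} C" using C(2) unfolding pred_on.chain_def by blast
    from chain_Union_is_ideal[OF this] C(1) have "ideal (\<Union>C) R" by simp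
    then show ?thesis using CF C(1) by blast
  qed
  have "\<exists>p \<in> ?F. \<forall>J \<in> ?F. p \<subseteq> J \<longrightarrow> J = p" by (rule subset_Zorn_nonempty[OF ne chain])
  then obtain p where p: "p \<in> ?F" and max: "\<forall>J \<in> ?F. p \<subseteq> J \<longrightarrow> J = p" by (rule bexE)
  interpret p: ideal p R using p by blast
  show ?thesis
  proof (rule that[of p])
    fix u assume u: "u \<in> carrier R" "u \<notin> p"
    let ?J = "p <+>\<^bsub>R\<^esub> PIdl u"
    have J: "ideal ?J R" by (rule add_ideals[OF p.is_ideal cgenideal_ideal[OF u(1)]])
    have elem: "x \<oplus> e \<otimes> u \<in> ?J" if "x \<in> p" "e \<in> carrier R" for x e
      using that by (auto simp: set_add_def' cgenideal_def)
    have sub: "p \<subseteq> ?J"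
    proof
      fix x assume "x \<in> p"
      with elem[of x \<zero>] u show "x \<in> ?J" by simp
    qed
    have "u \<in> ?J" using elem[of \<zero> \<one>] u by simp
    with u(2) max sub have "?J \<notin> ?F" by blast
    with J sub p obtain s where "s \<in> ?J" "s \<in> S" by blast
    then show "\<exists>x \<in> p. \<exists>e \<in> carrier R. x \<oplus> e \<otimes> u \<in> S"
      by (auto simp: set_add_def' cgenideal_def)
  qed (use p in auto)
qed

text \<open>Evaluation respects congruence modulo an ideal. Induction on the generation of the
  polynomial avoids the quotient algebra.\<close>

lemma (in k_algebra) poly_eval_cong_ideal:
  assumes p: "ideal p A" and P: "P \<in> K.indexed_pset V (carrier K)"
    and x: "x \<in> V \<rightarrow> carrier A" and y: "y \<in> V \<rightarrow> carrier A"
    and xy: "\<And>v. v \<in> V \<Longrightarrow> x v \<ominus>\<^bsub>A\<^esub> y v \<in> p"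
  shows "poly_eval K A x P \<ominus>\<^bsub>A\<^esub> poly_eval K A y P \<in> p"
proof -
  interpret p: ideal p A by (rule p)
  show ?thesis
    using P
  proof (induction)
    case (indexed_const k)
    then show ?case by (simp add: poly_eval_const A.minus_eq A.r_neg)
  next
    case (indexed_padd P Q)
    let ?a = "poly_eval K A x P" and ?b = "poly_eval K A x Q"
      and ?c = "poly_eval K A y P" and ?d = "poly_eval K A y Q"
    have "?a \<in> carrier A" "?b \<in> carrier A" "?c \<in> carrier A" "?d \<in> carrier A"
      using indexed_padd.hyps x y by (auto intro: poly_eval_closed)
    then have "(?a \<oplus>\<^bsub>A\<^esub> ?b) \<ominus>\<^bsub>A\<^esub> (?c \<oplus>\<^bsub>A\<^esub> ?d) = (?a \<ominus>\<^bsub>A\<^esub> ?c) \<oplus>\<^bsub>A\<^esub> (?b \<ominus>\<^bsub>A\<^esub> ?d)"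
      by (simp add: A.minus_eq A.minus_add A.a_ac)
    then show ?case using indexed_padd by (simp add: poly_eval_padd x y)
  next
    case (indexed_pmult P i)
    let ?a = "poly_eval K A x P" and ?c = "poly_eval K A y P"
    have c: "?a \<in> carrier A" "?c \<in> carrier A" "x i \<in> carrier A" "y i \<in> carrier A"
      using indexed_pmult.hyps x y by (auto intro: poly_eval_closed)
    \<comment> \<open>The product telescopes by changing one factor at a time:
      \<open>x a - y c = x (a - c) + (x - y) c\<close>.\<close>
    have "(x i \<ominus>\<^bsub>A\<^esub> y i) \<otimes>\<^bsub>A\<^esub> ?c \<in> p" "x i \<otimes>\<^bsub>A\<^esub> (?a \<ominus>\<^bsub>A\<^esub> ?c) \<in> p"
      using c xy[OF indexed_pmult.hyps(2)] indexed_pmult.IH by (auto intro: p.I_l_closed p.I_r_closed)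
    then have "x i \<otimes>\<^bsub>A\<^esub> (?a \<ominus>\<^bsub>A\<^esub> ?c) \<oplus>\<^bsub>A\<^esub> (x i \<ominus>\<^bsub>A\<^esub> y i) \<otimes>\<^bsub>A\<^esub> ?c \<in> p" by simp
    also have "x i \<otimes>\<^bsub>A\<^esub> (?a \<ominus>\<^bsub>A\<^esub> ?c) \<oplus>\<^bsub>A\<^esub> (x i \<ominus>\<^bsub>A\<^esub> y i) \<otimes>\<^bsub>A\<^esub> ?c = x i \<otimes>\<^bsub>A\<^esub> ?a \<ominus>\<^bsub>A\<^esub> y i \<otimes>\<^bsub>A\<^esub> ?c"
      using c by algebra
    finally show ?case using indexed_pmult.hyps by (simp add: poly_eval_pmult[OF _ _ x] poly_eval_pmult[OF _ _ y])
  qed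
qed

context field_algebra
begin

text \<open>Primality uses that the saturation is closed under multiplication, speciality that it is
  closed under values of special forms; both contradict that \<open>p\<close> misses it.\<close>

lemma exists_special_prime:
  assumes I: "ideal I A" and b: "b \<in> carrier A" and disj: "I \<inter> sat_values b = {}"
  obtains p where "primeideal p A" "special_ideal K A p" "I \<subseteq> p" "b \<notin> p"
proof -
  let ?S = "sat_values b"
  obtain p where p: "ideal p A" "I \<subseteq> p" "p \<inter> ?S = {}"
    and ext: "\<And>u. u \<in> carrier A \<Longrightarrow> u \<notin> p \<Longrightarrow> \<exists>x \<in> p. \<exists>e \<in> carrier A. x \<oplus>\<^bsub>A\<^esub> e \<otimes>\<^bsub>A\<^esub> u \<in> ?S"
    using A.exists_ideal_maximal_disjoint[OF I disj] by blast
  interpret p: ideal p A by (rule p(1))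
  interpret S: submonoid ?S A by (rule sat_values_submonoid[OF b])
  have "primeideal p A"
  proof (rule primeidealI[OF p(1) A.is_cring])
    show "carrier A \<noteq> p" using p(3) S.one_closed by blast
    fix u v assume uv: "u \<in> carrier A" "v \<in> carrier A" "u \<otimes>\<^bsub>A\<^esub> v \<in> p"
    show "u \<in> p \<or> v \<in> p"
    proof (rule ccontr)
      assume "\<not> (u \<in> p \<or> v \<in> p)"
      then obtain x e x' e' where x: "x \<in> p" "e \<in> carrier A" "x' \<in> p" "e' \<in> carrier A"
        and S: "x \<oplus>\<^bsub>A\<^esub> e \<otimes>\<^bsub>A\<^esub> u \<in> ?S" "x' \<oplus>\<^bsub>A\<^esub> e' \<otimes>\<^bsub>A\<^esub> v \<in> ?S"
        using ext[OF uv(1)] ext[OF uv(2)] by blast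
      have xc: "x \<in> carrier A" "x' \<in> carrier A" using x p.a_subset by auto
      \<comment> \<open>Modulo \<open>p\<close> the product of the two elements of \<open>?S\<close>
        is \<open>e e' u v\<close>, and \<open>u v\<close> lies in \<open>p\<close>.\<close>
      have "(x \<oplus>\<^bsub>A\<^esub> e \<otimes>\<^bsub>A\<^esub> u) \<otimes>\<^bsub>A\<^esub> (x' \<oplus>\<^bsub>A\<^esub> e' \<otimes>\<^bsub>A\<^esub> v) =
          (x' \<oplus>\<^bsub>A\<^esub> e' \<otimes>\<^bsub>A\<^esub> v) \<otimes>\<^bsub>A\<^esub> x \<oplus>\<^bsub>A\<^esub> ((e \<otimes>\<^bsub>A\<^esub> u) \<otimes>\<^bsub>A\<^esub> x' \<oplus>\<^bsub>A\<^esub> (e \<otimes>\<^bsub>A\<^esub> e') \<otimes>\<^bsub>A\<^esub> (u \<otimes>\<^bsub>A\<^esub> v))"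
        using xc x uv by algebra
      also have "\<dots> \<in> p"
        using x xc uv p.I_l_closed[OF uv(3), of "e \<otimes>\<^bsub>A\<^esub> e'"]
          p.I_l_closed[OF x(1), of "x' \<oplus>\<^bsub>A\<^esub> e' \<otimes>\<^bsub>A\<^esub> v"] p.I_l_closed[OF x(3), of "e \<otimes>\<^bsub>A\<^esub> u"]
        by auto
      finally show False using S.m_closed[OF S] p(3) by blast
    qed
  qed
  moreover have "special_ideal K A p"
    unfolding special_ideal_def
  proof (intro conjI p(1) allI ballI impI)
    fix r P a c
    assume P: "P \<in> hom_signature K r" and a: "a \<in> {..<r} \<rightarrow> carrier A" and c: "c \<in> carrier A"
      and Pp: "poly_eval K A (case_option c a) P \<in> p"
    show "c \<in> p"
    proof (rule ccontr)
      assume "c \<notin> p"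
      then obtain x e where x: "x \<in> p" "e \<in> carrier A" "x \<oplus>\<^bsub>A\<^esub> e \<otimes>\<^bsub>A\<^esub> c \<in> ?S" using ext[OF c] by blast
      let ?s = "x \<oplus>\<^bsub>A\<^esub> e \<otimes>\<^bsub>A\<^esub> c" and ?a = "\<lambda>i. e \<otimes>\<^bsub>A\<^esub> a i"
      have xc: "x \<in> carrier A" using x p.a_subset by auto
      \<comment> \<open>Homogeneity transfers membership in \<open>p\<close> from
        \<open>P(a, c)\<close> to \<open>P(e a, e c)\<close>, because \<open>c\<close> is controlled
        only through its multiple \<open>e c\<close>.\<close>
      obtain d f where "special_form r d f (\<lambda>x. poly_eval K A x P)"
        using hom_signature_special_form[OF P] by blast
      from special_form_scale[OF this a c x(2)]
      have ec: "poly_eval K A (case_option (e \<otimes>\<^bsub>A\<^esub> c) ?a) P \<in> p" (is "?y \<in> p")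
        using x Pp by (simp add: p.I_l_closed)
      have a': "?a \<in> {..<r} \<rightarrow> carrier A" using a x by auto
      \<comment> \<open>Replacing \<open>e c\<close> by \<open>?s = x + e c\<close> changes only the
        \<open>Y\<close> argument, and by an element of \<open>p\<close>.\<close>
      have "poly_eval K A (case_option ?s ?a) P \<ominus>\<^bsub>A\<^esub> ?y \<in> p"
      proof (rule poly_eval_cong_ideal[OF p(1) hom_signatureD(1)[OF P]])
        show "case_option ?s ?a \<in> hom_vars r \<rightarrow> carrier A" "case_option (e \<otimes>\<^bsub>A\<^esub> c) ?a \<in> hom_vars r \<rightarrow> carrier A"
          using a' c x xc by (intro case_option_closed; simp)+
        have "?s \<ominus>\<^bsub>A\<^esub> e \<otimes>\<^bsub>A\<^esub> c = x" using x xc c by algebra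
        then show "case_option ?s ?a v \<ominus>\<^bsub>A\<^esub> case_option (e \<otimes>\<^bsub>A\<^esub> c) ?a v \<in> p" if "v \<in> hom_vars r" for v
          using that a' x(1) by (auto simp: A.minus_eq A.r_neg Pi_iff)
      qed
      from p.a_closed[OF this ec] have "(poly_eval K A (case_option ?s ?a) P \<ominus>\<^bsub>A\<^esub> ?y) \<oplus>\<^bsub>A\<^esub> ?y \<in> p" .
      moreover have sat: "poly_eval K A (case_option ?s ?a) P \<in> ?S"
        by (rule sat_values_poly_eval[OF b x(3) P a'])
      then have "poly_eval K A (case_option ?s ?a) P \<in> carrier A" "?y \<in> carrier A"
        using ec p.a_subset S.subset by blast+
      then have "(poly_eval K A (case_option ?s ?a) P \<ominus>\<^bsub>A\<^esub> ?y) \<oplus>\<^bsub>A\<^esub> ?y = poly_eval K A (case_option ?s ?a) P"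
        by (simp add: A.minus_eq A.a_assoc A.l_neg)
      ultimately show False using sat p(3) by auto
    qed
  qed
  moreover have "b \<notin> p"
    using pow_hom_values[OF b, of 1] hom_values_subset_sat_values[OF b] p(3) b by auto
  ultimately show ?thesis using that p(2) by blast
qed

lemma prime_pow:
  assumes "primeideal p A" "b \<in> carrier A" "b [^]\<^bsub>A\<^esub> (n::nat) \<in> p"
  shows "b \<in> p"
proof -
  interpret p: primeideal p A by (rule assms(1))
  show ?thesis using assms(3)
  proof (induction n)
    case 0
    then show ?case using p.I_notcarr p.one_imp_carrier by simp
  next
    case (Suc n)
    then show ?case using p.I_prime[of "b [^]\<^bsub>A\<^esub> n" b] assms(2) by auto
  qed
qed

text \<open>If \<open>I\<close> misses the values, it misses their saturation, and some special
  prime over \<open>I\<close> avoids \<open>b\<close>. Conversely, a special prime containing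
  \<open>P(a, b^n)\<close> contains \<open>b^n\<close> and, being prime, \<open>b\<close>.\<close>

lemma special_radical_hom_values:
  assumes I: "ideal I A"
  shows "special_radical K A I = {b \<in> carrier A. I \<inter> hom_values b \<noteq> {}}"
proof (intro equalityI subsetI)
  interpret I: ideal I A by (rule I)
  fix b assume b: "b \<in> special_radical K A I"
  then have bc: "b \<in> carrier A" by (simp add: special_radical_def)
  have "I \<inter> sat_values b \<noteq> {}"
  proof
    assume "I \<inter> sat_values b = {}"
    then obtain p where "primeideal p A" "special_ideal K A p" "I \<subseteq> p" "b \<notin> p"
      by (rule exists_special_prime[OF I bc])
    with b show False by (auto simp: special_radical_def)
  qed
  then obtain s and t :: nat where "s \<in> I" "b [^]\<^bsub>A\<^esub> t \<otimes>\<^bsub>A\<^esub> s \<in> hom_values b"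
    by (auto simp: sat_values_def)
  with I.I_l_closed[of s "b [^]\<^bsub>A\<^esub> t"] bc show "b \<in> {b \<in> carrier A. I \<inter> hom_values b \<noteq> {}}" by auto
next
  fix b assume "b \<in> {b \<in> carrier A. I \<inter> hom_values b \<noteq> {}}"
  then obtain r P a n where b: "b \<in> carrier A" and P: "P \<in> hom_signature K r" "a \<in> {..<r} \<rightarrow> carrier A"
    "poly_eval K A (case_option (b [^]\<^bsub>A\<^esub> (n::nat)) a) P \<in> I"
    unfolding hom_values_def by blast
  have "b \<in> p" if p: "primeideal p A" "special_ideal K A p" "I \<subseteq> p" for p
  proof -
    have "b [^]\<^bsub>A\<^esub> n \<in> p"
      using p(2,3) P b unfolding special_ideal_def by (meson A.nat_pow_closed subsetD)
    then show ?thesis by (rule prime_pow[OF p(1) b])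
  qed
  with b show "b \<in> special_radical K A I" by (auto simp: special_radical_def)
qed

section \<open>Sets between the values and their saturation\<close>

lemma Sigma_gens_subset_sat_values:
  assumes b: "b \<in> carrier A" shows "Sigma_gens K A b \<subseteq> sat_values b"
proof
  fix v assume "v \<in> Sigma_gens K A b"
  then obtain m n :: nat and r D a where v:
    "v = b [^]\<^bsub>A\<^esub> m \<otimes>\<^bsub>A\<^esub> poly_eval K A (case_option (b [^]\<^bsub>A\<^esub> n) a) (homogenisation K D)"
    and D: "D \<in> alg_signature K r" "a \<in> {..<r} \<rightarrow> carrier A"
    unfolding Sigma_gens_def by blast
  have "poly_eval K A (case_option (b [^]\<^bsub>A\<^esub> n) a) (homogenisation K D) \<in> hom_values b"
    using D homogenisation_hom_signature[OF D(1)] unfolding hom_values_def by blast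
  then show "v \<in> sat_values b"
    unfolding v using hom_values_subset_sat_values[OF b] pow_hom_values[OF b]
    by (intro sat_values_mult[OF b]) auto
qed

text \<open>Writing \<open>P = Y^j D#\<close> and evaluating at \<open>Y = b^n\<close> gives
  \<open>b^(n j) D#(a, b^n)\<close>, already a generator.\<close>

lemma hom_values_subset_Sigma_gens:
  assumes b: "b \<in> carrier A" shows "hom_values b \<subseteq> Sigma_gens K A b"
proof
  fix v assume "v \<in> hom_values b"
  then obtain r P a and n :: nat where P: "P \<in> hom_signature K r" and a: "a \<in> {..<r} \<rightarrow> carrier A"
    and v: "v = poly_eval K A (case_option (b [^]\<^bsub>A\<^esub> n) a) P"
    unfolding hom_values_def by blast
  obtain D j where D: "D \<in> alg_signature K r"
    "\<And>a b. a \<in> {..<r} \<rightarrow> carrier A \<Longrightarrow> b \<in> carrier A \<Longrightarrow>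
      poly_eval K A (case_option b a) P =
        b [^]\<^bsub>A\<^esub> (j::nat) \<otimes>\<^bsub>A\<^esub> poly_eval K A (case_option b a) (homogenisation K D)"
    using dehomogenisation[OF P] by blast
  have "v = b [^]\<^bsub>A\<^esub> (n * j) \<otimes>\<^bsub>A\<^esub> poly_eval K A (case_option (b [^]\<^bsub>A\<^esub> n) a) (homogenisation K D)"
    unfolding v using D(2)[OF a, of "b [^]\<^bsub>A\<^esub> n"] b by (simp add: A.nat_pow_pow)
  then show "v \<in> Sigma_gens K A b" unfolding Sigma_gens_def using D(1) a by blast
qed

text \<open>An ideal containing \<open>s\<close> contains \<open>b^t s\<close>. Consequently every
  set between \<open>hom_values b\<close> and \<open>sat_values b\<close> describes the same
  radical.\<close>

lemma ideal_meets_sat_values: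
  assumes "ideal I A" "b \<in> carrier A" "I \<inter> sat_values b \<noteq> {}"
  shows "I \<inter> hom_values b \<noteq> {}"
proof -
  interpret I: ideal I A by (rule assms(1))
  obtain s and t :: nat where "s \<in> I" "b [^]\<^bsub>A\<^esub> t \<otimes>\<^bsub>A\<^esub> s \<in> hom_values b"
    using assms(3) by (auto simp: sat_values_def)
  with I.I_l_closed[of s "b [^]\<^bsub>A\<^esub> t"] assms(2) show ?thesis by auto
qed

lemma special_radical_Sigma_gens:
  assumes I: "ideal I A"
  shows "special_radical K A I = {b \<in> carrier A. I \<inter> Sigma_gens K A b \<noteq> {}}"
  unfolding special_radical_hom_values[OF I]
  using hom_values_subset_Sigma_gens Sigma_gens_subset_sat_values ideal_meets_sat_values[OF I]
  by blast

text \<open>The saturation is a submonoid containing the generators, so it also contains everything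
  they generate.\<close>

lemma special_radical_Sigma_set:
  assumes I: "ideal I A"
  shows "special_radical K A I = {b \<in> carrier A. I \<inter> Sigma_set K A b \<noteq> {}}"
proof -
  have "Sigma_gens K A b \<subseteq> Sigma_set K A b" "Sigma_set K A b \<subseteq> sat_values b" if "b \<in> carrier A" for b
    unfolding Sigma_set_def
    using sat_values_submonoid[OF that] Sigma_gens_subset_sat_values[OF that] by blast+
  then show ?thesis
    unfolding special_radical_hom_values[OF I]
    using hom_values_subset_Sigma_gens ideal_meets_sat_values[OF I] by blast
qed

text \<open>Given \<open>b^m D#(a, b^n)\<close> in \<open>I\<close>, both exponents are raised to
  \<open>n + m\<close>.\<close>

lemma special_radical_equal_exponents:
  assumes I: "ideal I A"
  shows "special_radical K A I = {b \<in> carrier A. \<exists>(n::nat) r. \<exists>D \<in> alg_signature K r.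
    \<exists>a \<in> {..<r} \<rightarrow> carrier A.
      b [^]\<^bsub>A\<^esub> n \<otimes>\<^bsub>A\<^esub> poly_eval K A (case_option (b [^]\<^bsub>A\<^esub> n) a) (homogenisation K D) \<in> I}"
  (is "_ = ?R")
proof (intro equalityI subsetI)
  fix b assume "b \<in> ?R"
  then show "b \<in> special_radical K A I"
    unfolding special_radical_Sigma_gens[OF I] Sigma_gens_def by blast
next
  interpret I: ideal I A by (rule I)
  fix b assume "b \<in> special_radical K A I"
  then obtain m n :: nat and r D a where b: "b \<in> carrier A"
    and D: "D \<in> alg_signature K r" and a: "a \<in> {..<r} \<rightarrow> carrier A"
    and mem: "b [^]\<^bsub>A\<^esub> m \<otimes>\<^bsub>A\<^esub> poly_eval K A (case_option (b [^]\<^bsub>A\<^esub> n) a) (homogenisation K D) \<in> I"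
      (is "_ \<otimes>\<^bsub>A\<^esub> ?v \<in> I")
    unfolding special_radical_Sigma_gens[OF I] Sigma_gens_def by blast
  obtain d f where g: "special_form r d f (\<lambda>x. poly_eval K A x (homogenisation K D))"
    using hom_signature_special_form[OF homogenisation_hom_signature[OF D]] by blast
  \<comment> \<open>Scaling by \<open>b^m\<close> moves \<open>Y\<close> from \<open>b^n\<close> to
    \<open>b^(n + m)\<close> and yields the factor \<open>b^(m d)\<close>. With
    \<open>b^(n + m)\<close> in front, a factor \<open>b^m\<close> can be split off to recover the
    given element of \<open>I\<close>.\<close>
  let ?a = "\<lambda>i. b [^]\<^bsub>A\<^esub> m \<otimes>\<^bsub>A\<^esub> a i"
  have v: "?v \<in> carrier A" using special_form_value_closed[OF g a] b by simp
  have "b [^]\<^bsub>A\<^esub> (n + m) \<otimes>\<^bsub>A\<^esub> poly_eval K A (case_option (b [^]\<^bsub>A\<^esub> (n + m)) ?a) (homogenisation K D) =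
      b [^]\<^bsub>A\<^esub> (n + m) \<otimes>\<^bsub>A\<^esub> (b [^]\<^bsub>A\<^esub> (m * d) \<otimes>\<^bsub>A\<^esub> ?v)"
    by (simp add: special_form_shift[OF g a b])
  also have "\<dots> = b [^]\<^bsub>A\<^esub> (n + m * d) \<otimes>\<^bsub>A\<^esub> (b [^]\<^bsub>A\<^esub> m \<otimes>\<^bsub>A\<^esub> ?v)"
    using b v by (simp add: A.m_assoc[symmetric] A.nat_pow_mult algebra_simps)
  also have "\<dots> \<in> I" using I.I_l_closed[OF mem] b by simp
  finally have "b [^]\<^bsub>A\<^esub> (n + m) \<otimes>\<^bsub>A\<^esub>
      poly_eval K A (case_option (b [^]\<^bsub>A\<^esub> (n + m)) ?a) (homogenisation K D) \<in> I" .
  moreover have "?a \<in> {..<r} \<rightarrow> carrier A" using a b by auto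
  ultimately show "b \<in> ?R" using b D by blast
qed

end

section \<open>Localisation\<close>

text \<open>The operations of the localisation are unions over all representatives. Once all
  representatives give the same class, and there is at least one, the union is that class.\<close>

lemma UN_pair_const:
  assumes "(r, s) \<in> U" "\<And>x y. (x, y) \<in> U \<Longrightarrow> h x y = c"
  shows "(\<Union>(x, y) \<in> U. h x y) = c"
proof -
  have "(\<Union>(x, y) \<in> U. h x y) = (\<Union>p \<in> U. c)" using assms(2) by (intro SUP_cong refl) auto
  with assms(1) show ?thesis by auto
qed

lemma UN_pairs_const:
  assumes "(r, s) \<in> U" "(r', s') \<in> V"
    "\<And>x y x' y'. (x, y) \<in> U \<Longrightarrow> (x', y') \<in> V \<Longrightarrow> h x y x' y' = c"
  shows "(\<Union>(x, y) \<in> U. \<Union>(x', y') \<in> V. h x y x' y') = c"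
  using assms by (intro UN_pair_const)

locale localised_algebra = k_algebra K A + S: submonoid S A
  for K :: "('k, 'x) ring_scheme" (structure) and A :: "('k, 'a, 'y) module_scheme" (structure) and S
begin

abbreviation frac_S :: "'a \<Rightarrow> 'a \<Rightarrow> ('a \<times> 'a) set" where "frac_S \<equiv> frac A S"

abbreviation L :: "('k, ('a \<times> 'a) set) module" where "L \<equiv> localisation A S"

lemma equiv_frac_rel: "equiv (carrier A \<times> S) (frac_rel A S)"
proof (rule equivI)
  show "frac_rel A S \<subseteq> (carrier A \<times> S) \<times> (carrier A \<times> S)" by (auto simp: frac_rel_def)
  show "refl_on (carrier A \<times> S) (frac_rel A S)"
    by (rule refl_onI) (auto simp: frac_rel_def A.minus_eq A.r_neg intro!: bexI[of _ "\<one>\<^bsub>A\<^esub>"])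
  show "sym (frac_rel A S)"
  proof (rule symI)
    fix p q assume "(p, q) \<in> frac_rel A S"
    then obtain r s r' s' t where rs: "p = (r, s)" "q = (r', s')" "r \<in> carrier A" "r' \<in> carrier A"
      "s \<in> S" "s' \<in> S" "t \<in> S" "t \<otimes>\<^bsub>A\<^esub> (r \<otimes>\<^bsub>A\<^esub> s' \<ominus>\<^bsub>A\<^esub> r' \<otimes>\<^bsub>A\<^esub> s) = \<zero>\<^bsub>A\<^esub>"
      by (auto simp: frac_rel_def)
    then have c: "s \<in> carrier A" "s' \<in> carrier A" "t \<in> carrier A" by auto
    have "t \<otimes>\<^bsub>A\<^esub> (r' \<otimes>\<^bsub>A\<^esub> s \<ominus>\<^bsub>A\<^esub> r \<otimes>\<^bsub>A\<^esub> s') = \<ominus>\<^bsub>A\<^esub> (t \<otimes>\<^bsub>A\<^esub> (r \<otimes>\<^bsub>A\<^esub> s' \<ominus>\<^bsub>A\<^esub> r' \<otimes>\<^bsub>A\<^esub> s))"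
      using rs(3,4) c by algebra
    with rs show "(q, p) \<in> frac_rel A S" unfolding frac_rel_def by fastforce
  qed
  show "trans (frac_rel A S)"
  proof (rule transI)
    fix p q w assume pq: "(p, q) \<in> frac_rel A S" and qw: "(q, w) \<in> frac_rel A S"
    from pq obtain r s r' s' t where rs: "p = (r, s)" "q = (r', s')" "r \<in> carrier A" "r' \<in> carrier A"
      "s \<in> S" "s' \<in> S" "t \<in> S" "t \<otimes>\<^bsub>A\<^esub> (r \<otimes>\<^bsub>A\<^esub> s' \<ominus>\<^bsub>A\<^esub> r' \<otimes>\<^bsub>A\<^esub> s) = \<zero>\<^bsub>A\<^esub>"
      by (auto simp: frac_rel_def)
    from qw rs(2) obtain r'' s'' t' where rs': "w = (r'', s'')" "r'' \<in> carrier A" "s'' \<in> S" "t' \<in> S"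
      "t' \<otimes>\<^bsub>A\<^esub> (r' \<otimes>\<^bsub>A\<^esub> s'' \<ominus>\<^bsub>A\<^esub> r'' \<otimes>\<^bsub>A\<^esub> s') = \<zero>\<^bsub>A\<^esub>"
      by (auto simp: frac_rel_def)
    have c: "s \<in> carrier A" "s' \<in> carrier A" "s'' \<in> carrier A" "t \<in> carrier A" "t' \<in> carrier A"
      using rs rs' by auto
    \<comment> \<open>The extra factor \<open>s'\<close> in the witness lets the two terms
      containing \<open>r'\<close> cancel.\<close>
    have "(t \<otimes>\<^bsub>A\<^esub> t' \<otimes>\<^bsub>A\<^esub> s') \<otimes>\<^bsub>A\<^esub> (r \<otimes>\<^bsub>A\<^esub> s'' \<ominus>\<^bsub>A\<^esub> r'' \<otimes>\<^bsub>A\<^esub> s) =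
        (t' \<otimes>\<^bsub>A\<^esub> s'') \<otimes>\<^bsub>A\<^esub> (t \<otimes>\<^bsub>A\<^esub> (r \<otimes>\<^bsub>A\<^esub> s' \<ominus>\<^bsub>A\<^esub> r' \<otimes>\<^bsub>A\<^esub> s)) \<oplus>\<^bsub>A\<^esub>
        (t \<otimes>\<^bsub>A\<^esub> s) \<otimes>\<^bsub>A\<^esub> (t' \<otimes>\<^bsub>A\<^esub> (r' \<otimes>\<^bsub>A\<^esub> s'' \<ominus>\<^bsub>A\<^esub> r'' \<otimes>\<^bsub>A\<^esub> s'))"
      using rs(3,4) rs'(2) c by algebra
    also have "\<dots> = \<zero>\<^bsub>A\<^esub>" using c by (simp add: rs(8) rs'(5))
    finally show "(p, w) \<in> frac_rel A S"
      using rs(1,3,5,6,7) rs'(1-4)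
      by (auto simp: frac_rel_def intro!: bexI[of _ "t \<otimes>\<^bsub>A\<^esub> t' \<otimes>\<^bsub>A\<^esub> s'"])
  qed
qed

lemma frac_eq_iff:
  assumes "r \<in> carrier A" "s \<in> S" "r' \<in> carrier A" "s' \<in> S"
  shows "frac_S r s = frac_S r' s' \<longleftrightarrow>
    (\<exists>t \<in> S. t \<otimes>\<^bsub>A\<^esub> (r \<otimes>\<^bsub>A\<^esub> s' \<ominus>\<^bsub>A\<^esub> r' \<otimes>\<^bsub>A\<^esub> s) = \<zero>\<^bsub>A\<^esub>)"
proof -
  have "frac_S r s = frac_S r' s' \<longleftrightarrow> ((r, s), (r', s')) \<in> frac_rel A S"
    unfolding frac_def using equiv_frac_rel by (rule eq_equiv_class_iff) (use assms in auto)
  then show ?thesis using assms by (auto simp: frac_rel_def)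
qed

lemma frac_eqI:
  assumes "r \<in> carrier A" "s \<in> S" "r' \<in> carrier A" "s' \<in> S" "r \<otimes>\<^bsub>A\<^esub> s' = r' \<otimes>\<^bsub>A\<^esub> s"
  shows "frac_S r s = frac_S r' s'"
  using assms by (auto simp: frac_eq_iff A.minus_eq A.r_neg intro!: bexI[of _ "\<one>\<^bsub>A\<^esub>"])

lemma frac_self: "r \<in> carrier A \<Longrightarrow> s \<in> S \<Longrightarrow> (r, s) \<in> frac_S r s"
  unfolding frac_def using equiv_class_self[OF equiv_frac_rel] by auto

lemma frac_memD:
  assumes "(r', s') \<in> frac_S r s"
  shows "r' \<in> carrier A" "s' \<in> S" "r \<in> carrier A" "s \<in> S"
    "\<exists>t \<in> S. t \<otimes>\<^bsub>A\<^esub> (r \<otimes>\<^bsub>A\<^esub> s' \<ominus>\<^bsub>A\<^esub> r' \<otimes>\<^bsub>A\<^esub> s) = \<zero>\<^bsub>A\<^esub>"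
  using assms unfolding frac_def frac_rel_def by auto

lemma frac_closed: "r \<in> carrier A \<Longrightarrow> s \<in> S \<Longrightarrow> frac_S r s \<in> carrier L"
  unfolding localisation_def frac_def by (auto intro: quotientI)

lemma localisation_carrierE:
  assumes "U \<in> carrier L"
  obtains r s where "r \<in> carrier A" "s \<in> S" "U = frac_S r s"
  using assms unfolding localisation_def frac_def by (auto elim!: quotientE)

lemma frac_mult:
  assumes r: "r \<in> carrier A" "s \<in> S" "r' \<in> carrier A" "s' \<in> S"
  shows "frac_S r s \<otimes>\<^bsub>L\<^esub> frac_S r' s' = frac_S (r \<otimes>\<^bsub>A\<^esub> r') (s \<otimes>\<^bsub>A\<^esub> s')"
proof -
  have "frac_S (x \<otimes>\<^bsub>A\<^esub> x') (y \<otimes>\<^bsub>A\<^esub> y') = frac_S (r \<otimes>\<^bsub>A\<^esub> r') (s \<otimes>\<^bsub>A\<^esub> s')"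
    if xy: "(x, y) \<in> frac_S r s" "(x', y') \<in> frac_S r' s'" for x y x' y'
  proof -
    obtain t t' where t: "t \<in> S" "t \<otimes>\<^bsub>A\<^esub> (r \<otimes>\<^bsub>A\<^esub> y \<ominus>\<^bsub>A\<^esub> x \<otimes>\<^bsub>A\<^esub> s) = \<zero>\<^bsub>A\<^esub>"
      "t' \<in> S" "t' \<otimes>\<^bsub>A\<^esub> (r' \<otimes>\<^bsub>A\<^esub> y' \<ominus>\<^bsub>A\<^esub> x' \<otimes>\<^bsub>A\<^esub> s') = \<zero>\<^bsub>A\<^esub>"
      using frac_memD(5)[OF xy(1)] frac_memD(5)[OF xy(2)] by blast
    note m = frac_memD(1,2)[OF xy(1)] frac_memD(1,2)[OF xy(2)]
    have c: "y \<in> carrier A" "y' \<in> carrier A" "s \<in> carrier A" "s' \<in> carrier A" "t \<in> carrier A" "t' \<in> carrier A"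
      using m r t by auto
    \<comment> \<open>Independence of representatives by changing one fraction at a time: the
      difference is a combination of the two expressions killed by \<open>t\<close> and
      \<open>t'\<close>.\<close>
    have "(t \<otimes>\<^bsub>A\<^esub> t') \<otimes>\<^bsub>A\<^esub> ((x \<otimes>\<^bsub>A\<^esub> x') \<otimes>\<^bsub>A\<^esub> (s \<otimes>\<^bsub>A\<^esub> s') \<ominus>\<^bsub>A\<^esub> (r \<otimes>\<^bsub>A\<^esub> r') \<otimes>\<^bsub>A\<^esub> (y \<otimes>\<^bsub>A\<^esub> y')) =
        \<ominus>\<^bsub>A\<^esub> ((t' \<otimes>\<^bsub>A\<^esub> (x' \<otimes>\<^bsub>A\<^esub> s')) \<otimes>\<^bsub>A\<^esub> (t \<otimes>\<^bsub>A\<^esub> (r \<otimes>\<^bsub>A\<^esub> y \<ominus>\<^bsub>A\<^esub> x \<otimes>\<^bsub>A\<^esub> s)) \<oplus>\<^bsub>A\<^esub>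
        (t \<otimes>\<^bsub>A\<^esub> (r \<otimes>\<^bsub>A\<^esub> y)) \<otimes>\<^bsub>A\<^esub> (t' \<otimes>\<^bsub>A\<^esub> (r' \<otimes>\<^bsub>A\<^esub> y' \<ominus>\<^bsub>A\<^esub> x' \<otimes>\<^bsub>A\<^esub> s')))"
      using c m r by algebra
    also have "\<dots> = \<zero>\<^bsub>A\<^esub>" using c m r by (simp add: t)
    finally show ?thesis
      using m r t(1,3) by (subst frac_eq_iff) auto
  qed
  then show ?thesis
    unfolding localisation_def ring.simps monoid.simps
    by (intro UN_pairs_const[OF frac_self[OF r(1,2)] frac_self[OF r(3,4)]])
qed

lemma frac_add:
  assumes r: "r \<in> carrier A" "s \<in> S" "r' \<in> carrier A" "s' \<in> S"
  shows "frac_S r s \<oplus>\<^bsub>L\<^esub> frac_S r' s' = frac_S (r \<otimes>\<^bsub>A\<^esub> s' \<oplus>\<^bsub>A\<^esub> r' \<otimes>\<^bsub>A\<^esub> s) (s \<otimes>\<^bsub>A\<^esub> s')"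
proof -
  have "frac_S (x \<otimes>\<^bsub>A\<^esub> y' \<oplus>\<^bsub>A\<^esub> x' \<otimes>\<^bsub>A\<^esub> y) (y \<otimes>\<^bsub>A\<^esub> y') =
      frac_S (r \<otimes>\<^bsub>A\<^esub> s' \<oplus>\<^bsub>A\<^esub> r' \<otimes>\<^bsub>A\<^esub> s) (s \<otimes>\<^bsub>A\<^esub> s')"
    if xy: "(x, y) \<in> frac_S r s" "(x', y') \<in> frac_S r' s'" for x y x' y'
  proof -
    obtain t t' where t: "t \<in> S" "t \<otimes>\<^bsub>A\<^esub> (r \<otimes>\<^bsub>A\<^esub> y \<ominus>\<^bsub>A\<^esub> x \<otimes>\<^bsub>A\<^esub> s) = \<zero>\<^bsub>A\<^esub>"
      "t' \<in> S" "t' \<otimes>\<^bsub>A\<^esub> (r' \<otimes>\<^bsub>A\<^esub> y' \<ominus>\<^bsub>A\<^esub> x' \<otimes>\<^bsub>A\<^esub> s') = \<zero>\<^bsub>A\<^esub>"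
      using frac_memD(5)[OF xy(1)] frac_memD(5)[OF xy(2)] by blast
    note m = frac_memD(1,2)[OF xy(1)] frac_memD(1,2)[OF xy(2)]
    have c: "y \<in> carrier A" "y' \<in> carrier A" "s \<in> carrier A" "s' \<in> carrier A" "t \<in> carrier A" "t' \<in> carrier A"
      using m r t by auto
    \<comment> \<open>Here too each summand of the difference contains one of the two expressions
      killed by \<open>t\<close> and \<open>t'\<close>.\<close>
    have "(t \<otimes>\<^bsub>A\<^esub> t') \<otimes>\<^bsub>A\<^esub> ((x \<otimes>\<^bsub>A\<^esub> y' \<oplus>\<^bsub>A\<^esub> x' \<otimes>\<^bsub>A\<^esub> y) \<otimes>\<^bsub>A\<^esub> (s \<otimes>\<^bsub>A\<^esub> s') \<ominus>\<^bsub>A\<^esub>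
          (r \<otimes>\<^bsub>A\<^esub> s' \<oplus>\<^bsub>A\<^esub> r' \<otimes>\<^bsub>A\<^esub> s) \<otimes>\<^bsub>A\<^esub> (y \<otimes>\<^bsub>A\<^esub> y')) =
        \<ominus>\<^bsub>A\<^esub> ((t' \<otimes>\<^bsub>A\<^esub> (y' \<otimes>\<^bsub>A\<^esub> s')) \<otimes>\<^bsub>A\<^esub> (t \<otimes>\<^bsub>A\<^esub> (r \<otimes>\<^bsub>A\<^esub> y \<ominus>\<^bsub>A\<^esub> x \<otimes>\<^bsub>A\<^esub> s)) \<oplus>\<^bsub>A\<^esub>
        (t \<otimes>\<^bsub>A\<^esub> (y \<otimes>\<^bsub>A\<^esub> s)) \<otimes>\<^bsub>A\<^esub> (t' \<otimes>\<^bsub>A\<^esub> (r' \<otimes>\<^bsub>A\<^esub> y' \<ominus>\<^bsub>A\<^esub> x' \<otimes>\<^bsub>A\<^esub> s')))"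
      using c m r by algebra
    also have "\<dots> = \<zero>\<^bsub>A\<^esub>" using c m r by (simp add: t)
    finally show ?thesis
      using m r c t(1,3) by (subst frac_eq_iff) auto
  qed
  then show ?thesis
    unfolding localisation_def ring.simps monoid.simps
    by (intro UN_pairs_const[OF frac_self[OF r(1,2)] frac_self[OF r(3,4)]])
qed

lemma frac_smult:
  assumes k: "k \<in> carrier K" and r: "r \<in> carrier A" "s \<in> S"
  shows "k \<odot>\<^bsub>L\<^esub> frac_S r s = frac_S (k \<odot>\<^bsub>A\<^esub> r) s"
proof -
  \<comment> \<open>Scalars act as multiplication by \<open>k 1\<close>, which turns the claim into
    an identity in the ring.\<close>
  have smult: "k \<odot>\<^bsub>A\<^esub> x = (k \<odot>\<^bsub>A\<^esub> \<one>\<^bsub>A\<^esub>) \<otimes>\<^bsub>A\<^esub> x" if "x \<in> carrier A" for x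
    using k that by (simp add: smult_assoc2)
  have "frac_S (k \<odot>\<^bsub>A\<^esub> x) y = frac_S (k \<odot>\<^bsub>A\<^esub> r) s" if xy: "(x, y) \<in> frac_S r s" for x y
  proof -
    let ?k = "k \<odot>\<^bsub>A\<^esub> \<one>\<^bsub>A\<^esub>"
    obtain t where t: "t \<in> S" "t \<otimes>\<^bsub>A\<^esub> (r \<otimes>\<^bsub>A\<^esub> y \<ominus>\<^bsub>A\<^esub> x \<otimes>\<^bsub>A\<^esub> s) = \<zero>\<^bsub>A\<^esub>"
      using frac_memD(5)[OF xy] by blast
    note m = frac_memD(1,2)[OF xy]
    have c: "y \<in> carrier A" "s \<in> carrier A" "t \<in> carrier A" "?k \<in> carrier A"
      using m r t k by auto
    have "t \<otimes>\<^bsub>A\<^esub> ((k \<odot>\<^bsub>A\<^esub> x) \<otimes>\<^bsub>A\<^esub> s \<ominus>\<^bsub>A\<^esub> (k \<odot>\<^bsub>A\<^esub> r) \<otimes>\<^bsub>A\<^esub> y) =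
        \<ominus>\<^bsub>A\<^esub> (?k \<otimes>\<^bsub>A\<^esub> (t \<otimes>\<^bsub>A\<^esub> (r \<otimes>\<^bsub>A\<^esub> y \<ominus>\<^bsub>A\<^esub> x \<otimes>\<^bsub>A\<^esub> s)))"
      unfolding smult[OF m(1)] smult[OF r(1)] using c m r by algebra
    also have "\<dots> = \<zero>\<^bsub>A\<^esub>" using c by (simp add: t)
    finally show ?thesis using m r k t(1) by (subst frac_eq_iff) auto
  qed
  then show ?thesis
    unfolding localisation_def module.simps
    by (intro UN_pair_const[OF frac_self[OF r]])
qed

lemma localisation_one: "\<one>\<^bsub>L\<^esub> = frac_S \<one>\<^bsub>A\<^esub> \<one>\<^bsub>A\<^esub>"
  and localisation_zero: "\<zero>\<^bsub>L\<^esub> = frac_S \<zero>\<^bsub>A\<^esub> \<one>\<^bsub>A\<^esub>"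
  by (simp_all add: localisation_def)

lemmas frac_simps = frac_mult frac_add frac_smult frac_closed localisation_one localisation_zero

lemma localisation_cring: "cring L"
proof (rule cringI)
  show "abelian_group L"
  proof (rule abelian_groupI)
    show "\<zero>\<^bsub>L\<^esub> \<in> carrier L" by (simp add: frac_simps)
  next
    fix U V assume "U \<in> carrier L" "V \<in> carrier L"
    then obtain r s r' s' where UV: "U = frac_S r s" "V = frac_S r' s'"
      and m: "r \<in> carrier A" "s \<in> S" "r' \<in> carrier A" "s' \<in> S"
      by (metis localisation_carrierE)
    show "U \<oplus>\<^bsub>L\<^esub> V \<in> carrier L" using m by (simp add: UV frac_simps)
    show "U \<oplus>\<^bsub>L\<^esub> V = V \<oplus>\<^bsub>L\<^esub> U" using m by (simp add: UV frac_simps A.a_comm A.m_comm)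
  next
    fix U V W assume "U \<in> carrier L" "V \<in> carrier L" "W \<in> carrier L"
    then obtain r s r' s' r'' s'' where UV: "U = frac_S r s" "V = frac_S r' s'" "W = frac_S r'' s''"
      and m: "r \<in> carrier A" "s \<in> S" "r' \<in> carrier A" "s' \<in> S" "r'' \<in> carrier A" "s'' \<in> S"
      by (metis localisation_carrierE)
    then have c: "s \<in> carrier A" "s' \<in> carrier A" "s'' \<in> carrier A" by auto
    have "(r \<otimes>\<^bsub>A\<^esub> s' \<oplus>\<^bsub>A\<^esub> r' \<otimes>\<^bsub>A\<^esub> s) \<otimes>\<^bsub>A\<^esub> s'' \<oplus>\<^bsub>A\<^esub> r'' \<otimes>\<^bsub>A\<^esub> (s \<otimes>\<^bsub>A\<^esub> s') =
        r \<otimes>\<^bsub>A\<^esub> (s' \<otimes>\<^bsub>A\<^esub> s'') \<oplus>\<^bsub>A\<^esub> (r' \<otimes>\<^bsub>A\<^esub> s'' \<oplus>\<^bsub>A\<^esub> r'' \<otimes>\<^bsub>A\<^esub> s') \<otimes>\<^bsub>A\<^esub> s"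
      using m c by algebra
    moreover have "s \<otimes>\<^bsub>A\<^esub> s' \<otimes>\<^bsub>A\<^esub> s'' = s \<otimes>\<^bsub>A\<^esub> (s' \<otimes>\<^bsub>A\<^esub> s'')" using c by (rule A.m_assoc)
    ultimately show "U \<oplus>\<^bsub>L\<^esub> V \<oplus>\<^bsub>L\<^esub> W = U \<oplus>\<^bsub>L\<^esub> (V \<oplus>\<^bsub>L\<^esub> W)"
      using m by (simp add: UV frac_simps)
  next
    fix U assume "U \<in> carrier L"
    then obtain r s where U: "U = frac_S r s" and m: "r \<in> carrier A" "s \<in> S"
      by (metis localisation_carrierE)
    show "\<zero>\<^bsub>L\<^esub> \<oplus>\<^bsub>L\<^esub> U = U" using m by (simp add: U frac_simps)
    have "frac_S (\<ominus>\<^bsub>A\<^esub> r) s \<oplus>\<^bsub>L\<^esub> U = \<zero>\<^bsub>L\<^esub>"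
      using m by (simp add: U frac_simps A.l_minus A.l_neg, intro frac_eqI, auto)
    then show "\<exists>V \<in> carrier L. V \<oplus>\<^bsub>L\<^esub> U = \<zero>\<^bsub>L\<^esub>" using m by (auto intro: frac_closed)
  qed
  show "comm_monoid L"
  proof (rule comm_monoidI)
    show "\<one>\<^bsub>L\<^esub> \<in> carrier L" by (simp add: frac_simps)
  next
    fix U V assume "U \<in> carrier L" "V \<in> carrier L"
    then obtain r s r' s' where UV: "U = frac_S r s" "V = frac_S r' s'"
      and m: "r \<in> carrier A" "s \<in> S" "r' \<in> carrier A" "s' \<in> S"
      by (metis localisation_carrierE)
    show "U \<otimes>\<^bsub>L\<^esub> V \<in> carrier L" using m by (simp add: UV frac_simps)
    show "U \<otimes>\<^bsub>L\<^esub> V = V \<otimes>\<^bsub>L\<^esub> U" using m by (simp add: UV frac_simps A.m_comm)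
  next
    fix U V W assume "U \<in> carrier L" "V \<in> carrier L" "W \<in> carrier L"
    then obtain r s r' s' r'' s'' where UV: "U = frac_S r s" "V = frac_S r' s'" "W = frac_S r'' s''"
      and m: "r \<in> carrier A" "s \<in> S" "r' \<in> carrier A" "s' \<in> S" "r'' \<in> carrier A" "s'' \<in> S"
      by (metis localisation_carrierE)
    show "U \<otimes>\<^bsub>L\<^esub> V \<otimes>\<^bsub>L\<^esub> W = U \<otimes>\<^bsub>L\<^esub> (V \<otimes>\<^bsub>L\<^esub> W)"
      using m by (simp add: UV frac_simps A.m_assoc)
  next
    fix U assume "U \<in> carrier L"
    then obtain r s where U: "U = frac_S r s" and m: "r \<in> carrier A" "s \<in> S"
      by (metis localisation_carrierE)
    show "\<one>\<^bsub>L\<^esub> \<otimes>\<^bsub>L\<^esub> U = U" using m by (simp add: U frac_simps)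
  qed
  fix U V W assume "U \<in> carrier L" "V \<in> carrier L" "W \<in> carrier L"
  then obtain r s r' s' r'' s'' where UV: "U = frac_S r s" "V = frac_S r' s'" "W = frac_S r'' s''"
    and m: "r \<in> carrier A" "s \<in> S" "r' \<in> carrier A" "s' \<in> S" "r'' \<in> carrier A" "s'' \<in> S"
    by (metis localisation_carrierE)
  then have c: "s \<in> carrier A" "s' \<in> carrier A" "s'' \<in> carrier A" by auto
  show "(U \<oplus>\<^bsub>L\<^esub> V) \<otimes>\<^bsub>L\<^esub> W = U \<otimes>\<^bsub>L\<^esub> W \<oplus>\<^bsub>L\<^esub> V \<otimes>\<^bsub>L\<^esub> W"
    using m c by (simp add: UV frac_simps, intro frac_eqI, simp_all, algebra)
qed

lemma localisation_algebra: "algebra K L"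
proof (rule algebraI[OF K.is_cring localisation_cring])
  fix k U assume k: "k \<in> carrier K" and "U \<in> carrier L"
  then obtain r s where U: "U = frac_S r s" and m: "r \<in> carrier A" "s \<in> S"
    by (metis localisation_carrierE)
  show "k \<odot>\<^bsub>L\<^esub> U \<in> carrier L" using k m by (simp add: U frac_simps)
next
  fix U assume "U \<in> carrier L"
  then obtain r s where U: "U = frac_S r s" and m: "r \<in> carrier A" "s \<in> S"
    by (metis localisation_carrierE)
  show "\<one> \<odot>\<^bsub>L\<^esub> U = U" using m by (simp add: U frac_simps)
next
  fix k l U assume k: "k \<in> carrier K" and l: "l \<in> carrier K" and "U \<in> carrier L"
  then obtain r s where U: "U = frac_S r s" and m: "r \<in> carrier A" "s \<in> S"
    by (metis localisation_carrierE)
  have s: "s \<in> carrier A" using m by auto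
  show "(k \<otimes> l) \<odot>\<^bsub>L\<^esub> U = k \<odot>\<^bsub>L\<^esub> (l \<odot>\<^bsub>L\<^esub> U)"
    using k l m by (simp add: U frac_simps smult_assoc1)
  \<comment> \<open>Adding two fractions over \<open>s\<close> produces the denominator
    \<open>s s\<close>, so the sum has to be compared with a fraction over \<open>s\<close>.\<close>
  have "k \<odot>\<^bsub>A\<^esub> r \<in> carrier A" "l \<odot>\<^bsub>A\<^esub> r \<in> carrier A" using k l m by auto
  then have "(k \<odot>\<^bsub>A\<^esub> r \<oplus>\<^bsub>A\<^esub> l \<odot>\<^bsub>A\<^esub> r) \<otimes>\<^bsub>A\<^esub> (s \<otimes>\<^bsub>A\<^esub> s) =
      (k \<odot>\<^bsub>A\<^esub> r \<otimes>\<^bsub>A\<^esub> s \<oplus>\<^bsub>A\<^esub> l \<odot>\<^bsub>A\<^esub> r \<otimes>\<^bsub>A\<^esub> s) \<otimes>\<^bsub>A\<^esub> s"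
    using s by algebra
  then have "frac_S (k \<odot>\<^bsub>A\<^esub> r \<oplus>\<^bsub>A\<^esub> l \<odot>\<^bsub>A\<^esub> r) s =
      frac_S (k \<odot>\<^bsub>A\<^esub> r \<otimes>\<^bsub>A\<^esub> s \<oplus>\<^bsub>A\<^esub> l \<odot>\<^bsub>A\<^esub> r \<otimes>\<^bsub>A\<^esub> s) (s \<otimes>\<^bsub>A\<^esub> s)"
    using k l m s by (intro frac_eqI) simp_all
  then show "(k \<oplus> l) \<odot>\<^bsub>L\<^esub> U = k \<odot>\<^bsub>L\<^esub> U \<oplus>\<^bsub>L\<^esub> l \<odot>\<^bsub>L\<^esub> U"
    using k l m by (simp add: U frac_simps smult_l_distr)
next
  fix k U V assume k: "k \<in> carrier K" and "U \<in> carrier L" "V \<in> carrier L"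
  then obtain r s r' s' where UV: "U = frac_S r s" "V = frac_S r' s'"
    and m: "r \<in> carrier A" "s \<in> S" "r' \<in> carrier A" "s' \<in> S"
    by (metis localisation_carrierE)
  show "k \<odot>\<^bsub>L\<^esub> (U \<oplus>\<^bsub>L\<^esub> V) = k \<odot>\<^bsub>L\<^esub> U \<oplus>\<^bsub>L\<^esub> k \<odot>\<^bsub>L\<^esub> V"
    using k m by (simp add: UV frac_simps smult_r_distr smult_assoc2)
  show "(k \<odot>\<^bsub>L\<^esub> U) \<otimes>\<^bsub>L\<^esub> V = k \<odot>\<^bsub>L\<^esub> (U \<otimes>\<^bsub>L\<^esub> V)"
    using k m by (simp add: UV frac_simps smult_assoc2)
qed

lemma frac_one_hom: "(\<lambda>c. frac_S c \<one>\<^bsub>A\<^esub>) \<in> ring_hom A L"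
  by (rule ring_hom_memI) (simp_all add: frac_simps)

text \<open>The fractions with numerator in \<open>I\<close> form an ideal containing the
  generators, so \<open>c/1 = x/s\<close> with \<open>x\<close> in \<open>I\<close>. Clearing
  denominators gives \<open>t s c = t x\<close> for some \<open>t\<close> in \<open>S\<close>.
  Conversely, \<open>c/1 = (1/t) (t c/1)\<close>.\<close>

lemma frac_one_mem_genideal:
  assumes I: "ideal I A" and c: "c \<in> carrier A"
  shows "frac_S c \<one>\<^bsub>A\<^esub> \<in> genideal L ((\<lambda>c. frac_S c \<one>\<^bsub>A\<^esub>) ` I) \<longleftrightarrow> (\<exists>t \<in> S. t \<otimes>\<^bsub>A\<^esub> c \<in> I)"
proof
  interpret I: ideal I A by (rule I)
  interpret L: cring L by (rule localisation_cring)
  have Ic: "x \<in> carrier A" if "x \<in> I" for x using that I.a_subset by blast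
  let ?J = "{U. \<exists>x \<in> I. \<exists>s \<in> S. U = frac_S x s}"
  {
    assume mem: "frac_S c \<one>\<^bsub>A\<^esub> \<in> genideal L ((\<lambda>c. frac_S c \<one>\<^bsub>A\<^esub>) ` I)"
    have "ideal ?J L"
    proof (rule idealI[OF L.ring_axioms])
      show "subgroup ?J (add_monoid L)"
      proof (rule L.add.subgroupI)
        show "?J \<subseteq> carrier L" using Ic by (auto intro: frac_closed)
        show "?J \<noteq> {}" using I.zero_closed S.one_closed by blast
      next
        fix U assume "U \<in> ?J"
        then obtain x s where U: "U = frac_S x s" "x \<in> I" "s \<in> S" by blast
        have "frac_S (\<ominus>\<^bsub>A\<^esub> x) s \<oplus>\<^bsub>L\<^esub> U = \<zero>\<^bsub>L\<^esub>"
          using U Ic by (simp add: U(1) frac_simps A.l_minus A.l_neg, intro frac_eqI, auto)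
        then have "\<ominus>\<^bsub>L\<^esub> U = frac_S (\<ominus>\<^bsub>A\<^esub> x) s"
          using U Ic by (intro L.minus_equality) (auto intro: frac_closed)
        then show "\<ominus>\<^bsub>L\<^esub> U \<in> ?J" using U by blast
      next
        fix U V assume "U \<in> ?J" "V \<in> ?J"
        then obtain x s y u where UV: "U = frac_S x s" "V = frac_S y u" and
          m: "x \<in> I" "s \<in> S" "y \<in> I" "u \<in> S" by blast
        have "x \<otimes>\<^bsub>A\<^esub> u \<oplus>\<^bsub>A\<^esub> y \<otimes>\<^bsub>A\<^esub> s \<in> I" using m by (auto intro!: I.a_closed I.I_r_closed)
        then show "U \<oplus>\<^bsub>L\<^esub> V \<in> ?J" using m Ic UV S.m_closed[of s u] by (auto simp: frac_simps)
      qed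
      fix U V assume "U \<in> ?J" "V \<in> carrier L"
      then obtain x s y u where UV: "U = frac_S x s" "V = frac_S y u" and
        m: "x \<in> I" "s \<in> S" "y \<in> carrier A" "u \<in> S" by (blast elim: localisation_carrierE)
      have "x \<otimes>\<^bsub>A\<^esub> y \<in> I" "y \<otimes>\<^bsub>A\<^esub> x \<in> I" using m by (auto intro: I.I_l_closed I.I_r_closed)
      then show "V \<otimes>\<^bsub>L\<^esub> U \<in> ?J" "U \<otimes>\<^bsub>L\<^esub> V \<in> ?J"
        using m Ic UV S.m_closed[of s u] S.m_closed[of u s] by (auto simp: frac_simps)
    qed
    moreover have "(\<lambda>c. frac_S c \<one>\<^bsub>A\<^esub>) ` I \<subseteq> ?J" using S.one_closed by blast
    ultimately have "frac_S c \<one>\<^bsub>A\<^esub> \<in> ?J" using L.genideal_minimal mem by blast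
    then obtain x s where x: "x \<in> I" "s \<in> S" "frac_S c \<one>\<^bsub>A\<^esub> = frac_S x s" by blast
    then obtain t where t: "t \<in> S" "t \<otimes>\<^bsub>A\<^esub> (c \<otimes>\<^bsub>A\<^esub> s \<ominus>\<^bsub>A\<^esub> x \<otimes>\<^bsub>A\<^esub> \<one>\<^bsub>A\<^esub>) = \<zero>\<^bsub>A\<^esub>"
      using frac_eq_iff[of c "\<one>\<^bsub>A\<^esub>" x s] c Ic by auto
    have ts: "t \<in> carrier A" "s \<in> carrier A" "x \<in> carrier A" using t x Ic by auto
    have "(t \<otimes>\<^bsub>A\<^esub> s) \<otimes>\<^bsub>A\<^esub> c = t \<otimes>\<^bsub>A\<^esub> (c \<otimes>\<^bsub>A\<^esub> s \<ominus>\<^bsub>A\<^esub> x \<otimes>\<^bsub>A\<^esub> \<one>\<^bsub>A\<^esub>) \<oplus>\<^bsub>A\<^esub> t \<otimes>\<^bsub>A\<^esub> x"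
      using ts c by algebra
    also have "\<dots> = t \<otimes>\<^bsub>A\<^esub> x" unfolding t(2) using ts by simp
    also have "\<dots> \<in> I" using ts x by (auto intro: I.I_l_closed)
    finally show "\<exists>t \<in> S. t \<otimes>\<^bsub>A\<^esub> c \<in> I" using S.m_closed[OF t(1) x(2)] by blast
  }
  assume "\<exists>t \<in> S. t \<otimes>\<^bsub>A\<^esub> c \<in> I"
  then obtain t where t: "t \<in> S" "t \<otimes>\<^bsub>A\<^esub> c \<in> I" by blast
  let ?gens = "(\<lambda>c. frac_S c \<one>\<^bsub>A\<^esub>) ` I"
  have gens: "?gens \<subseteq> carrier L" using Ic by (auto intro: frac_closed)
  have "frac_S (t \<otimes>\<^bsub>A\<^esub> c) \<one>\<^bsub>A\<^esub> \<in> genideal L ?gens"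
    using L.genideal_self[OF gens] t(2) by blast
  then have "frac_S \<one>\<^bsub>A\<^esub> t \<otimes>\<^bsub>L\<^esub> frac_S (t \<otimes>\<^bsub>A\<^esub> c) \<one>\<^bsub>A\<^esub> \<in> genideal L ?gens"
    using t(1) by (intro ideal.I_l_closed[OF L.genideal_ideal[OF gens]]) (auto intro: frac_closed)
  also have "frac_S \<one>\<^bsub>A\<^esub> t \<otimes>\<^bsub>L\<^esub> frac_S (t \<otimes>\<^bsub>A\<^esub> c) \<one>\<^bsub>A\<^esub> = frac_S c \<one>\<^bsub>A\<^esub>"
    using t(1) c by (simp add: frac_simps A.m_ac, intro frac_eqI, auto)
  finally show "frac_S c \<one>\<^bsub>A\<^esub> \<in> genideal L ?gens" .
qed

lemma frac_inverse:
  assumes "s \<in> S" shows "frac_S \<one>\<^bsub>A\<^esub> s \<otimes>\<^bsub>L\<^esub> frac_S s \<one>\<^bsub>A\<^esub> = \<one>\<^bsub>L\<^esub>"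
  using assms by (simp add: frac_simps, intro frac_eqI) auto

lemma frac_cancel:
  assumes "r \<in> carrier A" "s \<in> S"
  shows "frac_S s \<one>\<^bsub>A\<^esub> \<otimes>\<^bsub>L\<^esub> frac_S r s = frac_S r \<one>\<^bsub>A\<^esub>"
  using assms by (simp add: frac_simps, intro frac_eqI) (auto simp: A.m_comm)

end

section \<open>Polynomial values in the localisation at one element\<close>

context field_algebra
begin

lemma submonoid_powers: "b \<in> carrier A \<Longrightarrow> submonoid (powers A b) A"
  by (rule submonoid.intro) (auto simp: powers_def A.nat_pow_mult intro: range_eqI[of _ _ "0::nat"])

text \<open>With \<open>y = b^n/1\<close> one has \<open>D#(a, b^n)/1 = y^d D(a/b^n)\<close>. Since
  \<open>y\<close> is a unit, the factor \<open>y^d\<close> does not affect membership in the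
  localised ideal, and \<open>t\<close> is the power of \<open>b\<close> that clears
  denominators.\<close>

lemma frac_at_mult_poly_eval_mem:
  assumes I: "ideal I A" and b: "b \<in> carrier A" and D: "D \<in> alg_signature K r"
    and a: "a \<in> {..<r} \<rightarrow> carrier A"
  shows "frac_at A b (b [^]\<^bsub>A\<^esub> (m::nat)) \<one>\<^bsub>A\<^esub> \<otimes>\<^bsub>localisation_at A b\<^esub>
      poly_eval K (localisation_at A b) (\<lambda>i. frac_at A b (a i) (b [^]\<^bsub>A\<^esub> (n::nat))) D \<in> localised_ideal A b I \<longleftrightarrow>
    (\<exists>t::nat. b [^]\<^bsub>A\<^esub> (t + m) \<otimes>\<^bsub>A\<^esub>
      poly_eval K A (case_option (b [^]\<^bsub>A\<^esub> n) a) (homogenisation K D) \<in> I)"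
proof -
  interpret loc: localised_algebra K A "powers A b"
    using k_algebra_axioms submonoid_powers[OF b] by (rule localised_algebra.intro)
  let ?L = "localisation_at A b" and ?h = "\<lambda>c. frac_at A b c \<one>\<^bsub>A\<^esub>" and ?d = "total_degree K D"
  interpret L: k_algebra K ?L by (rule k_algebraI[OF loc.localisation_algebra])
  interpret h: ring_hom_cring A ?L ?h
    by (rule ring_hom_cring.intro[OF A.is_cring L.A.is_cring])
      (simp add: ring_hom_cring_axioms_def loc.frac_one_hom)
  have pow: "b [^]\<^bsub>A\<^esub> (k::nat) \<in> powers A b" for k by (simp add: powers_def)
  define x where "x i = frac_at A b (a i) (b [^]\<^bsub>A\<^esub> n)" for i
  define y where "y = ?h (b [^]\<^bsub>A\<^esub> n)"
  \<comment> \<open>The inverse of \<open>y\<close>.\<close>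
  define z where "z = frac_at A b \<one>\<^bsub>A\<^esub> (b [^]\<^bsub>A\<^esub> n)"
  define v where "v = poly_eval K A (case_option (b [^]\<^bsub>A\<^esub> n) a) (homogenisation K D)"
  define w where "w = poly_eval K ?L x D"
  note Dp = alg_signatureD(1)[OF D]
  have x: "x \<in> {..<r} \<rightarrow> carrier ?L" using a pow[of n]
    by (auto simp: x_def Pi_iff intro!: loc.frac_closed)
  have yz: "y \<in> carrier ?L" "z \<in> carrier ?L" using b pow by (auto simp: y_def z_def intro!: loc.frac_closed)
  have one: "z \<otimes>\<^bsub>?L\<^esub> y = \<one>\<^bsub>?L\<^esub>"
    unfolding y_def z_def by (rule loc.frac_inverse[OF pow])
  have yx: "y \<otimes>\<^bsub>?L\<^esub> x i = ?h (a i)" if "i < r" for i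
    unfolding y_def x_def using a that by (intro loc.frac_cancel[OF _ pow]) auto
  have ab: "case_option (b [^]\<^bsub>A\<^esub> n) a \<in> hom_vars r \<rightarrow> carrier A"
    using a b by (intro case_option_closed) auto
  have v: "v \<in> carrier A" unfolding v_def by (rule poly_eval_closed[OF K.homogenisation_pset[OF Dp] ab])
  have w: "w \<in> carrier ?L" unfolding w_def by (rule L.poly_eval_closed[OF Dp x])
  have "?h v = poly_eval K ?L (\<lambda>u. ?h (case_option (b [^]\<^bsub>A\<^esub> n) a u)) (homogenisation K D)"
    unfolding v_def
    by (rule poly_eval_hom[OF loc.localisation_algebra loc.frac_one_hom _ K.homogenisation_pset[OF Dp] ab])
      (simp add: loc.frac_smult)
  \<comment> \<open>Each \<open>a i / 1\<close> is \<open>y\<close> times \<open>a i / b^n\<close>,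
    which gives the arguments the shape required by \<open>poly_eval_homogenisation\<close>.\<close>
  also have "\<dots> = poly_eval K ?L (case_option y (\<lambda>i. y \<otimes>\<^bsub>?L\<^esub> x i)) (homogenisation K D)"
    by (rule L.poly_eval_cong[OF K.homogenisation_pset[OF Dp]])
      (use x yz yx a in \<open>auto simp: y_def Pi_iff intro!: loc.frac_closed\<close>)
  also have "\<dots> = y [^]\<^bsub>?L\<^esub> ?d \<otimes>\<^bsub>?L\<^esub> w"
    unfolding w_def by (rule L.poly_eval_homogenisation[OF Dp x yz(1)])
  finally have hv: "?h v = y [^]\<^bsub>?L\<^esub> ?d \<otimes>\<^bsub>?L\<^esub> w" .
  have "z [^]\<^bsub>?L\<^esub> ?d \<otimes>\<^bsub>?L\<^esub> ?h v = (z [^]\<^bsub>?L\<^esub> ?d \<otimes>\<^bsub>?L\<^esub> y [^]\<^bsub>?L\<^esub> ?d) \<otimes>\<^bsub>?L\<^esub> w"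
    using yz w by (simp add: hv L.A.m_assoc)
  also have "z [^]\<^bsub>?L\<^esub> ?d \<otimes>\<^bsub>?L\<^esub> y [^]\<^bsub>?L\<^esub> ?d = \<one>\<^bsub>?L\<^esub>"
    using L.A.nat_pow_distrib[OF yz(2,1), of ?d] by (simp add: one)
  finally have wv: "w = z [^]\<^bsub>?L\<^esub> ?d \<otimes>\<^bsub>?L\<^esub> ?h v" using w by simp
  have gens: "?h ` I \<subseteq> carrier ?L"
    using ideal.Icarr[OF I] by (auto intro!: loc.frac_closed)
  interpret J: ideal "localised_ideal A b I" ?L
    unfolding localised_ideal_def by (rule L.A.genideal_ideal[OF gens])
  have bm: "?h (b [^]\<^bsub>A\<^esub> m) \<in> carrier ?L" using b by (intro loc.frac_closed) auto
  have hvc: "?h v \<in> carrier ?L" using v by (intro loc.frac_closed) auto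
  have hbv: "?h (b [^]\<^bsub>A\<^esub> m \<otimes>\<^bsub>A\<^esub> v) = ?h (b [^]\<^bsub>A\<^esub> m) \<otimes>\<^bsub>?L\<^esub> ?h v"
    using b v by (intro h.hom_mult) auto
  have "?h (b [^]\<^bsub>A\<^esub> m) \<otimes>\<^bsub>?L\<^esub> w \<in> localised_ideal A b I \<longleftrightarrow>
      ?h (b [^]\<^bsub>A\<^esub> m \<otimes>\<^bsub>A\<^esub> v) \<in> localised_ideal A b I"
  proof
    assume "?h (b [^]\<^bsub>A\<^esub> m) \<otimes>\<^bsub>?L\<^esub> w \<in> localised_ideal A b I"
    then have "y [^]\<^bsub>?L\<^esub> ?d \<otimes>\<^bsub>?L\<^esub> (?h (b [^]\<^bsub>A\<^esub> m) \<otimes>\<^bsub>?L\<^esub> w) \<in> localised_ideal A b I"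
      by (rule J.I_l_closed) (use yz in auto)
    then show "?h (b [^]\<^bsub>A\<^esub> m \<otimes>\<^bsub>A\<^esub> v) \<in> localised_ideal A b I"
      unfolding hbv hv using yz w bm by (simp add: L.A.m_lcomm)
  next
    assume "?h (b [^]\<^bsub>A\<^esub> m \<otimes>\<^bsub>A\<^esub> v) \<in> localised_ideal A b I"
    then have "z [^]\<^bsub>?L\<^esub> ?d \<otimes>\<^bsub>?L\<^esub> (?h (b [^]\<^bsub>A\<^esub> m) \<otimes>\<^bsub>?L\<^esub> ?h v) \<in> localised_ideal A b I"
      unfolding hbv by (rule J.I_l_closed) (use yz in auto)
    then show "?h (b [^]\<^bsub>A\<^esub> m) \<otimes>\<^bsub>?L\<^esub> w \<in> localised_ideal A b I"
      unfolding wv using yz bm hvc by (simp add: L.A.m_lcomm)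
  qed
  also have "\<dots> \<longleftrightarrow> (\<exists>t \<in> powers A b. t \<otimes>\<^bsub>A\<^esub> (b [^]\<^bsub>A\<^esub> m \<otimes>\<^bsub>A\<^esub> v) \<in> I)"
    unfolding localised_ideal_def using b v by (intro loc.frac_one_mem_genideal[OF I]) auto
  also have "\<dots> \<longleftrightarrow> (\<exists>t::nat. b [^]\<^bsub>A\<^esub> (t + m) \<otimes>\<^bsub>A\<^esub> v \<in> I)"
    using b v by (simp add: powers_def A.m_assoc[symmetric] A.nat_pow_mult)
  finally show ?thesis unfolding v_def w_def x_def .
qed

lemma special_radical_localised:
  assumes I: "ideal I A"
  shows "special_radical K A I = {b \<in> carrier A. \<exists>(m::nat) (n::nat) r. \<exists>D \<in> alg_signature K r.
    \<exists>a \<in> {..<r} \<rightarrow> carrier A.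
      frac_at A b (b [^]\<^bsub>A\<^esub> m) \<one>\<^bsub>A\<^esub> \<otimes>\<^bsub>localisation_at A b\<^esub>
        poly_eval K (localisation_at A b) (\<lambda>i. frac_at A b (a i) (b [^]\<^bsub>A\<^esub> n)) D
      \<in> localised_ideal A b I}"
  (is "_ = ?R")
proof (intro equalityI subsetI)
  interpret I: ideal I A by (rule I)
  fix b assume "b \<in> special_radical K A I"
  then obtain m n :: nat and r D a where b: "b \<in> carrier A"
    and D: "D \<in> alg_signature K r" "a \<in> {..<r} \<rightarrow> carrier A"
    and "b [^]\<^bsub>A\<^esub> m \<otimes>\<^bsub>A\<^esub> poly_eval K A (case_option (b [^]\<^bsub>A\<^esub> n) a) (homogenisation K D) \<in> I"
    unfolding special_radical_Sigma_gens[OF I] Sigma_gens_def by blast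
  then have "\<exists>t::nat. b [^]\<^bsub>A\<^esub> (t + m) \<otimes>\<^bsub>A\<^esub>
      poly_eval K A (case_option (b [^]\<^bsub>A\<^esub> n) a) (homogenisation K D) \<in> I"
    \<comment> \<open>No further power of \<open>b\<close> is needed in this direction. In the other
      one, the power \<open>b^t\<close> is absorbed into the exponent of the generator, which
      becomes \<open>t + m\<close>.\<close>
    by (intro exI[of _ 0]) simp
  then have "frac_at A b (b [^]\<^bsub>A\<^esub> m) \<one>\<^bsub>A\<^esub> \<otimes>\<^bsub>localisation_at A b\<^esub>
      poly_eval K (localisation_at A b) (\<lambda>i. frac_at A b (a i) (b [^]\<^bsub>A\<^esub> n)) D \<in> localised_ideal A b I"
    by (rule frac_at_mult_poly_eval_mem[OF I b D, THEN iffD2])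
  with b D show "b \<in> ?R" by blast
next
  fix b assume "b \<in> ?R"
  then obtain m n :: nat and r D a where b: "b \<in> carrier A"
    and D: "D \<in> alg_signature K r" "a \<in> {..<r} \<rightarrow> carrier A"
    and "frac_at A b (b [^]\<^bsub>A\<^esub> m) \<one>\<^bsub>A\<^esub> \<otimes>\<^bsub>localisation_at A b\<^esub>
      poly_eval K (localisation_at A b) (\<lambda>i. frac_at A b (a i) (b [^]\<^bsub>A\<^esub> n)) D \<in> localised_ideal A b I"
    by blast
  then obtain t :: nat where "b [^]\<^bsub>A\<^esub> (t + m) \<otimes>\<^bsub>A\<^esub>
      poly_eval K A (case_option (b [^]\<^bsub>A\<^esub> n) a) (homogenisation K D) \<in> I"
    by (auto simp: frac_at_mult_poly_eval_mem[OF I b D])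
  with b D show "b \<in> special_radical K A I"
    unfolding special_radical_Sigma_gens[OF I] Sigma_gens_def by blast
qed

end

theorem theorem5p4:
  fixes K :: "('k, 'x) ring_scheme" and A :: "('k, 'a, 'y) module_scheme" and I :: "'a set"
  assumes "field K" and "algebra K A" and "ideal I A"
  shows
    "special_radical K A I = {a \<in> carrier A. I \<inter> Sigma_set K A a \<noteq> {}} \<and>
     special_radical K A I =
       {b \<in> carrier A. \<exists>(m::nat) (n::nat) r. \<exists>D \<in> alg_signature K r. \<exists>a \<in> {..<r} \<rightarrow> carrier A.
          frac_at A b (b [^]\<^bsub>A\<^esub> m) \<one>\<^bsub>A\<^esub> \<otimes>\<^bsub>localisation_at A b\<^esub>
            poly_eval K (localisation_at A b) (\<lambda>i. frac_at A b (a i) (b [^]\<^bsub>A\<^esub> n)) D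
          \<in> localised_ideal A b I} \<and>
     special_radical K A I =
       {b \<in> carrier A. \<exists>(m::nat) (n::nat) r. \<exists>D \<in> alg_signature K r. \<exists>a \<in> {..<r} \<rightarrow> carrier A.
          b [^]\<^bsub>A\<^esub> m \<otimes>\<^bsub>A\<^esub>
            poly_eval K A (case_option (b [^]\<^bsub>A\<^esub> n) a) (homogenisation K D) \<in> I} \<and>
     special_radical K A I =
       {b \<in> carrier A. \<exists>(n::nat) r. \<exists>D \<in> alg_signature K r. \<exists>a \<in> {..<r} \<rightarrow> carrier A.
          b [^]\<^bsub>A\<^esub> n \<otimes>\<^bsub>A\<^esub>
            poly_eval K A (case_option (b [^]\<^bsub>A\<^esub> n) a) (homogenisation K D) \<in> I} \<and>
     special_radical K A I =
       {b \<in> carrier A. \<exists>r. \<exists>P \<in> hom_signature K r. \<exists>a \<in> {..<r} \<rightarrow> carrier A. \<exists>n::nat.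
          poly_eval K A (case_option (b [^]\<^bsub>A\<^esub> n) a) P \<in> I}"
proof -
  interpret field_algebra K A
    using assms(1,2) by (rule field_algebraI)
  note I = assms(3)
  \<comment> \<open>The third description is the condition that \<open>I\<close> meets the
    generators themselves, not just the submonoid they generate.\<close>
  have gens: "special_radical K A I =
       {b \<in> carrier A. \<exists>(m::nat) (n::nat) r. \<exists>D \<in> alg_signature K r. \<exists>a \<in> {..<r} \<rightarrow> carrier A.
          b [^]\<^bsub>A\<^esub> m \<otimes>\<^bsub>A\<^esub>
            poly_eval K A (case_option (b [^]\<^bsub>A\<^esub> n) a) (homogenisation K D) \<in> I}"
    unfolding special_radical_Sigma_gens[OF I] Sigma_gens_def by blast
  have hom: "special_radical K A I =
       {b \<in> carrier A. \<exists>r. \<exists>P \<in> hom_signature K r. \<exists>a \<in> {..<r} \<rightarrow> carrier A. \<exists>n::nat.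
          poly_eval K A (case_option (b [^]\<^bsub>A\<^esub> n) a) P \<in> I}"
    unfolding special_radical_hom_values[OF I] hom_values_def by blast
  show ?thesis
    by (intro conjI special_radical_Sigma_set[OF I] special_radical_localised[OF I] gens
        special_radical_equal_exponents[OF I] hom)
qed

end
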